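(* Let $\xi$ be a positive random variable with non-degenerate law, let $\xi_1,\xi_2,\ldots$ be independent copies of $\xi$, let $S_0=0$, $S_k=\xi_1+\ldots+\xi_k$ for $k\in\mathbb{N}$, and let $N(t)=\inf\{k\in\mathbb{N}: S_k>t\}$ for $t\ge 0$. Put $\mu=\mathbb{E}[\xi]$ and suppose $\mu<\infty$; put $\sigma^2=\mathrm{Var}[\xi]\in(0,\infty]$. Suppose that one of the following holds: (A1) $\sigma^2<\infty$; in this case put $a(t)=\sqrt{\sigma^2\mu^{-3}t}$; (A2) $\sigma^2=\infty$ and $\ell_2(t)=\mathbb{E}[\xi^2\mathbf{1}_{\{\xi\le t\}}]$ is slowly varying at $\infty$; in this case put $a(t)=\mu^{-3/2}c(t)$, where $c(t)$ is a positive function with $c(t)\to\infty$ and $\lim_{t\to\infty}t\,\ell_2(c(t))\,c(t)^{-2}=1$. Let $W$ be a standard normal random variable. Then, for every $\theta\ge 0$, $$\lim_{t\to\infty}\mathbb{E}\left[\exp\left(\theta\,\frac{N(t)-t/\mu}{a(t)}\right)\right]=\mathbb{E}[e^{\theta W}]=e^{\theta^2/2}.$$ In particular, for every $p>0$, $$\lim_{t\to\infty}\mathbb{E}\left[\left(\frac{N(t)-t/\mu}{a(t)}\right)_+^p\right]=\mathbb{E}[W_+^p]=\frac{2^{p/2-1}\Gamma(\frac{p+1}{2})}{\sqrt{\pi}}.$$ Further, in the case (A1), $$\lim_{t\to\infty}\mathbb{E}\left[\left(\frac{N(t)-t/\mu}{a(t)}\right)_-^p\right]=\mathbb{E}[W_-^p]=\frac{2^{p/2-1}\Gamma(\frac{p+1}{2})}{\sqrt{\pi}}\qquad(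 * )$$ for every $p\in[0,2]$. In the case (A2), relation $( * )$ holds for every $p\in[0,2)$, and $$\mathbb{E}[(N(t)-t/\mu)^2]\sim\frac{2t}{\mu^3}\int_0^t\left(\int_x^\infty\mathbb{P}(\xi>z)\,\mathrm{d}z\right)\mathrm{d}x\qquad\text{as }t\to\infty.$$
   Context: Non-degenerate means $\mathbb{P}(\xi=c)<1$ for all $c>0$. For real $x$, $x_+=\max\{x,0\}$ and $x_-=-\min\{x,0\}$; for $p=0$ the convention $0^0=0$ is used, so $x_-^0=\mathbf{1}_{\{x<0\}}$. A function $\ell$ that is positive for all large arguments is slowly varying at $\infty$ if $\ell(xt)/\ell(t)\to1$ as $t\to\infty$ for every $x>0$. The notation $f(t)\sim g(t)$ means $f(t)/g(t)\to 1$. $\Gamma$ is Euler's gamma function. *)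

theory Defs
  imports "HOL-Probability.Probability"
begin

text \<open>Partial sums of the steps \<open>\<xi>s 1, \<xi>s 2, \<dots>\<close>; the value \<open>\<xi>s 0\<close> is never used.\<close>

definition partial_sum :: "(nat \<Rightarrow> 'a \<Rightarrow> real) \<Rightarrow> nat \<Rightarrow> 'a \<Rightarrow> real" where
  "partial_sum \<xi>s k \<omega> = (\<Sum>i=1..k. \<xi>s i \<omega>)"

text \<open>For i.i.d. positive steps the set below is almost surely nonempty; on the exceptional
  null set the infimum of the empty set of natural numbers is \<open>0\<close>.\<close>

definition first_passage :: "(nat \<Rightarrow> 'a \<Rightarrow> real) \<Rightarrow> real \<Rightarrow> 'a \<Rightarrow> nat" where
  "first_passage \<xi>s t \<omega> = Inf {k. 1 \<le> k \<and> t < partial_sum \<xi>s k \<omega>}"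

text \<open>Variance with values in \<open>[0,\<infinity>]\<close>, for integrable random variables.\<close>

definition ext_variance :: "'a measure \<Rightarrow> ('a \<Rightarrow> real) \<Rightarrow> ennreal" where
  "ext_variance M X = (\<integral>\<^sup>+\<omega>. ennreal ((X \<omega> - prob_space.expectation M X)\<^sup>2) \<partial>M)"

definition truncated_second_moment :: "'a measure \<Rightarrow> ('a \<Rightarrow> real) \<Rightarrow> real \<Rightarrow> real" where
  "truncated_second_moment M X t =
     prob_space.expectation M (\<lambda>\<omega>. (X \<omega>)\<^sup>2 * indicator {\<omega>. X \<omega> \<le> t} \<omega>)"

definition slowly_varying :: "(real \<Rightarrow> real) \<Rightarrow> bool" where
  "slowly_varying l \<longleftrightarrow> (\<forall>\<^sub>F t in at_top. 0 < l t) \<and>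
     (\<forall>x>0. ((\<lambda>t. l (x * t) / l t) \<longlongrightarrow> 1) at_top)"

definition finite_variance_case :: "'a measure \<Rightarrow> ('a \<Rightarrow> real) \<Rightarrow> (real \<Rightarrow> real) \<Rightarrow> bool" where
  "finite_variance_case M X a \<longleftrightarrow>
     ext_variance M X < \<infinity> \<and>
     (\<forall>t\<ge>0. a t = sqrt (enn2real (ext_variance M X) * prob_space.expectation M X powr (-3) * t))"

definition infinite_variance_case ::
    "'a measure \<Rightarrow> ('a \<Rightarrow> real) \<Rightarrow> (real \<Rightarrow> real) \<Rightarrow> (real \<Rightarrow> real) \<Rightarrow> bool" where
  "infinite_variance_case M X c a \<longleftrightarrow>
     ext_variance M X = \<infinity> \<and>
     slowly_varying (truncated_second_moment M X) \<and>
     (\<forall>t>0. 0 < c t) \<and> filterlim c at_top at_top \<and>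
     ((\<lambda>t. t * truncated_second_moment M X (c t) / (c t)\<^sup>2) \<longlongrightarrow> 1) at_top \<and>
     (\<forall>t>0. a t = prob_space.expectation M X powr (-3/2) * c t)"

text \<open>Positive and negative parts raised to the power \<open>p\<close>. Since \<open>0 powr 0 = 0\<close>, the case
  \<open>p = 0\<close> follows the convention \<open>0\<^sup>0 = 0\<close>: e.g. \<open>neg_part_pow 0\<close> is the indicator of \<open>{x. x < 0}\<close>.\<close>

definition pos_part_pow :: "real \<Rightarrow> real \<Rightarrow> real" where
  "pos_part_pow p x = max x 0 powr p"

definition neg_part_pow :: "real \<Rightarrow> real \<Rightarrow> real" where
  "neg_part_pow p x = (- min x 0) powr p"

end

theory Submission
  imports Defs
begin

text \<open>
  Everything rests on stopping at \<open>N = N(t)\<close> sums and products of functions of the steps. Write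
  \<open>Z = (N - t / \<mu>) / a(t)\<close> and \<open>\<ell>\<^sub>2(y) = E[\<xi>\<^sup>2; \<xi> \<le> y]\<close>; in both cases \<open>\<ell>\<^sub>2\<close> is slowly varying, hence
  \<open>y E[\<xi>; \<xi> > y] = o(\<ell>\<^sub>2(y))\<close>.

  Truncating the steps at \<open>a(t)\<close>, the stopped exponential supermartingale bounds \<open>E exp (\<theta> Z)\<close> for every
  \<open>\<theta> \<ge> 0\<close>; with Wald's \<open>\<mu> E N \<ge> t\<close> this bounds \<open>E \<bar>Z\<bar>\<close>. The stopped product of
  \<open>exp (- i u (\<xi>\<^sub>k - \<mu>) + \<kappa> / t)\<close> with \<open>u = \<theta> / (\<mu> a(t))\<close> and \<open>\<kappa> = \<theta>\<^sup>2 \<mu> / 2\<close> has mean \<open>1 + o(1)\<close> and differs from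
  \<open>exp (i \<theta> Z + \<theta>\<^sup>2 / 2)\<close> by a negligible error, so \<open>Z\<close> is asymptotically normal by Levy's continuity theorem. Exponential
  bounds make \<open>exp (\<theta> Z)\<close> and the powers of the positive part uniformly integrable. For the negative part,
  Chebyshev's inequality for truncated steps gives \<open>P(Z < - 2\<^sup>j) \<le> C r\<^sup>j\<close> with any \<open>r > 1 / 4\<close>.

  For second moments the steps are truncated at \<open>2 t\<close>, which does not change \<open>N\<close>. Wald's second identity gives the
  main term, and the squared overshoot has mean \<open>O(E[min(\<xi>, 2 t)\<^sup>3]) = o(t \<ell>\<^sub>2(t))\<close>.
\<close>

subsection \<open>Stopped sums and products of independent steps\<close>

text \<open>A large value of \<open>N\<close> requires many small steps, which positivity makes
  exponentially unlikely; a small value requires only one large step. Hence all exponential moments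
  are available above, but only powers up to 2 below. A negative power \<open>p < 2\<close> is
  controlled by a bound for a slightly larger power. At \<open>p = 2\<close> no larger power is
  left: there \<open>E Z^2\<close> is computed, and the limit of the positive part is subtracted.

  One scheme serves both variance cases. It uses the limits \<open>L\<close> of
  \<open>t * trunc2 (a t) / (a t)^2\<close> and \<open>L'\<close> of \<open>t / (a t)^2\<close> only
  through \<open>L - mu^2 * L' = mu^3\<close>, which says that the variance of a step truncated at
  \<open>a t\<close> has the right size. For infinite variance \<open>mu^2\<close> is negligible
  against \<open>trunc2\<close>, so \<open>L' = 0\<close>.

  The second moment lives on another scale. Steps between \<open>a t\<close> and \<open>t\<close>
  are too rare to affect the limit law, yet they can contribute to \<open>E (N - t / mu)^2\<close>.
  The truncation level there is therefore of order \<open>t\<close>, and the answer contains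
  \<open>trunc2 t\<close> instead of \<open>trunc2 (a t)\<close>; the double tail integral of the
  theorem is asymptotically half of it.\<close>

locale renewal = prob_space +
  fixes xi :: "'a \<Rightarrow> real" and X :: "nat \<Rightarrow> 'a \<Rightarrow> real"
  assumes xi_rv [measurable]: "random_variable borel xi"
    and xi_pos: "AE \<omega> in M. 0 < xi \<omega>"
    and indep: "indep_vars (\<lambda>_. borel) X {1..}"
    and ident: "\<And>k. k \<ge> 1 \<Longrightarrow> distr M borel (X k) = distr M borel xi"
    and xi_int: "integrable M xi"
begin

definition past :: "nat \<Rightarrow> 'a measure" where
  "past n = vimage_algebra (space M) (\<lambda>\<omega>. \<lambda>i\<in>{1..n}. X i \<omega>) (PiM {1..n} (\<lambda>_. borel))"

text \<open>Stands for \<open>k < N t \<omega>\<close>, with which it agrees on an almost sure event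
  (\<open>alive_iff\<close>). Written through partial sums it visibly depends on the first
  \<open>k\<close> steps only, and it is not disturbed by the default value 0 of the infimum on the
  exceptional null set.\<close>

definition alive :: "real \<Rightarrow> nat \<Rightarrow> 'a \<Rightarrow> bool" where
  "alive t k \<omega> \<longleftrightarrow> (\<forall>j\<in>{1..k}. partial_sum X j \<omega> \<le> t)"

lemma X_rv [measurable]: "random_variable borel (X (Suc k))"
  using indep by (auto simp: indep_vars_def)

lemma X_rv': "k \<ge> 1 \<Longrightarrow> random_variable borel (X k)"
  using indep by (auto simp: indep_vars_def)

lemma space_past [simp]: "space (past n) = space M"
  by (simp add: past_def)

lemma restrict_X_measurable:
  "(\<lambda>\<omega>. \<lambda>i\<in>{1..n}. X i \<omega>) \<in> measurable M (PiM {1..n} (\<lambda>_. borel))"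
  by (intro measurable_restrict) (auto intro: X_rv')

lemma sets_past_le: "sets (past n) \<subseteq> events"
  unfolding past_def by (intro sets_image_in_sets restrict_X_measurable) simp

lemma measurable_pastD: "f \<in> measurable (past n) N \<Longrightarrow> f \<in> measurable M N"
  using sets_past_le[of n] unfolding measurable_def by auto

lemma X_past: "1 \<le> i \<Longrightarrow> i \<le> n \<Longrightarrow> X i \<in> borel_measurable (past n)"
proof -
  assume i: "1 \<le> i" "i \<le> n"
  have "(\<lambda>\<omega>. \<lambda>i\<in>{1..n}. X i \<omega>) \<in> measurable (past n) (PiM {1..n} (\<lambda>_. borel))"
    unfolding past_def by (intro measurable_vimage_algebra1) (auto simp: space_PiM)
  from measurable_compose[OF this measurable_component_singleton[of i]] show ?thesis
    using i by simp
qed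

lemma partial_sum_past: "k \<le> n \<Longrightarrow> partial_sum X k \<in> borel_measurable (past n)"
  unfolding partial_sum_def[abs_def] by (intro borel_measurable_sum X_past) auto

lemma partial_sum_rv [measurable]: "random_variable borel (partial_sum X k)"
  using partial_sum_past[of k k] by (auto intro: measurable_pastD)

lemma alive_past: "k \<le> n \<Longrightarrow> Measurable.pred (past n) (alive t k)"
proof -
  assume "k \<le> n"
  then have [measurable]: "partial_sum X j \<in> borel_measurable (past n)" if "j \<in> {1..k}" for j
    using that by (intro partial_sum_past) auto
  show ?thesis
    unfolding alive_def[abs_def] by measurable
qed

lemma alive_rv [measurable]: "Measurable.pred M (alive t k)"
  using alive_past[of k k] by (auto intro: measurable_pastD)

lemma alive_0 [simp]: "alive t 0 \<omega>"
  by (simp add: alive_def)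

text \<open>The coordinate blocks \<open>{1..n}\<close> and \<open>{Suc n}\<close> are independent,
  and independence is inherited by the smaller sigma-algebras generated by \<open>f\<close> and by
  \<open>g (X (Suc n))\<close>. The value type is left general because real, complex and extended
  nonnegative functions all occur later.\<close>

lemma indep_past:
  assumes f: "f \<in> borel_measurable (past n)" and g: "g \<in> borel_measurable borel"
  shows "indep_var (borel :: 'b :: topological_space measure) f borel (\<lambda>\<omega>. g (X (Suc n) \<omega>))"
proof -
  have rv: "random_variable borel f"
    using f by (rule measurable_pastD)
  have "indep_var (PiM {1..n} (\<lambda>_. borel)) (\<lambda>\<omega>. restrict (\<lambda>i. X i \<omega>) {1..n})
      (PiM {Suc n} (\<lambda>_. borel)) (\<lambda>\<omega>. restrict (\<lambda>i. X i \<omega>) {Suc n})"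
    by (rule indep_var_restrict[OF indep]) auto
  then have "indep_set (sets (past n)) (sigma_sets (space M)
      {(\<lambda>\<omega>. restrict (\<lambda>i. X i \<omega>) {Suc n}) -` A \<inter> space M | A. A \<in> sets (PiM {Suc n} (\<lambda>_. borel))})"
    unfolding indep_var_eq by (simp add: past_def sets_vimage_algebra)
  moreover have "sigma_sets (space M) {f -` A \<inter> space M | A. A \<in> sets borel} \<subseteq> sets (past n)"
    using f by (intro sets.sigma_sets_subset[of _ "past n", simplified]) (auto dest: measurable_sets)
  moreover have "sigma_sets (space M) {(\<lambda>\<omega>. g (X (Suc n) \<omega>)) -` A \<inter> space M | A. A \<in> sets borel} \<subseteq>
     sigma_sets (space M)
      {(\<lambda>\<omega>. restrict (\<lambda>i. X i \<omega>) {Suc n}) -` A \<inter> space M | A. A \<in> sets (PiM {Suc n} (\<lambda>_. borel))}"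
  proof (rule sigma_sets_mono', safe)
    fix A :: "'b set" assume "A \<in> sets borel"
    moreover have "(\<lambda>h. g (h (Suc n))) \<in> borel_measurable (PiM {Suc n} (\<lambda>_. borel))"
      by (rule measurable_compose[OF _ g]) (rule measurable_component_singleton, simp)
    ultimately have "(\<lambda>h. g (h (Suc n))) -` A \<inter> space (PiM {Suc n} (\<lambda>_. borel)) \<in> sets (PiM {Suc n} (\<lambda>_. borel))"
      by (rule measurable_sets[rotated])
    moreover have "(\<lambda>\<omega>. g (X (Suc n) \<omega>)) -` A \<inter> space M = (\<lambda>\<omega>. restrict (\<lambda>i. X i \<omega>) {Suc n}) -`
       ((\<lambda>h. g (h (Suc n))) -` A \<inter> space (PiM {Suc n} (\<lambda>_. borel))) \<inter> space M"
      by (auto simp: space_PiM)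
    ultimately show "\<exists>B. (\<lambda>\<omega>. g (X (Suc n) \<omega>)) -` A \<inter> space M = (\<lambda>\<omega>. restrict (\<lambda>i. X i \<omega>) {Suc n}) -` B \<inter> space M \<and>
        B \<in> sets (PiM {Suc n} (\<lambda>_. borel))"
      by blast
  qed
  ultimately have "indep_set (sigma_sets (space M) {f -` A \<inter> space M | A. A \<in> sets borel})
      (sigma_sets (space M) {(\<lambda>\<omega>. g (X (Suc n) \<omega>)) -` A \<inter> space M | A. A \<in> sets borel})"
    unfolding indep_set_def by (elim indep_sets_mono_sets) (auto split: bool.split)
  then show ?thesis
    unfolding indep_var_eq using rv g by simp
qed

text \<open>Takes the place of conditional expectations: every martingale computation below
  multiplies a function of the past by a function of one fresh step.\<close>

lemma next_step:
  fixes f :: "'a \<Rightarrow> 'b :: {real_normed_field, banach, second_countable_topology}"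
  assumes f: "f \<in> borel_measurable (past n)" "integrable M f"
    and g: "g \<in> borel_measurable borel" "integrable M (\<lambda>\<omega>. g (xi \<omega>))"
  shows "integrable M (\<lambda>\<omega>. f \<omega> * g (X (Suc n) \<omega>))" (is ?I)
    and "expectation (\<lambda>\<omega>. f \<omega> * g (X (Suc n) \<omega>)) = expectation f * expectation (\<lambda>\<omega>. g (xi \<omega>))" (is ?E)
proof -
  have "integrable (distr M borel xi) g"
    using g by (subst integrable_distr_eq) auto
  then have int: "integrable M (\<lambda>\<omega>. g (X (Suc n) \<omega>))"
    using g by (subst (asm) ident[of "Suc n", symmetric]) (auto simp: integrable_distr_eq)
  have "(\<integral>x. g x \<partial>distr M borel (X (Suc n))) = (\<integral>x. g x \<partial>distr M borel xi)"
    using ident[of "Suc n"] by simp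
  then have eq: "expectation (\<lambda>\<omega>. g (X (Suc n) \<omega>)) = expectation (\<lambda>\<omega>. g (xi \<omega>))"
    using g by (simp add: integral_distr)
  show ?I ?E
    using indep_var_integrable[OF indep_past[OF f(1) g(1)] f(2) int]
      indep_var_lebesgue_integral[OF indep_past[OF f(1) g(1)] f(2) int] eq by auto
qed

text \<open>The extended nonnegative version needs no integrability, so sums over all
  \<open>k\<close> can be formed before anything is known to be finite.\<close>

lemma nn_next_step:
  fixes f :: "'a \<Rightarrow> ennreal"
  assumes f: "f \<in> borel_measurable (past n)" and g: "g \<in> borel_measurable borel"
  shows "(\<integral>\<^sup>+\<omega>. f \<omega> * g (X (Suc n) \<omega>) \<partial>M) = (\<integral>\<^sup>+\<omega>. f \<omega> \<partial>M) * (\<integral>\<^sup>+\<omega>. g (xi \<omega>) \<partial>M)"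
proof -
  have "(\<integral>\<^sup>+x. g x \<partial>distr M borel (X (Suc n))) = (\<integral>\<^sup>+x. g x \<partial>distr M borel xi)"
    using ident[of "Suc n"] by simp
  then have eq: "(\<integral>\<^sup>+\<omega>. g (X (Suc n) \<omega>) \<partial>M) = (\<integral>\<^sup>+\<omega>. g (xi \<omega>) \<partial>M)"
    using g by (simp add: nn_integral_distr)
  define h where "h = case_bool f (\<lambda>\<omega>. g (X (Suc n) \<omega>))"
  have "indep_vars (case_bool borel borel) h UNIV"
    using indep_past[OF f g] by (simp add: indep_var_def h_def)
  also have "case_bool borel borel = (\<lambda>_. borel)"
    by (auto simp: fun_eq_iff split: bool.split)
  finally have "(\<integral>\<^sup>+\<omega>. (\<Prod>i\<in>UNIV. h i \<omega>) \<partial>M) = (\<Prod>i\<in>UNIV. \<integral>\<^sup>+\<omega>. h i \<omega> \<partial>M)"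
    by (intro indep_vars_nn_integral) auto
  then show ?thesis
    by (simp add: UNIV_bool h_def eq mult.commute)
qed

lemma ident_AE:
  assumes [measurable]: "Measurable.pred borel P" and "AE \<omega> in M. P (xi \<omega>)"
  shows "AE \<omega> in M. P (X (Suc n) \<omega>)"
proof -
  have "AE x in distr M borel (X (Suc n)). P x"
    unfolding ident[of "Suc n", simplified] using assms by (subst AE_distr_iff) auto
  then show ?thesis
    by (subst (asm) AE_distr_iff) auto
qed

lemma AE_steps_pos: "AE \<omega> in M. \<forall>k\<ge>1. 0 < X k \<omega>"
proof -
  have "AE \<omega> in M. \<forall>k. 0 < X (Suc k) \<omega>"
    unfolding AE_all_countable using ident_AE[of "\<lambda>x. 0 < x"] xi_pos by auto
  then show ?thesis
    by eventually_elim (auto simp: Suc_le_eq dest!: gr0_implies_Suc)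
qed

text \<open>The weight \<open>f k\<close> is known before step \<open>Suc k\<close> is drawn. With
  the indicator of \<open>alive\<close> this is Wald's identity; the freedom in \<open>f\<close> is
  needed to count visits of the walk to an interval when the overshoot is estimated.\<close>

lemma wald_nn:
  assumes g [measurable]: "g \<in> borel_measurable borel"
    and f: "\<And>k. f k \<in> borel_measurable (past k)"
  shows "(\<integral>\<^sup>+\<omega>. (\<Sum>k. f k \<omega> * g (X (Suc k) \<omega>)) \<partial>M)
    = (\<integral>\<^sup>+\<omega>. (\<Sum>k. f k \<omega>) \<partial>M) * (\<integral>\<^sup>+\<omega>. g (xi \<omega>) \<partial>M)"
proof -
  have [measurable]: "f k \<in> borel_measurable M" for k
    using f by (rule measurable_pastD)
  show ?thesis
    by (simp add: nn_integral_suminf nn_next_step[OF f g])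
qed

text \<open>Telescoping: the increment of \<open>G\<close> at \<open>n\<close> is
  \<open>G n * of_bool (alive t n) * (\<psi> (X (Suc n)) - 1)\<close>, a past factor times a fresh
  one. An exact formula serves two purposes: for real \<open>\<psi>\<close> of mean at most 1 it
  gives a supermartingale bound, for complex \<open>\<psi>\<close> of mean close to 1 it quantifies
  the defect from being a martingale.\<close>

lemma stopped_prod:
  fixes \<psi> :: "real \<Rightarrow> 'b :: {real_normed_field, banach, second_countable_topology}" and t :: real
  assumes \<psi> [measurable]: "\<psi> \<in> borel_measurable borel" and int: "integrable M (\<lambda>\<omega>. \<psi> (xi \<omega>))"
  defines "G \<equiv> \<lambda>n \<omega>. \<Prod>k<n. if alive t k \<omega> then \<psi> (X (Suc k) \<omega>) else 1"
  shows "integrable M (G n)"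
    and "expectation (G n) = 1 + (\<Sum>k<n. expectation (\<lambda>\<omega>. G k \<omega> * of_bool (alive t k \<omega>)))
      * (expectation (\<lambda>\<omega>. \<psi> (xi \<omega>)) - 1)"
proof -
  have past: "G n \<in> borel_measurable (past n)" for n
  proof -
    have [measurable]: "Measurable.pred (past n) (alive t k)" "X (Suc k) \<in> borel_measurable (past n)"
      if "k < n" for k
      using that by (auto intro: alive_past X_past)
    show ?thesis
      unfolding G_def by measurable
  qed
  have step: "G (Suc n) \<omega> = G n \<omega> + (G n \<omega> * of_bool (alive t n \<omega>)) * (\<psi> (X (Suc n) \<omega>) - 1)" for n \<omega>
    by (simp add: G_def algebra_simps)
  have past': "(\<lambda>\<omega>. G n \<omega> * of_bool (alive t n \<omega>)) \<in> borel_measurable (past n)" for n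
    using past[of n] alive_past[of n n t] by measurable
  have int': "integrable M (\<lambda>\<omega>. G n \<omega> * of_bool (alive t n \<omega>))" if "integrable M (G n)" for n
    using that by (rule Bochner_Integration.integrable_bound)
      (auto intro!: measurable_pastD[OF past'] AE_I2)
  have main: "integrable M (G n) \<and> expectation (G n) =
     1 + (\<Sum>k<n. expectation (\<lambda>\<omega>. G k \<omega> * of_bool (alive t k \<omega>))) * (expectation (\<lambda>\<omega>. \<psi> (xi \<omega>)) - 1)"
  proof (induction n)
    case 0
    show ?case by (simp add: G_def prob_space)
  next
    case (Suc n)
    have [simp]: "(\<lambda>x. \<psi> x - 1) \<in> borel_measurable borel"
      by simp
    note ns = next_step[OF past'[of n] int', of "\<lambda>x. \<psi> x - 1"]
    have i2: "integrable M (\<lambda>\<omega>. (G n \<omega> * of_bool (alive t n \<omega>)) * (\<psi> (X (Suc n) \<omega>) - 1))"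
      and e2: "expectation (\<lambda>\<omega>. (G n \<omega> * of_bool (alive t n \<omega>)) * (\<psi> (X (Suc n) \<omega>) - 1))
        = expectation (\<lambda>\<omega>. G n \<omega> * of_bool (alive t n \<omega>)) * (expectation (\<lambda>\<omega>. \<psi> (xi \<omega>)) - 1)"
      using ns Suc int by (auto simp: prob_space)
    have "G (Suc n) = (\<lambda>\<omega>. G n \<omega> + (G n \<omega> * of_bool (alive t n \<omega>)) * (\<psi> (X (Suc n) \<omega>) - 1))"
      using step by (rule ext)
    then show ?case
      using Suc i2 e2 by (simp only: Bochner_Integration.integrable_add Bochner_Integration.integral_add)
        (simp add: algebra_simps)
  qed
  from main show "integrable M (G n)" "expectation (G n) = 1 + (\<Sum>k<n. expectation (\<lambda>\<omega>. G k \<omega> * of_bool (alive t k \<omega>)))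
      * (expectation (\<lambda>\<omega>. \<psi> (xi \<omega>)) - 1)" by auto
qed

text \<open>In the square of \<open>S (Suc n)\<close> the cross term is a past factor times a fresh
  centred one and has mean zero; only the diagonal terms survive, each weighted by the probability
  that the walk is still alive.\<close>

lemma stopped_sum_square:
  fixes g :: "real \<Rightarrow> real" and t :: real
  assumes g [measurable]: "g \<in> borel_measurable borel" and int: "integrable M (\<lambda>\<omega>. g (xi \<omega>))"
    and int2: "integrable M (\<lambda>\<omega>. (g (xi \<omega>))\<^sup>2)" and zero: "expectation (\<lambda>\<omega>. g (xi \<omega>)) = 0"
  defines "S \<equiv> \<lambda>n \<omega>. \<Sum>k<n. of_bool (alive t k \<omega>) * g (X (Suc k) \<omega>)"
  shows "integrable M (\<lambda>\<omega>. (S n \<omega>)\<^sup>2)"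
    and "expectation (\<lambda>\<omega>. (S n \<omega>)\<^sup>2) = (\<Sum>k<n. prob {\<omega>\<in>space M. alive t k \<omega>}) * expectation (\<lambda>\<omega>. (g (xi \<omega>))\<^sup>2)"
proof -
  have past: "S n \<in> borel_measurable (past n)" for n
  proof -
    have [measurable]: "Measurable.pred (past n) (alive t k)" "X (Suc k) \<in> borel_measurable (past n)"
      if "k < n" for k
      using that by (auto intro: alive_past X_past)
    show ?thesis
      unfolding S_def by measurable
  qed
  have alive: "(\<lambda>\<omega>. of_bool (alive t n \<omega>) :: real) \<in> borel_measurable (past n)" for n
    using alive_past[of n n t] by measurable
  have inta: "integrable M (\<lambda>\<omega>. of_bool (alive t n \<omega>) :: real)" for n
    by (rule integrable_const_bound[of _ 1]) auto
  have ea: "expectation (\<lambda>\<omega>. of_bool (alive t n \<omega>)) = prob {\<omega>\<in>space M. alive t n \<omega>}" for n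
  proof -
    have "expectation (\<lambda>\<omega>. of_bool (alive t n \<omega>)) = expectation (indicat_real {\<omega>\<in>space M. alive t n \<omega>})"
      by (intro Bochner_Integration.integral_cong) (auto simp: indicator_def)
    then show ?thesis by simp
  qed
  have past': "(\<lambda>\<omega>. S n \<omega> * of_bool (alive t n \<omega>)) \<in> borel_measurable (past n)" for n
    using past[of n] alive[of n] by measurable
  have int1: "integrable M (S n) " for n
    unfolding S_def by (intro Bochner_Integration.integrable_sum next_step[OF alive inta g int])
  have int1': "integrable M (\<lambda>\<omega>. S n \<omega> * of_bool (alive t n \<omega>))" for n
    using int1[of n] by (rule Bochner_Integration.integrable_bound)
      (auto intro!: measurable_pastD[OF past'] AE_I2)
  have step: "(S (Suc n) \<omega>)\<^sup>2 = (S n \<omega>)\<^sup>2 + 2 * ((S n \<omega> * of_bool (alive t n \<omega>)) * g (X (Suc n) \<omega>))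
      + of_bool (alive t n \<omega>) * (g (X (Suc n) \<omega>))\<^sup>2" for n \<omega>
  proof -
    have "S (Suc n) \<omega> = S n \<omega> + of_bool (alive t n \<omega>) * g (X (Suc n) \<omega>)"
      unfolding S_def by (rule sum.lessThan_Suc)
    then show ?thesis
      by (cases "alive t n \<omega>") (simp_all add: power2_eq_square algebra_simps)
  qed
  have main: "integrable M (\<lambda>\<omega>. (S n \<omega>)\<^sup>2) \<and>
    expectation (\<lambda>\<omega>. (S n \<omega>)\<^sup>2) = (\<Sum>k<n. prob {\<omega>\<in>space M. alive t k \<omega>}) * expectation (\<lambda>\<omega>. (g (xi \<omega>))\<^sup>2)"
  proof (induction n)
    case 0
    show ?case by (simp add: S_def)
  next
    case (Suc n)
    have g2: "(\<lambda>x. (g x)\<^sup>2) \<in> borel_measurable borel" by measurable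
    note n1 = next_step[OF past'[of n] int1' g int]
    note n2 = next_step[OF alive[of n] inta g2 int2]
    show ?case
      using Suc n1 n2 zero unfolding step
      by (simp add: algebra_simps ea del: of_bool_eq)
  qed
  then show "integrable M (\<lambda>\<omega>. (S n \<omega>)\<^sup>2)"
     "expectation (\<lambda>\<omega>. (S n \<omega>)\<^sup>2) = (\<Sum>k<n. prob {\<omega>\<in>space M. alive t k \<omega>}) * expectation (\<lambda>\<omega>. (g (xi \<omega>))\<^sup>2)"
    by auto
qed

end

subsection \<open>The first passage time and Wald identities\<close>

lemma first_passage_measurable [measurable]:
  assumes [measurable]: "\<And>k. partial_sum X k \<in> borel_measurable M"
  shows "first_passage X t \<in> measurable M (count_space UNIV)"
  unfolding first_passage_def[abs_def] Inf_nat_def mem_Collect_eq by measurable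

context renewal
begin

\<comment> \<open>These rules would turn sums of indicators into cardinalities.\<close>
declare sum_of_bool_eq [simp del] sum_of_bool_mult_eq [simp del] sum_mult_of_bool_eq [simp del]

abbreviation N :: "real \<Rightarrow> 'a \<Rightarrow> nat" where
  "N \<equiv> first_passage X"

abbreviation mean_N :: "real \<Rightarrow> real" where
  "mean_N t \<equiv> expectation (\<lambda>\<omega>. real (N t \<omega>))"

abbreviation tail0 :: "real \<Rightarrow> real" where
  "tail0 y \<equiv> prob {\<omega>\<in>space M. y < xi \<omega>}"

text \<open>The almost sure event on which all pathwise arguments run: the steps are positive, and
  the level is eventually passed, so the infimum in \<open>first_passage\<close> is a true
  minimum.\<close>

definition good :: "real \<Rightarrow> 'a \<Rightarrow> bool" where
  "good t \<omega> \<longleftrightarrow> (\<forall>k. 0 < X (Suc k) \<omega>) \<and> (\<exists>k. \<not> alive t k \<omega>)"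

lemma partial_sum_0 [simp]: "partial_sum X 0 \<omega> = 0"
  by (simp add: partial_sum_def)

lemma partial_sum_Suc: "partial_sum X (Suc n) \<omega> = partial_sum X n \<omega> + X (Suc n) \<omega>"
  by (simp add: partial_sum_def)

lemma partial_sum_eq: "partial_sum X n \<omega> = (\<Sum>k<n. X (Suc k) \<omega>)"
  by (induction n) (simp_all add: partial_sum_Suc)

lemma alive_le: "alive t n \<omega> \<Longrightarrow> 0 \<le> t \<Longrightarrow> partial_sum X n \<omega> \<le> t"
  by (cases n) (auto simp: alive_def)

lemma alive_iff: "good t \<omega> \<Longrightarrow> alive t k \<omega> \<longleftrightarrow> k < N t \<omega>"
proof -
  assume "good t \<omega>"
  then have ne: "{k. 1 \<le> k \<and> t < partial_sum X k \<omega>} \<noteq> {}" (is "?A \<noteq> _")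
    by (auto simp: good_def alive_def not_le) (metis Suc_le_eq)
  have N: "N t \<omega> = Inf ?A"
    by (simp add: first_passage_def)
  have "N t \<omega> \<in> ?A"
    unfolding N using ne by (rule Inf_nat_def1)
  moreover have "N t \<omega> \<le> j" if "j \<in> ?A" for j
    unfolding N using that by (simp add: cInf_lower)
  ultimately show ?thesis
    unfolding alive_def by (force simp: not_le[symmetric] simp del: not_le)
qed

lemma good_sum_pos: "good t \<omega> \<Longrightarrow> 0 \<le> t \<Longrightarrow> t < partial_sum X (N t \<omega>) \<omega> \<and> 0 < N t \<omega>"
proof -
  assume g: "good t \<omega>" and "0 \<le> t"
  have "\<not> alive t (N t \<omega>) \<omega>" "0 < N t \<omega>"
    using alive_iff[OF g, of "N t \<omega>"] alive_iff[OF g, of 0] by auto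
  moreover have "alive t (N t \<omega> - 1) \<omega>"
    using alive_iff[OF g] \<open>0 < N t \<omega>\<close> by simp
  ultimately show ?thesis
    unfolding alive_def by (metis One_nat_def Suc_diff_1 atLeastAtMost_iff le_Suc_eq not_le)
qed

lemma N_rv [measurable]: "N t \<in> measurable M (count_space UNIV)"
  by (rule first_passage_measurable) simp

lemma stopped_sum_eq:
  fixes h :: "nat \<Rightarrow> 'c :: semiring_1"
  assumes "good t \<omega>"
  shows "(\<Sum>k<n. of_bool (alive t k \<omega>) * h k) = (\<Sum>k<min n (N t \<omega>). h k)"
proof -
  have "(\<Sum>k<n. of_bool (alive t k \<omega>) * h k) = (\<Sum>k\<in>{..<n}. if k < N t \<omega> then h k else 0)"
    using alive_iff[OF assms] by (intro sum.cong) auto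
  also have "\<dots> = (\<Sum>k\<in>{k \<in> {..<n}. k < N t \<omega>}. h k)"
    by (intro sum.inter_filter[symmetric]) simp
  also have "{k \<in> {..<n}. k < N t \<omega>} = {..<min n (N t \<omega>)}"
    by auto
  finally show ?thesis .
qed

lemma stopped_prod_eq:
  fixes h :: "nat \<Rightarrow> 'c :: comm_semiring_1"
  assumes "good t \<omega>"
  shows "(\<Prod>k<n. if alive t k \<omega> then h k else 1) = (\<Prod>k<min n (N t \<omega>). h k)"
proof -
  have "(\<Prod>k<n. if alive t k \<omega> then h k else 1) = (\<Prod>k\<in>{..<n}. if k < N t \<omega> then h k else 1)"
    using alive_iff[OF assms] by (intro prod.cong) auto
  also have "\<dots> = (\<Prod>k\<in>{k \<in> {..<n}. k < N t \<omega>}. h k)"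
    by (intro prod.inter_filter[symmetric]) simp
  also have "{k \<in> {..<n}. k < N t \<omega>} = {..<min n (N t \<omega>)}"
    by auto
  finally show ?thesis .
qed

text \<open>As long as the walk is alive the sum is at most \<open>t\<close>; the single crossing
  step adds at most \<open>b\<close>, and nothing is added afterwards. Truncation thus gives a
  deterministic control of the overshoot.\<close>

lemma truncated_stopped_sum_le:
  assumes "\<And>k. 0 < X (Suc k) \<omega>" "0 \<le> t" "0 \<le> b"
  shows "(\<Sum>k<n. of_bool (alive t k \<omega>) * min (X (Suc k) \<omega>) b) \<le> t + b"
proof (induction n)
  case (Suc n)
  show ?case
  proof (cases "alive t n \<omega>")
    case True
    have "(\<Sum>k<n. of_bool (alive t k \<omega>) * min (X (Suc k) \<omega>) b) \<le> (\<Sum>k<n. X (Suc k) \<omega>)"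
      using assms(1,3) by (intro sum_mono) (auto intro: less_imp_le)
    also have "\<dots> \<le> t"
      using alive_le[OF True assms(2)] by (simp add: partial_sum_eq)
    finally have "(\<Sum>k<n. of_bool (alive t k \<omega>) * min (X (Suc k) \<omega>) b)
       + of_bool (alive t n \<omega>) * min (X (Suc n) \<omega>) b \<le> t + b"
      using True by (intro add_mono) auto
    then show ?thesis
      by (simp only: sum.lessThan_Suc)
  qed (use Suc in \<open>simp only: sum.lessThan_Suc of_bool_eq mult_zero_left add_0_right\<close>)
qed (use assms in simp)

text \<open>The stopped product of \<open>exp (l - s * min x b)\<close> is a supermartingale by
  \<open>le\<close>, and the truncated sum in its exponent never exceeds \<open>t + b\<close>. The
  count is cut at a finite \<open>n\<close> because the finiteness of the passage time is itself a
  consequence of this bound.\<close>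

lemma exp_count_bound:
  assumes t: "0 \<le> t" and b: "0 \<le> b" and s: "0 \<le> s"
    and le: "exp l * expectation (\<lambda>\<omega>. exp (- s * min (xi \<omega>) b)) \<le> 1"
  shows "integrable M (\<lambda>\<omega>. exp (l * (\<Sum>k<n. of_bool (alive t k \<omega>))))"
    and "expectation (\<lambda>\<omega>. exp (l * (\<Sum>k<n. of_bool (alive t k \<omega>)))) \<le> exp (s * (t + b))"
proof -
  define \<psi> where "\<psi> = (\<lambda>x. exp (l - s * min x b))"
  define G where "G = (\<lambda>n \<omega>. \<Prod>k<n. if alive t k \<omega> then \<psi> (X (Suc k) \<omega>) else 1)"
  define E where "E = (\<lambda>\<omega>. exp (l * (\<Sum>k<n. of_bool (alive t k \<omega>))))"
  have \<psi>m [measurable]: "\<psi> \<in> borel_measurable borel"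
    unfolding \<psi>_def by measurable
  have [measurable]: "E \<in> borel_measurable M"
    unfolding E_def by measurable
  have int: "integrable M (\<lambda>\<omega>. \<psi> (xi \<omega>))"
  proof (rule integrable_const_bound[of _ "exp l"])
    show "AE \<omega> in M. norm (\<psi> (xi \<omega>)) \<le> exp l"
      using xi_pos by eventually_elim (use s b in \<open>auto simp: \<psi>_def\<close>)
  qed measurable
  have e: "expectation (\<lambda>\<omega>. \<psi> (xi \<omega>)) \<le> 1"
    using le by (simp add: \<psi>_def diff_conv_add_uminus exp_add del: add_uminus_conv_diff)
  have sp: "integrable M (G n)"
    "expectation (G n) = 1 + (\<Sum>k<n. expectation (\<lambda>\<omega>. G k \<omega> * of_bool (alive t k \<omega>)))
      * (expectation (\<lambda>\<omega>. \<psi> (xi \<omega>)) - 1)" for n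
    unfolding G_def by (rule stopped_prod[OF \<psi>m int])+
  have pos: "0 \<le> G n \<omega>" for n \<omega>
    unfolding G_def \<psi>_def by (intro prod_nonneg) auto
  have "expectation (G n) = 1 + (\<Sum>k<n. expectation (\<lambda>\<omega>. G k \<omega> * of_bool (alive t k \<omega>)))
      * (expectation (\<lambda>\<omega>. \<psi> (xi \<omega>)) - 1)"
    by (rule sp(2))
  also have "\<dots> \<le> 1 + 0"
    using e pos by (intro add_left_mono mult_nonneg_nonpos sum_nonneg Bochner_Integration.integral_nonneg) auto
  finally have G1: "expectation (G n) \<le> 1" by simp
  have Geq: "G n \<omega> = exp (l * (\<Sum>k<n. of_bool (alive t k \<omega>))
      - s * (\<Sum>k<n. of_bool (alive t k \<omega>) * min (X (Suc k) \<omega>) b))" for n \<omega>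
  proof -
    have "G n \<omega> = (\<Prod>k<n. exp (of_bool (alive t k \<omega>) * (l - s * min (X (Suc k) \<omega>) b)))"
      unfolding G_def \<psi>_def by (intro prod.cong) auto
    also have "\<dots> = exp (\<Sum>k<n. of_bool (alive t k \<omega>) * (l - s * min (X (Suc k) \<omega>) b))"
      by (simp only: exp_sum finite_lessThan)
    finally show ?thesis
      by (simp add: sum_distrib_left sum_subtractf[symmetric] algebra_simps)
  qed
  have bnd: "AE \<omega> in M. E \<omega> \<le> exp (s * (t + b)) * G n \<omega>"
    using AE_steps_pos
  proof eventually_elim
    case (elim \<omega>)
    have "(\<Sum>k<n. of_bool (alive t k \<omega>) * min (X (Suc k) \<omega>) b) \<le> t + b"
      using elim t b by (intro truncated_stopped_sum_le) auto
    then have "s * (\<Sum>k<n. of_bool (alive t k \<omega>) * min (X (Suc k) \<omega>) b) \<le> s * (t + b)"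
      using s by (rule mult_left_mono)
    then show ?case
      unfolding Geq E_def exp_add[symmetric] by (simp)
  qed
  have iG: "integrable M (\<lambda>\<omega>. exp (s * (t + b)) * G n \<omega>)"
    using sp(1)[of n] by simp
  have iE: "integrable M E"
    by (rule Bochner_Integration.integrable_bound[OF iG]) (use bnd pos in \<open>auto simp: E_def\<close>)
  have "expectation E \<le> expectation (\<lambda>\<omega>. exp (s * (t + b)) * G n \<omega>)"
    using bnd by (intro integral_mono_AE iE iG)
  also have "\<dots> \<le> exp (s * (t + b)) * 1"
    unfolding integral_mult_right_zero using G1 by (intro mult_left_mono) auto
  finally show "integrable M (\<lambda>\<omega>. exp (l * (\<Sum>k<n. of_bool (alive t k \<omega>))))"
    "expectation (\<lambda>\<omega>. exp (l * (\<Sum>k<n. of_bool (alive t k \<omega>)))) \<le> exp (s * (t + b))"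
    using iE by (auto simp: E_def)
qed

text \<open>Since \<open>xi\<close> is almost surely positive, \<open>exp (- min xi 1)\<close> has
  mean below 1, and \<open>l\<close> may be minus the logarithm of that mean. The form
  \<open>- 1 * min\<close> matches \<open>exp_count_bound\<close> with \<open>s = 1\<close> and
  \<open>b = 1\<close>. The case split only ensures that \<open>ln\<close> is applied to a positive
  number.\<close>

lemma small_laplace: "\<exists>l>0. exp l * expectation (\<lambda>\<omega>. exp (- 1 * min (xi \<omega>) 1)) \<le> 1"
proof -
  have "AE \<omega> in M. exp (- 1 * min (xi \<omega>) 1) < 1"
    using xi_pos by eventually_elim auto
  moreover have "integrable M (\<lambda>\<omega>. exp (- 1 * min (xi \<omega>) 1))"
  proof (rule integrable_const_bound[of _ 1])
    show "AE \<omega> in M. norm (exp (- 1 * min (xi \<omega>) 1)) \<le> 1"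
      using xi_pos by eventually_elim auto
  qed measurable
  ultimately have lt: "expectation (\<lambda>\<omega>. exp (- 1 * min (xi \<omega>) 1)) < 1" (is "?e < 1")
    by (intro expectation_less) auto
  show ?thesis
  proof (cases "?e \<le> 0")
    case True
    then show ?thesis by (intro exI[of _ 1]) (auto intro: order_trans[OF mult_nonneg_nonpos])
  next
    case False
    then show ?thesis
      using lt by (intro exI[of _ "- ln ?e"]) (auto simp: exp_minus)
  qed
qed

text \<open>If the walk stays below \<open>t\<close> for ever on \<open>A\<close>, then the count up
  to \<open>n\<close> equals \<open>n\<close> there, and the exponential bound forces
  \<open>exp (l * n) * prob A\<close> to stay bounded in \<open>n\<close>. No law of large numbers
  is involved.\<close>

lemma AE_good:
  assumes t: "0 \<le> t"
  shows "AE \<omega> in M. good t \<omega>"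
proof -
  obtain l where l: "l > 0" "exp l * expectation (\<lambda>\<omega>. exp (- 1 * min (xi \<omega>) 1)) \<le> 1"
    using small_laplace by auto
  note ecb = exp_count_bound[OF t _ _ l(2), simplified]
  define A where "A = {\<omega>\<in>space M. \<forall>k. alive t k \<omega>}"
  have [measurable]: "A \<in> events"
    unfolding A_def by measurable
  have bound: "prob A \<le> exp (t + 1) * exp (- (l * n))" for n :: nat
  proof -
    have "exp (l * n) * prob A = expectation (\<lambda>\<omega>. exp (l * n) * indicator A \<omega>)"
      by simp
    also have "\<dots> \<le> expectation (\<lambda>\<omega>. exp (l * (\<Sum>k<n. of_bool (alive t k \<omega>))))"
    proof (intro integral_mono)
      fix \<omega> assume "\<omega> \<in> space M"
      show "exp (l * n) * indicator A \<omega> \<le> exp (l * (\<Sum>k<n. of_bool (alive t k \<omega>)))"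
        by (cases "\<omega> \<in> A") (auto simp: A_def)
    qed (use ecb in \<open>auto simp: emeasure_eq_measure\<close>)
    also have "\<dots> \<le> exp (t + 1)"
      using ecb by simp
    finally show ?thesis
      by (simp add: exp_minus field_simps)
  qed
  have "(\<lambda>n. exp (t + 1) * exp (- (l * real n))) \<longlonglongrightarrow> exp (t + 1) * 0"
  proof (intro tendsto_mult tendsto_const)
    have "filterlim (\<lambda>n. l * real n) at_top sequentially"
      using l by (intro filterlim_tendsto_pos_mult_at_top[OF tendsto_const] filterlim_real_sequentially) auto
    then have "filterlim (\<lambda>n. - (l * real n)) at_bot sequentially"
      by (simp add: filterlim_uminus_at_top)
    then show "(\<lambda>n. exp (- (l * real n))) \<longlonglongrightarrow> 0"
      by (rule filterlim_compose[OF exp_at_bot])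
  qed
  from LIMSEQ_le_const[OF this, of "prob A"] have "prob A \<le> 0"
    using bound unfolding mult_zero_right by blast
  then have "prob A = 0"
    by (simp add: measure_le_0_iff)
  then have "AE \<omega> in M. \<omega> \<notin> A"
    by (subst (asm) prob_eq_0) simp_all
  with AE_steps_pos AE_space show ?thesis
    by eventually_elim (auto simp: good_def A_def)
qed

text \<open>The bound of \<open>exp_count_bound\<close> is uniform in \<open>n\<close>, and for good
  outcomes the count is eventually \<open>N t\<close>; Fatou's lemma gives the limit.\<close>

lemma exp_N_bound:
  assumes t: "0 \<le> t" and b: "0 \<le> b" and s: "0 \<le> s"
    and le: "exp l * expectation (\<lambda>\<omega>. exp (- s * min (xi \<omega>) b)) \<le> 1"
  shows "integrable M (\<lambda>\<omega>. exp (l * N t \<omega>))"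
    and "expectation (\<lambda>\<omega>. exp (l * N t \<omega>)) \<le> exp (s * (t + b))"
proof -
  note ecb = exp_count_bound[OF t b s le]
  have "(\<integral>\<^sup>+\<omega>. exp (l * N t \<omega>) \<partial>M) \<le> (\<integral>\<^sup>+\<omega>. liminf (\<lambda>n. ennreal (exp (l * (\<Sum>k<n. of_bool (alive t k \<omega>))))) \<partial>M)"
  proof (intro nn_integral_mono_AE)
    show "AE \<omega> in M. ennreal (exp (l * N t \<omega>)) \<le> liminf (\<lambda>n. ennreal (exp (l * (\<Sum>k<n. of_bool (alive t k \<omega>)))))"
      using AE_good[OF t]
    proof eventually_elim
      case (elim \<omega>)
      have "(\<lambda>n. ennreal (exp (l * (\<Sum>k<n. of_bool (alive t k \<omega>))))) \<longlonglongrightarrow> ennreal (exp (l * N t \<omega>))"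
      proof (rule tendsto_eventually)
        show "\<forall>\<^sub>F n in sequentially. ennreal (exp (l * (\<Sum>k<n. of_bool (alive t k \<omega>)))) = ennreal (exp (l * N t \<omega>))"
          using eventually_ge_at_top[of "N t \<omega>"]
          by eventually_elim (use stopped_sum_eq[OF elim, of "\<lambda>_. 1 :: real"] in simp)
      qed
      then show ?case
        by (simp only: lim_imp_Liminf[OF sequentially_bot] order_refl)
    qed
  qed
  also have "\<dots> \<le> liminf (\<lambda>n. \<integral>\<^sup>+\<omega>. ennreal (exp (l * (\<Sum>k<n. of_bool (alive t k \<omega>)))) \<partial>M)"
    by (intro nn_integral_liminf) measurable
  also have "\<dots> \<le> exp (s * (t + b))"
    using ecb by (intro Liminf_le) (auto intro!: always_eventually simp: nn_integral_eq_integral)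
  finally have fin: "(\<integral>\<^sup>+\<omega>. exp (l * N t \<omega>) \<partial>M) \<le> exp (s * (t + b))" .
  show int: "integrable M (\<lambda>\<omega>. exp (l * N t \<omega>))"
    using fin by (intro integrableI_bounded) (auto simp: less_top[symmetric] top_unique)
  show "expectation (\<lambda>\<omega>. exp (l * N t \<omega>)) \<le> exp (s * (t + b))"
    using fin by (subst (asm) nn_integral_eq_integral[OF int]) auto
qed

lemma exp_moment:
  assumes "0 \<le> t"
  obtains l :: real where "l > 0" "integrable M (\<lambda>\<omega>. exp (l * N t \<omega>))"
  using small_laplace exp_N_bound(1)[OF assms, of 1 1] by auto

lemma integrable_N_sq:
  assumes "0 \<le> t"
  shows "integrable M (\<lambda>\<omega>. (real (N t \<omega>))\<^sup>2)"
proof -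
  obtain l :: real where l: "l > 0" "integrable M (\<lambda>\<omega>. exp (l * N t \<omega>))"
    using exp_moment[OF assms] by auto
  have "integrable M (\<lambda>\<omega>. 2 / l\<^sup>2 * exp (l * N t \<omega>))"
    using l by simp
  then show ?thesis
  proof (rule Bochner_Integration.integrable_bound)
    have "(real n)\<^sup>2 \<le> 2 / l\<^sup>2 * exp (l * n)" for n :: nat
    proof -
      have "(l * n)\<^sup>2 / 2 \<le> exp (l * n)"
      proof -
        have "0 \<le> l * n"
          using l by simp
        then show ?thesis
          using exp_lower_Taylor_quadratic[of "l * n"] by linarith
      qed
      then show ?thesis
        using l by (simp add: field_simps power2_eq_square)
    qed
    then show "AE \<omega> in M. norm ((real (N t \<omega>))\<^sup>2) \<le> norm (2 / l\<^sup>2 * exp (l * N t \<omega>))"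
      using l by auto
  qed measurable
qed

lemma integrable_N:
  assumes "0 \<le> t"
  shows "integrable M (\<lambda>\<omega>. real (N t \<omega>))"
  by (rule square_integrable_imp_integrable[OF _ integrable_N_sq[OF assms]]) measurable

lemma nn_wald:
  assumes t: "0 \<le> t" and g [measurable]: "g \<in> borel_measurable borel"
  shows "(\<integral>\<^sup>+\<omega>. (\<Sum>k<N t \<omega>. g (X (Suc k) \<omega>)) \<partial>M) = (\<integral>\<^sup>+\<omega>. N t \<omega> \<partial>M) * (\<integral>\<^sup>+\<omega>. g (xi \<omega>) \<partial>M)"
proof -
  have eq: "(\<Sum>k. of_bool (alive t k \<omega>) * h k) = (\<Sum>k<N t \<omega>. h k)" if "good t \<omega>" for h :: "nat \<Rightarrow> ennreal" and \<omega>
  proof -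
    have "(\<Sum>k. of_bool (alive t k \<omega>) * h k) = (\<Sum>k\<in>{..<N t \<omega>}. of_bool (alive t k \<omega>) * h k)"
      using alive_iff[OF that] by (intro suminf_finite) auto
    then show ?thesis
      using stopped_sum_eq[OF that, of h "N t \<omega>"] by simp
  qed
  have "(\<integral>\<^sup>+\<omega>. (\<Sum>k<N t \<omega>. g (X (Suc k) \<omega>)) \<partial>M) = (\<integral>\<^sup>+\<omega>. (\<Sum>k. of_bool (alive t k \<omega>) * g (X (Suc k) \<omega>)) \<partial>M)"
    using AE_good[OF t] by (intro nn_integral_cong_AE) (auto simp: eq)
  also have "\<dots> = (\<integral>\<^sup>+\<omega>. (\<Sum>k. of_bool (alive t k \<omega>)) \<partial>M) * (\<integral>\<^sup>+\<omega>. g (xi \<omega>) \<partial>M)"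
    by (intro wald_nn) (use alive_past in measurable)
  also have "(\<integral>\<^sup>+\<omega>. (\<Sum>k. of_bool (alive t k \<omega>)) \<partial>M) = (\<integral>\<^sup>+\<omega>. N t \<omega> \<partial>M)"
    using AE_good[OF t] eq[of _ "\<lambda>_. 1"] by (intro nn_integral_cong_AE) auto
  finally show ?thesis .
qed

lemma random_sum_measurable [measurable]:
  fixes g :: "real \<Rightarrow> 'c :: {second_countable_topology, topological_comm_monoid_add}"
  assumes [measurable]: "g \<in> borel_measurable borel"
  shows "(\<lambda>\<omega>. \<Sum>k<N t \<omega>. g (X (Suc k) \<omega>)) \<in> borel_measurable M"
  by (rule measurable_compose_countable[where f = "\<lambda>n \<omega>. \<Sum>k<n. g (X (Suc k) \<omega>)"]) measurable

lemma wald: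
  fixes g :: "real \<Rightarrow> real"
  assumes t: "0 \<le> t" and g [measurable]: "g \<in> borel_measurable borel" and pos: "\<And>x. 0 \<le> g x"
    and int: "integrable M (\<lambda>\<omega>. g (xi \<omega>))"
  shows "integrable M (\<lambda>\<omega>. \<Sum>k<N t \<omega>. g (X (Suc k) \<omega>))"
    and "expectation (\<lambda>\<omega>. \<Sum>k<N t \<omega>. g (X (Suc k) \<omega>)) = mean_N t * expectation (\<lambda>\<omega>. g (xi \<omega>))"
proof -
  have "(\<integral>\<^sup>+\<omega>. ennreal (\<Sum>k<N t \<omega>. g (X (Suc k) \<omega>)) \<partial>M) = (\<integral>\<^sup>+\<omega>. (\<Sum>k<N t \<omega>. ennreal (g (X (Suc k) \<omega>))) \<partial>M)"
    using pos by (simp add: sum_ennreal)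
  also have "\<dots> = (\<integral>\<^sup>+\<omega>. N t \<omega> \<partial>M) * (\<integral>\<^sup>+\<omega>. ennreal (g (xi \<omega>)) \<partial>M)"
    using nn_wald[OF t, of "\<lambda>x. ennreal (g x)"] by simp
  also have "(\<integral>\<^sup>+\<omega>. N t \<omega> \<partial>M) = ennreal (mean_N t)"
    using integrable_N[OF t] by (subst nn_integral_eq_integral[symmetric]) (auto simp: ennreal_of_nat_eq_real_of_nat)
  also have "(\<integral>\<^sup>+\<omega>. ennreal (g (xi \<omega>)) \<partial>M) = ennreal (expectation (\<lambda>\<omega>. g (xi \<omega>)))"
    using int pos by (simp add: nn_integral_eq_integral)
  finally have eq: "(\<integral>\<^sup>+\<omega>. ennreal (\<Sum>k<N t \<omega>. g (X (Suc k) \<omega>)) \<partial>M)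
      = ennreal (mean_N t * expectation (\<lambda>\<omega>. g (xi \<omega>)))"
    using pos by (simp add: ennreal_mult)
  show i: "integrable M (\<lambda>\<omega>. \<Sum>k<N t \<omega>. g (X (Suc k) \<omega>))"
    using eq pos by (intro integrableI_bounded) (auto simp: sum_nonneg less_top)
  show "expectation (\<lambda>\<omega>. \<Sum>k<N t \<omega>. g (X (Suc k) \<omega>)) = mean_N t * expectation (\<lambda>\<omega>. g (xi \<omega>))"
    using eq pos by (subst (asm) nn_integral_eq_integral[OF i]) (auto simp: sum_nonneg)
qed

text \<open>The identity for the sum stopped at \<open>min n N\<close> passes to the limit because a
  bounded \<open>g\<close> makes \<open>B^2 * N^2\<close> a dominating variable, integrable by the
  exponential moment of \<open>N\<close>. It will be applied to centred truncated steps, which are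
  bounded.\<close>

lemma wald_second:
  fixes g :: "real \<Rightarrow> real"
  assumes t: "0 \<le> t" and g [measurable]: "g \<in> borel_measurable borel" and bnd: "\<And>x. \<bar>g x\<bar> \<le> B"
    and zero: "expectation (\<lambda>\<omega>. g (xi \<omega>)) = 0"
  shows "integrable M (\<lambda>\<omega>. (\<Sum>k<N t \<omega>. g (X (Suc k) \<omega>))\<^sup>2)"
    and "expectation (\<lambda>\<omega>. (\<Sum>k<N t \<omega>. g (X (Suc k) \<omega>))\<^sup>2)
      = mean_N t * expectation (\<lambda>\<omega>. (g (xi \<omega>))\<^sup>2)"
proof -
  have B: "0 \<le> B"
    using bnd[of 0] by linarith
  have int: "integrable M (\<lambda>\<omega>. g (xi \<omega>))"
    using bnd by (intro integrable_const_bound[of _ B]) auto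
  have int2: "integrable M (\<lambda>\<omega>. (g (xi \<omega>))\<^sup>2)"
    using bnd B by (intro integrable_const_bound[of _ "B\<^sup>2"]) (auto simp: abs_le_square_iff[symmetric])
  define S where "S = (\<lambda>n \<omega>. \<Sum>k<n. of_bool (alive t k \<omega>) * g (X (Suc k) \<omega>))"
  define S' where "S' = (\<lambda>\<omega>. \<Sum>k<N t \<omega>. g (X (Suc k) \<omega>))"
  have [measurable]: "S n \<in> borel_measurable M" "S' \<in> borel_measurable M" for n
    unfolding S_def S'_def by measurable
  have sq: "expectation (\<lambda>\<omega>. (S n \<omega>)\<^sup>2)
      = (\<Sum>k<n. prob {\<omega>\<in>space M. alive t k \<omega>}) * expectation (\<lambda>\<omega>. (g (xi \<omega>))\<^sup>2)" for n
    unfolding S_def by (rule stopped_sum_square[OF g int int2 zero])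
  have ae: "AE \<omega> in M. (\<forall>n. S n \<omega> = (\<Sum>k<min n (N t \<omega>). g (X (Suc k) \<omega>)))"
    using AE_good[OF t] by eventually_elim (simp only: S_def stopped_sum_eq simp_thms)
  have lim: "AE \<omega> in M. (\<lambda>n. (S n \<omega>)\<^sup>2) \<longlonglongrightarrow> (S' \<omega>)\<^sup>2"
    using ae
  proof eventually_elim
    case (elim \<omega>)
    show ?case
    proof (rule tendsto_eventually)
      show "\<forall>\<^sub>F n in sequentially. (S n \<omega>)\<^sup>2 = (S' \<omega>)\<^sup>2"
        using eventually_ge_at_top[of "N t \<omega>"] by eventually_elim (simp add: elim S'_def min_def)
    qed
  qed
  have bd: "AE \<omega> in M. norm ((S n \<omega>)\<^sup>2) \<le> B\<^sup>2 * (real (N t \<omega>))\<^sup>2" for n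
    using ae
  proof eventually_elim
    case (elim \<omega>)
    have "\<bar>S n \<omega>\<bar> \<le> (\<Sum>k<min n (N t \<omega>). B)"
      unfolding elim[rule_format] using bnd by (intro sum_abs[THEN order_trans] sum_mono)
    also have "\<dots> \<le> B * real (N t \<omega>)"
      using B by (simp add: mult.commute mult_left_mono)
    finally show ?case
      using B by (simp add: power_mult_distrib[symmetric] abs_le_square_iff[symmetric])
  qed
  have iw: "integrable M (\<lambda>\<omega>. B\<^sup>2 * (real (N t \<omega>))\<^sup>2)"
    using integrable_N_sq[OF t] by simp
  show "integrable M (\<lambda>\<omega>. (\<Sum>k<N t \<omega>. g (X (Suc k) \<omega>))\<^sup>2)"
    using integrable_dominated_convergence[OF _ _ iw lim bd] by (simp add: S'_def)
  have l1: "(\<lambda>n. expectation (\<lambda>\<omega>. (S n \<omega>)\<^sup>2)) \<longlonglongrightarrow> expectation (\<lambda>\<omega>. (S' \<omega>)\<^sup>2)"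
    by (rule integral_dominated_convergence[OF _ _ iw lim bd]) measurable
  have l2: "(\<lambda>n. expectation (\<lambda>\<omega>. \<Sum>k<n. of_bool (alive t k \<omega>))) \<longlonglongrightarrow> expectation (\<lambda>\<omega>. real (N t \<omega>))"
  proof (rule integral_dominated_convergence[OF _ _ integrable_N[OF t]])
    show "AE \<omega> in M. (\<lambda>n. \<Sum>k<n. of_bool (alive t k \<omega>)) \<longlonglongrightarrow> real (N t \<omega>)"
      using AE_good[OF t]
    proof eventually_elim
      case (elim \<omega>)
      show ?case
      proof (rule tendsto_eventually)
        show "\<forall>\<^sub>F n in sequentially. (\<Sum>k<n. of_bool (alive t k \<omega>)) = real (N t \<omega>)"
          using eventually_ge_at_top[of "N t \<omega>"]
          by eventually_elim (use stopped_sum_eq[OF elim, of "\<lambda>_. 1 :: real"] in simp)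
      qed
    qed
    show "AE \<omega> in M. norm (\<Sum>k<n. of_bool (alive t k \<omega>) :: real) \<le> real (N t \<omega>)" for n
      using AE_good[OF t]
      by eventually_elim (use stopped_sum_eq[where t = t and h = "\<lambda>_. 1 :: real" and n = n] in simp)
  qed measurable
  have "expectation (\<lambda>\<omega>. \<Sum>k<n. of_bool (alive t k \<omega>)) = (\<Sum>k<n. prob {\<omega>\<in>space M. alive t k \<omega>})" for n
  proof -
    have "expectation (\<lambda>\<omega>. \<Sum>k<n. of_bool (alive t k \<omega>)) = expectation (\<lambda>\<omega>. \<Sum>k<n. indicat_real {\<omega>\<in>space M. alive t k \<omega>} \<omega>)"
      by (intro Bochner_Integration.integral_cong sum.cong) (auto simp: indicator_def)
    then show ?thesis
      by (simp add: Bochner_Integration.integral_sum emeasure_eq_measure)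
  qed
  with l2 have "(\<lambda>n. (\<Sum>k<n. prob {\<omega>\<in>space M. alive t k \<omega>}) * expectation (\<lambda>\<omega>. (g (xi \<omega>))\<^sup>2))
     \<longlonglongrightarrow> expectation (\<lambda>\<omega>. real (N t \<omega>)) * expectation (\<lambda>\<omega>. (g (xi \<omega>))\<^sup>2)"
    by (intro tendsto_mult) auto
  with l1 have "expectation (\<lambda>\<omega>. (S' \<omega>)\<^sup>2) = expectation (\<lambda>\<omega>. real (N t \<omega>)) * expectation (\<lambda>\<omega>. (g (xi \<omega>))\<^sup>2)"
    unfolding sq by (rule LIMSEQ_unique)
  then show "expectation (\<lambda>\<omega>. (\<Sum>k<N t \<omega>. g (X (Suc k) \<omega>))\<^sup>2)
      = mean_N t * expectation (\<lambda>\<omega>. (g (xi \<omega>))\<^sup>2)"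
    by (simp add: S'_def)
qed

text \<open>By \<open>stopped_prod\<close> the distance of the mean from 1 is the mean of a sum of
  at most \<open>N\<close> partial products, times the defect of the mean of \<open>\<psi>\<close>.
  Each of these partial products is at most \<open>R ^ N\<close> in norm.\<close>

lemma random_prod_bound:
  fixes \<psi> :: "real \<Rightarrow> 'b :: {real_normed_field, banach, second_countable_topology}" and R :: real
  assumes t: "0 \<le> t" and \<psi> [measurable]: "\<psi> \<in> borel_measurable borel" and bnd: "\<And>x. norm (\<psi> x) \<le> R"
    and R: "1 \<le> R" and int: "integrable M (\<lambda>\<omega>. N t \<omega> * R ^ N t \<omega>)"
  shows "integrable M (\<lambda>\<omega>. \<Prod>k<N t \<omega>. \<psi> (X (Suc k) \<omega>))"
    and "norm (expectation (\<lambda>\<omega>. \<Prod>k<N t \<omega>. \<psi> (X (Suc k) \<omega>)) - 1)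
      \<le> expectation (\<lambda>\<omega>. N t \<omega> * R ^ N t \<omega>) * norm (expectation (\<lambda>\<omega>. \<psi> (xi \<omega>)) - 1)"
proof -
  have i\<psi>: "integrable M (\<lambda>\<omega>. \<psi> (xi \<omega>))"
    using bnd by (intro integrable_const_bound[of _ R]) auto
  define G where "G = (\<lambda>n \<omega>. \<Prod>k<n. if alive t k \<omega> then \<psi> (X (Suc k) \<omega>) else 1)"
  define G' where "G' = (\<lambda>\<omega>. \<Prod>k<N t \<omega>. \<psi> (X (Suc k) \<omega>))"
  have [measurable]: "G n \<in> borel_measurable M" for n
    unfolding G_def by measurable
  have [measurable]: "G' \<in> borel_measurable M"
    unfolding G'_def
    by (rule measurable_compose_countable[where f = "\<lambda>n \<omega>. \<Prod>k<n. \<psi> (X (Suc k) \<omega>)"]) measurable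
  have sp: "integrable M (G n)"
    "expectation (G n) = 1 + (\<Sum>k<n. expectation (\<lambda>\<omega>. G k \<omega> * of_bool (alive t k \<omega>)))
      * (expectation (\<lambda>\<omega>. \<psi> (xi \<omega>)) - 1)" for n
    unfolding G_def by (rule stopped_prod[OF \<psi> i\<psi>])+
  have ae: "AE \<omega> in M. good t \<omega> \<and> 0 < N t \<omega> \<and> (\<forall>n. G n \<omega> = (\<Prod>k<min n (N t \<omega>). \<psi> (X (Suc k) \<omega>)))"
    using AE_good[OF t] by eventually_elim (simp only: G_def stopped_prod_eq good_sum_pos t simp_thms)
  have nG: "norm (\<Prod>k<m. \<psi> (X (Suc k) \<omega>)) \<le> R ^ m" for m \<omega>
  proof -
    have "norm (\<Prod>k<m. \<psi> (X (Suc k) \<omega>)) \<le> (\<Prod>k<m. R)"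
      unfolding prod_norm[symmetric] using bnd by (intro prod_mono) auto
    then show ?thesis by simp
  qed
  have lim: "AE \<omega> in M. (\<lambda>n. G n \<omega>) \<longlonglongrightarrow> G' \<omega>"
    using ae
  proof eventually_elim
    case (elim \<omega>)
    show ?case
    proof (rule tendsto_eventually)
      show "\<forall>\<^sub>F n in sequentially. G n \<omega> = G' \<omega>"
        using eventually_ge_at_top[of "N t \<omega>"] by eventually_elim (simp add: elim G'_def min_def)
    qed
  qed
  have bd: "AE \<omega> in M. norm (G n \<omega>) \<le> N t \<omega> * R ^ N t \<omega>" for n
    using ae
  proof eventually_elim
    case (elim \<omega>)
    have "norm (G n \<omega>) \<le> R ^ min n (N t \<omega>)"
      using elim nG by simp
    also have "\<dots> \<le> R ^ N t \<omega>"
      using R by (intro power_increasing) auto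
    \<comment> \<open>Here \<open>N t \<omega> \<ge> 1\<close> matters: the one integrable variable
      \<open>N * R ^ N\<close> then dominates the products as well as the sums of products
      below.\<close>
    also have "\<dots> \<le> N t \<omega> * R ^ N t \<omega>"
      using elim R by simp
    finally show ?case .
  qed
  show "integrable M (\<lambda>\<omega>. \<Prod>k<N t \<omega>. \<psi> (X (Suc k) \<omega>))"
    using integrable_dominated_convergence[OF _ _ int lim bd] by (simp add: G'_def)
  have l1: "(\<lambda>n. expectation (G n)) \<longlonglongrightarrow> expectation G'"
    by (rule integral_dominated_convergence[OF _ _ int lim bd]) measurable
  let ?d = "norm (expectation (\<lambda>\<omega>. \<psi> (xi \<omega>)) - 1)"
  have le: "norm (expectation (G n) - 1) \<le> expectation (\<lambda>\<omega>. N t \<omega> * R ^ N t \<omega>) * ?d" for n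
  proof -
    have i1: "integrable M (\<lambda>\<omega>. G k \<omega> * of_bool (alive t k \<omega>))" for k
      using sp(1)[of k] by (rule Bochner_Integration.integrable_bound) auto
    have "(\<Sum>k<n. expectation (\<lambda>\<omega>. G k \<omega> * of_bool (alive t k \<omega>)))
        = expectation (\<lambda>\<omega>. \<Sum>k<n. G k \<omega> * of_bool (alive t k \<omega>))"
      using i1 by (intro Bochner_Integration.integral_sum[symmetric])
    also have "norm \<dots> \<le> expectation (\<lambda>\<omega>. N t \<omega> * R ^ N t \<omega>)"
    proof (rule integral_norm_bound[THEN order_trans])
      show "expectation (\<lambda>\<omega>. norm (\<Sum>k<n. G k \<omega> * of_bool (alive t k \<omega>))) \<le> expectation (\<lambda>\<omega>. N t \<omega> * R ^ N t \<omega>)"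
      proof (rule integral_mono_AE[OF _ int])
        show "integrable M (\<lambda>\<omega>. norm (\<Sum>k<n. G k \<omega> * of_bool (alive t k \<omega>)))"
          using i1 by (intro integrable_norm Bochner_Integration.integrable_sum)
        show "AE \<omega> in M. norm (\<Sum>k<n. G k \<omega> * of_bool (alive t k \<omega>)) \<le> N t \<omega> * R ^ N t \<omega>"
          using ae
        proof eventually_elim
          case (elim \<omega>)
          have "(\<Sum>k<n. G k \<omega> * of_bool (alive t k \<omega>)) = (\<Sum>k<min n (N t \<omega>). G k \<omega>)"
            using stopped_sum_eq[of t \<omega> "\<lambda>k. G k \<omega>" n] elim by (simp only: mult.commute)
          also have "norm \<dots> \<le> (\<Sum>k<min n (N t \<omega>). R ^ N t \<omega>)"
          proof (rule sum_norm_le)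
            fix k assume "k \<in> {..<min n (N t \<omega>)}"
            have "norm (G k \<omega>) \<le> R ^ min k (N t \<omega>)"
              using elim nG by simp
            also have "\<dots> \<le> R ^ N t \<omega>"
              using R by (intro power_increasing) auto
            finally show "norm (G k \<omega>) \<le> R ^ N t \<omega>" .
          qed
          also have "\<dots> \<le> N t \<omega> * R ^ N t \<omega>"
            using R by (auto intro!: mult_right_mono)
          finally show ?case .
        qed
      qed
    qed
    finally show ?thesis
      unfolding sp by (simp add: norm_mult mult_right_mono)
  qed
  show "norm (expectation (\<lambda>\<omega>. \<Prod>k<N t \<omega>. \<psi> (X (Suc k) \<omega>)) - 1) \<le> expectation (\<lambda>\<omega>. N t \<omega> * R ^ N t \<omega>) * ?d"
    using l1 le by (intro LIMSEQ_le_const2[OF tendsto_norm[OF tendsto_diff[OF l1[unfolded G'_def] tendsto_const]]]) auto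
qed

subsection \<open>Truncated moments and slow variation\<close>

definition mu :: real where "mu = expectation xi"

abbreviation trunc2 :: "real \<Rightarrow> real" where
  "trunc2 \<equiv> truncated_second_moment M xi"

definition tail1 :: "real \<Rightarrow> real" where
  "tail1 y = expectation (\<lambda>\<omega>. xi \<omega> * indicator {\<omega>. y < xi \<omega>} \<omega>)"

lemma trunc2_eq: "trunc2 y = expectation (\<lambda>\<omega>. (xi \<omega>)\<^sup>2 * indicator {\<omega>. xi \<omega> \<le> y} \<omega>)"
  by (simp add: truncated_second_moment_def)

lemma indicator_le_rv [measurable]:
  "(\<lambda>\<omega>. indicator {\<omega>. xi \<omega> \<le> y} \<omega> :: real) \<in> borel_measurable M"
  "(\<lambda>\<omega>. indicator {\<omega>. y < xi \<omega>} \<omega> :: real) \<in> borel_measurable M"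
  unfolding indicator_def by measurable

lemma trunc2_int: "integrable M (\<lambda>\<omega>. (xi \<omega>)\<^sup>2 * indicator {\<omega>. xi \<omega> \<le> y} \<omega>)"
proof (rule integrable_const_bound[of _ "y\<^sup>2"])
  show "AE \<omega> in M. norm ((xi \<omega>)\<^sup>2 * indicator {\<omega>. xi \<omega> \<le> y} \<omega>) \<le> y\<^sup>2"
    using xi_pos by eventually_elim (auto simp: indicator_def intro!: power_mono)
qed measurable

lemma trunc2_mono: "y \<le> z \<Longrightarrow> trunc2 y \<le> trunc2 z"
  unfolding trunc2_eq by (intro integral_mono trunc2_int) (auto simp: indicator_def)

lemma trunc2_nonneg: "0 \<le> trunc2 y"
  unfolding trunc2_eq by (intro Bochner_Integration.integral_nonneg) auto

lemma tail1_int: "integrable M (\<lambda>\<omega>. xi \<omega> * indicator {\<omega>. y < xi \<omega>} \<omega>)"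
  using xi_int by (rule Bochner_Integration.integrable_bound) (auto simp: indicator_def)

lemma tail1_nonneg: "0 \<le> tail1 y"
  unfolding tail1_def using xi_pos by (intro integral_nonneg_AE) auto

lemma mu_pos: "0 < mu"
  unfolding mu_def using xi_pos xi_int by (intro expectation_greater) auto

text \<open>On \<open>y < xi \<le> 2 * y\<close> the variable is at most \<open>xi^2 / y\<close>, so
  this dyadic block of the tail is paid for by an increment of \<open>trunc2\<close>. Iterating the
  inequality turns slow variation into a tail bound.\<close>

lemma tail1_step:
  assumes "0 < y"
  shows "tail1 y \<le> (trunc2 (2 * y) - trunc2 y) / y + tail1 (2 * y)"
proof -
  have "tail1 y \<le> expectation (\<lambda>\<omega>. ((xi \<omega>)\<^sup>2 * indicator {\<omega>. xi \<omega> \<le> 2 * y} \<omega> - (xi \<omega>)\<^sup>2 * indicator {\<omega>. xi \<omega> \<le> y} \<omega>) / y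
      + xi \<omega> * indicator {\<omega>. 2 * y < xi \<omega>} \<omega>)"
    unfolding tail1_def
  proof (intro integral_mono tail1_int Bochner_Integration.integrable_add Bochner_Integration.integrable_divide
      Bochner_Integration.integrable_diff trunc2_int)
    fix \<omega>
    show "xi \<omega> * indicator {\<omega>. y < xi \<omega>} \<omega> \<le>
        ((xi \<omega>)\<^sup>2 * indicator {\<omega>. xi \<omega> \<le> 2 * y} \<omega> - (xi \<omega>)\<^sup>2 * indicator {\<omega>. xi \<omega> \<le> y} \<omega>) / y
         + xi \<omega> * indicator {\<omega>. 2 * y < xi \<omega>} \<omega>"
      using assms by (auto simp: indicator_def power2_eq_square field_simps)
  qed
  also have "\<dots> = (trunc2 (2 * y) - trunc2 y) / y + tail1 (2 * y)"
    using trunc2_int tail1_int by (simp add: tail1_def trunc2_eq)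
  finally show ?thesis .
qed

lemma tail1_tendsto: "(tail1 \<longlongrightarrow> 0) at_top"
proof -
  have "((\<lambda>y. expectation (\<lambda>\<omega>. xi \<omega> * indicator {\<omega>. y < xi \<omega>} \<omega>)) \<longlongrightarrow> expectation (\<lambda>\<omega>. 0)) at_top"
  proof (rule integral_dominated_convergence_at_top[where w = "\<lambda>\<omega>. norm (xi \<omega>)"])
    show "AE \<omega> in M. ((\<lambda>y. xi \<omega> * indicator {\<omega>. y < xi \<omega>} \<omega>) \<longlongrightarrow> 0) at_top"
    proof (intro AE_I2 tendsto_eventually)
      fix \<omega>
      show "\<forall>\<^sub>F y in at_top. xi \<omega> * indicator {\<omega>. y < xi \<omega>} \<omega> = 0"
        using eventually_ge_at_top[of "xi \<omega>"] by eventually_elim auto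
    qed
  qed (use xi_int in \<open>auto simp: indicator_def\<close>)
  then show ?thesis
    by (simp add: tail1_def[abs_def])
qed

lemma trunc2_small: "((\<lambda>y. trunc2 y / y) \<longlongrightarrow> 0) at_top"
proof -
  \<comment> \<open>The factor \<open>of_bool (y > 0)\<close> makes the domination by
    \<open>\<bar>xi\<bar>\<close> valid for every \<open>y\<close>, since
    \<open>xi^2 / y \<le> xi\<close> where \<open>0 < xi \<le> y\<close>.\<close>
  have "((\<lambda>y. expectation (\<lambda>\<omega>. (xi \<omega>)\<^sup>2 * indicator {\<omega>. xi \<omega> \<le> y} \<omega> / y * of_bool (y > 0))) \<longlongrightarrow> expectation (\<lambda>\<omega>. 0)) at_top"
  proof (rule integral_dominated_convergence_at_top[where w = "\<lambda>\<omega>. norm (xi \<omega>)"])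
    show "AE \<omega> in M. ((\<lambda>y. (xi \<omega>)\<^sup>2 * indicator {\<omega>. xi \<omega> \<le> y} \<omega> / y * of_bool (y > 0)) \<longlongrightarrow> 0) at_top"
    proof (intro AE_I2)
      fix \<omega>
      have "((\<lambda>y. (xi \<omega>)\<^sup>2 / y) \<longlongrightarrow> 0) at_top"
        by (intro tendsto_divide_0[OF tendsto_const] filterlim_at_top_imp_at_infinity filterlim_ident)
      then show "((\<lambda>y. (xi \<omega>)\<^sup>2 * indicator {\<omega>. xi \<omega> \<le> y} \<omega> / y * of_bool (y > 0)) \<longlongrightarrow> 0) at_top"
        by (rule Lim_null_comparison[rotated])
          (use eventually_gt_at_top[of 0] in \<open>eventually_elim, simp add: indicator_def\<close>)
    qed
    show "\<forall>\<^sub>F y in at_top. AE \<omega> in M. norm ((xi \<omega>)\<^sup>2 * indicator {\<omega>. xi \<omega> \<le> y} \<omega> / y * of_bool (y > 0)) \<le> norm (xi \<omega>)"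
    proof (rule always_eventually, rule allI)
      fix y
      show "AE \<omega> in M. norm ((xi \<omega>)\<^sup>2 * indicator {\<omega>. xi \<omega> \<le> y} \<omega> / y * of_bool (y > 0)) \<le> norm (xi \<omega>)"
        using xi_pos by eventually_elim (auto simp: indicator_def field_simps power2_eq_square)
    qed
  qed (use xi_int in \<open>auto\<close>)
  then have "((\<lambda>y. expectation (\<lambda>\<omega>. (xi \<omega>)\<^sup>2 * indicator {\<omega>. xi \<omega> \<le> y} \<omega> / y * of_bool (y > 0))) \<longlongrightarrow> 0) at_top"
    by simp
  then show ?thesis
    by (rule Lim_transform_eventually) (use eventually_gt_at_top[of 0] in \<open>eventually_elim, simp add: trunc2_eq\<close>)
qed

lemma prob_tail_le: "0 < y \<Longrightarrow> tail0 y \<le> tail1 y / y"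
proof -
  assume y: "0 < y"
  have "tail0 y = expectation (indicat_real {\<omega>\<in>space M. y < xi \<omega>})"
    by simp
  also have "\<dots> \<le> expectation (\<lambda>\<omega>. xi \<omega> * indicator {\<omega>. y < xi \<omega>} \<omega> / y)"
    using y by (intro integral_mono Bochner_Integration.integrable_divide tail1_int)
      (auto simp: indicator_def emeasure_eq_measure)
  finally show ?thesis
    by (simp add: tail1_def)
qed

lemma expectation_indicator_gt: "expectation (\<lambda>\<omega>. indicator {\<omega>. y < xi \<omega>} \<omega>) = tail0 y"
proof -
  have "expectation (\<lambda>\<omega>. indicator {\<omega>. y < xi \<omega>} \<omega>) = expectation (indicat_real {\<omega>\<in>space M. y < xi \<omega>})"
    by (intro Bochner_Integration.integral_cong) (auto simp: indicator_def)
  then show ?thesis by simp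
qed

end

section \<open>Karamata-type consequences of slow variation\<close>

locale sv_renewal = renewal +
  assumes sv: "slowly_varying trunc2"
begin

lemma doubling:
  assumes "0 < e"
  obtains y0 where "0 < y0" "\<And>y. y0 \<le> y \<Longrightarrow> 0 < trunc2 y" "\<And>y. y0 \<le> y \<Longrightarrow> trunc2 (2 * y) \<le> (1 + e) * trunc2 y"
proof -
  have "((\<lambda>t. trunc2 (2 * t) / trunc2 t) \<longlongrightarrow> 1) at_top"
    using sv by (simp add: slowly_varying_def)
  then have "\<forall>\<^sub>F t in at_top. trunc2 (2 * t) / trunc2 t < 1 + e"
    using assms by (intro order_tendstoD(2)) auto
  moreover have "\<forall>\<^sub>F t in at_top. 0 < trunc2 t"
    using sv by (simp add: slowly_varying_def)
  ultimately have "\<forall>\<^sub>F t in at_top. 0 < trunc2 t \<and> trunc2 (2 * t) \<le> (1 + e) * trunc2 t"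
    by eventually_elim (auto simp: field_simps)
  then obtain y0 where "\<forall>y\<ge>y0. 0 < trunc2 y \<and> trunc2 (2 * y) \<le> (1 + e) * trunc2 y"
    by (auto simp: eventually_at_top_linorder)
  then show ?thesis
    by (intro that[of "max y0 1"]) auto
qed

text \<open>A Potter-type bound along powers of two; with small \<open>e\<close> the growth
  \<open>(1 + e) ^ j\<close> is far slower than the \<open>4 ^ j\<close> of a squared scale.\<close>

lemma doubling_power:
  assumes y0: "0 < y0" "\<And>y. y0 \<le> y \<Longrightarrow> trunc2 (2 * y) \<le> (1 + e) * trunc2 y" and "0 < e" "y0 \<le> y"
  shows "trunc2 (2 ^ j * y) \<le> (1 + e) ^ j * trunc2 y"
proof (induction j)
  case (Suc j)
  have "1 * y \<le> 2 ^ j * y"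
    using assms by (intro mult_right_mono) auto
  then have "trunc2 (2 * (2 ^ j * y)) \<le> (1 + e) * trunc2 (2 ^ j * y)"
    using assms by (intro y0(2)) linarith
  also have "\<dots> \<le> (1 + e) * ((1 + e) ^ j * trunc2 y)"
    using Suc \<open>0 < e\<close> by (intro mult_left_mono) auto
  finally show ?case
    by (simp add: mult_ac)
qed simp

text \<open>The tail is cut into blocks from \<open>2 ^ k * y\<close> to
  \<open>2 ^ Suc k * y\<close>. The increment of \<open>trunc2\<close> over a block is at most
  \<open>e\<close> times its value, because of slow variation, so the whole tail is a geometric
  series with a small factor in front.\<close>

lemma tail1_small: "((\<lambda>y. y * tail1 y / trunc2 y) \<longlongrightarrow> 0) at_top"
proof (rule tendstoI)
  fix r :: real assume r: "0 < r"
  define e where "e = min (1/2) (r / 8)"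
  have e: "0 < e" "e \<le> 1/2" "4 * e < r"
    using r by (auto simp: e_def min_def field_simps)
  obtain y0 where y0: "0 < y0" "\<And>y. y0 \<le> y \<Longrightarrow> 0 < trunc2 y"
      "\<And>y. y0 \<le> y \<Longrightarrow> trunc2 (2 * y) \<le> (1 + e) * trunc2 y"
    using doubling[OF e(1)] by metis
  \<comment> \<open>The first block contributes \<open>e * trunc2 y / y\<close>; each further
    doubling multiplies the bound by at most \<open>(3/2) / 2 = 3/4\<close>, as
    \<open>1 + e \<le> 3/2\<close>. The constant 4 is the sum of the geometric series with ratio
    \<open>3/4\<close>.\<close>
  have iter: "tail1 y \<le> 4 * e * trunc2 y / y + tail1 (2 ^ n * y)" if "y0 \<le> y" for y n
    using that
  proof (induction n arbitrary: y)
    case 0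
    then show ?case using y0 e(1) by (simp add: less_imp_le)
  next
    case (Suc n)
    have y: "0 < y" using y0 Suc by simp
    have t: "trunc2 (2 * y) \<le> (1 + e) * trunc2 y" "0 < trunc2 y"
      using y0 Suc by auto
    have "tail1 y \<le> (trunc2 (2 * y) - trunc2 y) / y + tail1 (2 * y)"
      by (rule tail1_step[OF y])
    also have "\<dots> \<le> e * trunc2 y / y + (4 * e * trunc2 (2 * y) / (2 * y) + tail1 (2 ^ n * (2 * y)))"
      using Suc.prems y t by (intro add_mono Suc.IH divide_right_mono) (auto simp: algebra_simps)
    also have "4 * e * trunc2 (2 * y) / (2 * y) \<le> 4 * e * (3/2 * trunc2 y) / (2 * y)"
    proof (intro divide_right_mono mult_left_mono)
      have "(1 + e) * trunc2 y \<le> 3/2 * trunc2 y"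
        using e t by (intro mult_right_mono) auto
      then show "trunc2 (2 * y) \<le> 3/2 * trunc2 y"
        using t by linarith
    qed (use e y in auto)
    finally show ?case
      using y by (simp add: mult_ac field_simps)
  qed
  have bound: "tail1 y \<le> 4 * e * trunc2 y / y" if "y0 \<le> y" for y
  proof -
    have "filterlim (\<lambda>n. (2::real) ^ n * y) at_top sequentially"
      using y0 that by (intro filterlim_at_top_mult_tendsto_pos[OF tendsto_const] filterlim_at_infinity_imp_filterlim_at_top
          filterlim_realpow_sequentially_gt1) auto
    then have "(\<lambda>n. 4 * e * trunc2 y / y + tail1 (2 ^ n * y)) \<longlonglongrightarrow> 4 * e * trunc2 y / y + 0"
      by (intro tendsto_add tendsto_const filterlim_compose[OF tail1_tendsto])
    then show ?thesis
      using iter[OF that] by (intro LIMSEQ_le_const[of _ "4 * e * trunc2 y / y"]) auto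
  qed
  show "\<forall>\<^sub>F y in at_top. dist (y * tail1 y / trunc2 y) 0 < r"
    using eventually_ge_at_top[of y0]
  proof eventually_elim
    case (elim y)
    have "y * tail1 y / trunc2 y \<le> 4 * e"
      using bound[OF elim] y0(1) y0(2)[OF elim] elim by (simp add: field_simps)
    moreover have "0 \<le> y * tail1 y / trunc2 y"
      using y0(1) y0(2)[OF elim] elim tail1_nonneg[of y] by (intro divide_nonneg_pos mult_nonneg_nonneg) auto
    ultimately show ?case
      using e by simp
  qed
qed

end

text \<open>The common ground of (A1) and (A2). With variance \<open>s < \<infinity>\<close> one has
  \<open>L' = mu^3 / s\<close> and \<open>L = L' * (s + mu^2)\<close>; with infinite variance
  \<open>L' = 0\<close> and \<open>L = mu^3\<close>. In either case \<open>L_rel\<close> states that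
  \<open>t * (trunc2 (a t) - mu^2) / (a t)^2\<close> tends to \<open>mu^3\<close>.\<close>

locale scaled_renewal = sv_renewal +
  fixes a :: "real \<Rightarrow> real" and L L' :: real
  assumes a_top: "filterlim a at_top at_top"
    and L': "((\<lambda>t. t / (a t)\<^sup>2) \<longlongrightarrow> L') at_top"
    and L: "((\<lambda>t. t * trunc2 (a t) / (a t)\<^sup>2) \<longlongrightarrow> L) at_top"
    and L_rel: "L - mu\<^sup>2 * L' = mu ^ 3"
begin

lemma a_pos: "\<forall>\<^sub>F t in at_top. 0 < a t"
  using a_top by (simp add: filterlim_at_top_dense)

lemma L'_nonneg: "0 \<le> L'"
  by (rule tendsto_lowerbound[OF L']) (auto intro: eventually_mono[OF eventually_ge_at_top[of 0]])

lemma L_pos: "0 < L"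
proof -
  have "0 < mu ^ 3" "0 \<le> mu\<^sup>2 * L'"
    using mu_pos L'_nonneg by auto
  then show ?thesis
    using L_rel by linarith
qed

lemma scaled_top: "0 < e \<Longrightarrow> filterlim (\<lambda>t. e * a t) at_top at_top"
  by (intro filterlim_tendsto_pos_mult_at_top[OF tendsto_const] a_top)

lemma L_scaled:
  assumes "0 < e"
  shows "((\<lambda>t. t * trunc2 (e * a t) / (a t)\<^sup>2) \<longlongrightarrow> L) at_top"
proof -
  have "((\<lambda>t. trunc2 (e * a t) / trunc2 (a t)) \<longlongrightarrow> 1) at_top"
    using sv assms unfolding slowly_varying_def by (auto intro: filterlim_compose[OF _ a_top])
  from tendsto_mult[OF this L] have "((\<lambda>t. trunc2 (e * a t) / trunc2 (a t) * (t * trunc2 (a t) / (a t)\<^sup>2)) \<longlongrightarrow> L) at_top"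
    by simp
  moreover have "\<forall>\<^sub>F t in at_top. 0 < trunc2 (a t)"
    using sv unfolding slowly_varying_def by (auto intro: eventually_compose_filterlim[OF _ a_top])
  then have "\<forall>\<^sub>F t in at_top. trunc2 (e * a t) / trunc2 (a t) * (t * trunc2 (a t) / (a t)\<^sup>2)
      = t * trunc2 (e * a t) / (a t)\<^sup>2"
    by eventually_elim auto
  ultimately show ?thesis
    by (rule Lim_transform_eventually)
qed

lemma a_small: "((\<lambda>t. a t / t) \<longlongrightarrow> 0) at_top"
proof -
  have "((\<lambda>t. (trunc2 (a t) / a t) / (t * trunc2 (a t) / (a t)\<^sup>2)) \<longlongrightarrow> 0 / L) at_top"
    using L_pos by (intro tendsto_divide L filterlim_compose[OF trunc2_small a_top]) auto
  moreover have "\<forall>\<^sub>F t in at_top. 0 < trunc2 (a t)"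
    using sv unfolding slowly_varying_def by (auto intro: eventually_compose_filterlim[OF _ a_top])
  then have "\<forall>\<^sub>F t in at_top. (trunc2 (a t) / a t) / (t * trunc2 (a t) / (a t)\<^sup>2) = a t / t"
    using a_pos by eventually_elim (auto simp: field_simps power2_eq_square)
  ultimately show ?thesis
    using Lim_transform_eventually by fastforce
qed

text \<open>A Lindeberg-type condition: about \<open>t\<close> steps are taken, and the part of them
  beyond \<open>e * a t\<close> adds up to \<open>o (a t)\<close> in mean. It is available for every
  \<open>e > 0\<close>, so the characteristic function can be expanded at a level that is a small
  fraction of \<open>a t\<close>.\<close>

lemma tail1_scaled:
  assumes e: "0 < e"
  shows "((\<lambda>t. t / a t * tail1 (e * a t)) \<longlongrightarrow> 0) at_top"
proof -
  have "((\<lambda>t. (1 / e) * ((e * a t) * tail1 (e * a t) / trunc2 (e * a t)) * (t * trunc2 (e * a t) / (a t)\<^sup>2)) \<longlongrightarrow> (1 / e) * 0 * L) at_top"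
    by (intro tendsto_mult tendsto_const L_scaled e filterlim_compose[OF tail1_small scaled_top])
  moreover have "\<forall>\<^sub>F t in at_top. 0 < trunc2 (e * a t)"
    using sv unfolding slowly_varying_def by (auto intro: eventually_compose_filterlim[OF _ scaled_top[OF e]])
  then have "\<forall>\<^sub>F t in at_top. (1 / e) * ((e * a t) * tail1 (e * a t) / trunc2 (e * a t)) * (t * trunc2 (e * a t) / (a t)\<^sup>2)
      = t / a t * tail1 (e * a t)"
    using a_pos by eventually_elim (use e in \<open>auto simp: field_simps power2_eq_square\<close>)
  ultimately show ?thesis
    using Lim_transform_eventually by fastforce
qed

text \<open>By a union bound, among order \<open>t\<close> steps none exceeds
  \<open>e * a t\<close>, up to vanishing probability. This will make the overshoot negligible on
  the scale \<open>a t\<close>.\<close>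

lemma prob_scaled:
  assumes e: "0 < e"
  shows "((\<lambda>t. t * tail0 (e * a t)) \<longlongrightarrow> 0) at_top"
proof (rule tendsto_sandwich[OF _ _ tendsto_const])
  show "\<forall>\<^sub>F t in at_top. 0 \<le> t * tail0 (e * a t)"
    using eventually_ge_at_top[of 0] by eventually_elim auto
  show "\<forall>\<^sub>F t in at_top. t * tail0 (e * a t) \<le> 1 / e * (t / a t * tail1 (e * a t))"
    using eventually_ge_at_top[of 0] a_pos
  proof eventually_elim
    case (elim t)
    then show ?case
      using mult_left_mono[OF prob_tail_le[of "e * a t"], of t] e by (simp add: field_simps)
  qed
  show "((\<lambda>t. 1 / e * (t / a t * tail1 (e * a t))) \<longlongrightarrow> 0) at_top"
    using tendsto_mult_left[OF tail1_scaled[OF e], of "1 / e"] by simp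
qed

end

subsection \<open>Exponential moments of the normalised first passage time\<close>

text \<open>The product of \<open>1 - y + y^2 / 2\<close> and \<open>1 + y + y^2 / 2\<close> is
  \<open>1 + y^4 / 4\<close>, at least 1, and the second factor is a lower bound for
  \<open>exp y\<close>.\<close>

lemma exp_minus_le_quadratic: "0 \<le> y \<Longrightarrow> exp (- y) \<le> 1 - y + y\<^sup>2 / 2" for y :: real
proof -
  assume y: "0 \<le> y"
  have "1 \<le> 1 + (y\<^sup>2)\<^sup>2 / 4"
    by simp
  also have "\<dots> = (1 - y + y\<^sup>2 / 2) * (1 + y + y\<^sup>2 / 2)"
    by (simp add: power2_eq_square field_simps)
  also have "\<dots> \<le> (1 - y + y\<^sup>2 / 2) * exp y"
  proof (rule mult_left_mono[OF exp_lower_Taylor_quadratic[OF y]])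
    have "0 \<le> ((y - 1)\<^sup>2 + 1) / 2" by simp
    also have "\<dots> = 1 - y + y\<^sup>2 / 2" by (simp add: power2_eq_square field_simps)
    finally show "0 \<le> 1 - y + y\<^sup>2 / 2" .
  qed
  finally show ?thesis
    by (simp add: exp_minus field_simps)
qed

context renewal
begin

lemma laplace_bound:
  assumes s: "0 \<le> s" and b: "0 \<le> b"
  shows "expectation (\<lambda>\<omega>. exp (- s * min (xi \<omega>) b)) \<le> 1 - s * mu + s * tail1 b + s\<^sup>2 / 2 * trunc2 b"
proof -
  let ?f = "\<lambda>\<omega>. 1 - s * xi \<omega> + s * (xi \<omega> * indicator {\<omega>. b < xi \<omega>} \<omega>)
      + s\<^sup>2 / 2 * ((xi \<omega>)\<^sup>2 * indicator {\<omega>. xi \<omega> \<le> b} \<omega>)"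
  have "expectation (\<lambda>\<omega>. exp (- s * min (xi \<omega>) b)) \<le> expectation ?f"
  proof (intro integral_mono_AE)
    show "integrable M (\<lambda>\<omega>. exp (- s * min (xi \<omega>) b))"
    proof (rule integrable_const_bound[of _ 1])
      show "AE \<omega> in M. norm (exp (- s * min (xi \<omega>) b)) \<le> 1"
        using xi_pos by eventually_elim (use s b in auto)
    qed measurable
    show "integrable M ?f"
      using xi_int tail1_int trunc2_int by simp
    show "AE \<omega> in M. exp (- s * min (xi \<omega>) b) \<le> ?f \<omega>"
      using xi_pos
    proof eventually_elim
      case (elim \<omega>)
      show ?case
      proof (cases "xi \<omega> \<le> b")
        case True
        then show ?thesis
          using exp_minus_le_quadratic[of "s * xi \<omega>"] elim s by (simp add: indicator_def power_mult_distrib)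
      next
        case False
        \<comment> \<open>Beyond \<open>b\<close> the terms \<open>- s * xi\<close> and
          \<open>+ s * xi\<close> of \<open>?f\<close> cancel and the quadratic one is absent, so
          the right-hand side is exactly 1.\<close>
        have "exp (- (s * b)) \<le> 1"
          using s b by simp
        then show ?thesis
          using False by (simp add: indicator_def)
      qed
    qed
  qed
  also have "expectation ?f = 1 - s * mu + s * tail1 b + s\<^sup>2 / 2 * trunc2 b"
    using xi_int tail1_int trunc2_int by (simp add: mu_def tail1_def trunc2_eq prob_space)
  finally show ?thesis .
qed

lemma wald_mean:
  assumes "0 \<le> t"
  shows "t \<le> mu * mean_N t"
    and "integrable M (\<lambda>\<omega>. partial_sum X (N t \<omega>) \<omega>)"
    and "expectation (\<lambda>\<omega>. partial_sum X (N t \<omega>) \<omega>) = mu * mean_N t"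
proof -
  \<comment> \<open>\<open>wald\<close> requires a function that is nonnegative everywhere, whereas
    the steps are positive only almost surely; hence the detour through
    \<open>max x 0\<close>.\<close>
  have int: "integrable M (\<lambda>\<omega>. max (xi \<omega>) 0)"
    using xi_int by auto
  have "expectation (\<lambda>\<omega>. max (xi \<omega>) 0) = mu"
    unfolding mu_def using xi_pos by (intro integral_cong_AE) auto
  then have w: "integrable M (\<lambda>\<omega>. \<Sum>k<N t \<omega>. max (X (Suc k) \<omega>) 0)"
     "expectation (\<lambda>\<omega>. \<Sum>k<N t \<omega>. max (X (Suc k) \<omega>) 0) = mu * mean_N t"
    using wald[OF assms _ _ int] by (auto simp: mult.commute)
  have ae: "AE \<omega> in M. (\<Sum>k<N t \<omega>. max (X (Suc k) \<omega>) 0) = partial_sum X (N t \<omega>) \<omega>"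
    using AE_good[OF assms] by eventually_elim (auto simp: good_def partial_sum_eq intro!: sum.cong max_absorb1 less_imp_le)
  have [measurable]: "(\<lambda>\<omega>. partial_sum X (N t \<omega>) \<omega>) \<in> borel_measurable M"
    by (rule measurable_compose_countable[where f = "\<lambda>n. partial_sum X n"]) measurable
  show i: "integrable M (\<lambda>\<omega>. partial_sum X (N t \<omega>) \<omega>)"
    using w(1) ae by (subst integrable_cong_AE[symmetric]) auto
  show e: "expectation (\<lambda>\<omega>. partial_sum X (N t \<omega>) \<omega>) = mu * mean_N t"
    unfolding w(2)[symmetric] using ae by (intro integral_cong_AE) auto
  have "expectation (\<lambda>\<omega>. t) \<le> expectation (\<lambda>\<omega>. partial_sum X (N t \<omega>) \<omega>)"
    using AE_good[OF assms] by (intro integral_mono_AE i) (auto simp: good_sum_pos[OF _ assms] less_imp_le)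
  then show "t \<le> mu * mean_N t"
    by (simp add: e prob_space)
qed

end

context scaled_renewal
begin

definition Z :: "real \<Rightarrow> 'a \<Rightarrow> real" where
  "Z t \<omega> = (real (N t \<omega>) - t / mu) / a t"

lemma Z_rv [measurable]: "Z t \<in> borel_measurable M"
  unfolding Z_def[abs_def] by measurable

lemma N_eq_Z: "0 < t \<Longrightarrow> 0 < a t \<Longrightarrow> real (N t \<omega>) / t = 1 / mu + a t / t * Z t \<omega>"
  using mu_pos by (simp add: Z_def field_simps)

text \<open>\<open>exp_N_bound\<close> is applied with \<open>l = \<theta> / a t\<close> and
  truncation level \<open>b = a t\<close>. At this level the possible overshoot costs only the
  bounded factor \<open>exp (s * b)\<close>, and the second order terms of the Laplace transform are
  of order \<open>1 / t\<close>.\<close>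

lemma exp_Z_bound:
  assumes \<theta>: "0 \<le> \<theta>"
  obtains C where "0 < C" "\<forall>\<^sub>F t in at_top. integrable M (\<lambda>\<omega>. exp (\<theta> * Z t \<omega>)) \<and> expectation (\<lambda>\<omega>. exp (\<theta> * Z t \<omega>)) \<le> C"
proof -
  \<comment> \<open>\<open>D\<close> bounds \<open>s * b\<close>: the leading part of
    \<open>s\<close> contributes \<open>\<theta> / mu\<close>, and the correction
    \<open>\<kappa> * a t / t\<close> is eventually below 1. Then \<open>\<kappa> * mu\<close> is
    chosen to exceed by 1 the limit \<open>D^2 / 2 * L\<close> of \<open>t\<close> times the second
    order terms.\<close>
  define D where "D = \<theta> / mu + 1"
  define \<kappa> where "\<kappa> = (D\<^sup>2 / 2 * L + 1) / mu"
  have D: "0 < D"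
    using \<theta> mu_pos by (simp add: D_def add_nonneg_pos)
  have \<kappa>: "0 < \<kappa>"
    using L_pos mu_pos by (auto simp: \<kappa>_def intro!: divide_pos_pos add_nonneg_pos)
  have "((\<lambda>t. D * (t / a t * tail1 (1 * a t)) + D\<^sup>2 / 2 * (t * trunc2 (a t) / (a t)\<^sup>2)) \<longlongrightarrow> D * 0 + D\<^sup>2 / 2 * L) at_top"
    by (intro tendsto_add tendsto_mult tendsto_const tail1_scaled L) simp
  then have ev1: "\<forall>\<^sub>F t in at_top. D * (t / a t * tail1 (1 * a t)) + D\<^sup>2 / 2 * (t * trunc2 (a t) / (a t)\<^sup>2) < \<kappa> * mu"
    using mu_pos by (intro order_tendstoD(2)) (auto simp: \<kappa>_def)
  have "((\<lambda>t. \<kappa> * (a t / t)) \<longlongrightarrow> \<kappa> * 0) at_top"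
    by (intro tendsto_mult tendsto_const a_small)
  then have ev2: "\<forall>\<^sub>F t in at_top. \<kappa> * (a t / t) < 1"
    by (intro order_tendstoD(2)) auto
  show thesis
  proof (rule that[of "exp (\<kappa> + D)"])
    show "\<forall>\<^sub>F t in at_top. integrable M (\<lambda>\<omega>. exp (\<theta> * Z t \<omega>)) \<and> expectation (\<lambda>\<omega>. exp (\<theta> * Z t \<omega>)) \<le> exp (\<kappa> + D)"
      using ev1 ev2 eventually_gt_at_top[of 0] a_pos
    proof eventually_elim
      case (elim t)
      define b where "b = a t"
      have b: "0 < b" and t: "0 < t"
        using elim by (auto simp: b_def)
      \<comment> \<open>The leading term of \<open>s\<close> makes \<open>exp (\<theta> / b)\<close> and the Laplace transform cancel to first order;
        \<open>\<kappa> / t\<close> absorbs the second order terms.\<close>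
      define s where "s = \<theta> / (mu * b) + \<kappa> / t"
      have s0: "0 \<le> s"
        using \<theta> mu_pos b t \<kappa> by (simp add: s_def)
      have sb: "s * b \<le> D"
        using elim b t mu_pos by (simp add: s_def D_def b_def field_simps)
      have main: "s * tail1 b + s\<^sup>2 / 2 * trunc2 b \<le> \<kappa> * mu / t"
      proof -
        have "t * (s * tail1 b) \<le> D * (t / b * tail1 b)"
          using mult_right_mono[OF sb, of "t / b * tail1 b"] b t tail1_nonneg[of b] by (simp add: field_simps)
        moreover have "t * (s\<^sup>2 / 2 * trunc2 b) \<le> D\<^sup>2 / 2 * (t * trunc2 b / b\<^sup>2)"
        proof -
          have "(s * b)\<^sup>2 \<le> D\<^sup>2"
            using sb s0 b by (intro power_mono) auto
          then have "(s * b)\<^sup>2 * (t * trunc2 b / b\<^sup>2 / 2) \<le> D\<^sup>2 * (t * trunc2 b / b\<^sup>2 / 2)"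
            using t trunc2_nonneg[of b] by (intro mult_right_mono) auto
          then show ?thesis
            using b by (simp add: power_mult_distrib field_simps)
        qed
        moreover have "D * (t / b * tail1 b) + D\<^sup>2 / 2 * (t * trunc2 b / b\<^sup>2) < \<kappa> * mu"
          using elim by (simp add: b_def)
        ultimately have "t * (s * tail1 b + s\<^sup>2 / 2 * trunc2 b) \<le> \<kappa> * mu"
          unfolding distrib_left by linarith
        then show ?thesis
          using t by (simp add: field_simps)
      qed
      have "expectation (\<lambda>\<omega>. exp (- s * min (xi \<omega>) b)) \<le> 1 + (- s * mu + (s * tail1 b + s\<^sup>2 / 2 * trunc2 b))"
        using laplace_bound[of s b] s0 b by simp
      also have "\<dots> \<le> 1 + (- (\<theta> / b))"
      proof -
        have "s * mu = \<theta> / b + \<kappa> * mu / t"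
          using mu_pos b t by (simp add: s_def field_simps)
        then show ?thesis
          using main by simp
      qed
      also have "\<dots> \<le> exp (- (\<theta> / b))"
        by (rule exp_ge_add_one_self)
      finally have le: "exp (\<theta> / b) * expectation (\<lambda>\<omega>. exp (- s * min (xi \<omega>) b)) \<le> 1"
        by (simp add: exp_minus field_simps)
      have eq: "exp (\<theta> * Z t \<omega>) = exp (- (\<theta> * t / (mu * b))) * exp (\<theta> / b * N t \<omega>)" for \<omega>
        unfolding exp_add[symmetric] using b mu_pos by (simp add: Z_def b_def field_simps)
      have Nb: "integrable M (\<lambda>\<omega>. exp (\<theta> / b * N t \<omega>))" "expectation (\<lambda>\<omega>. exp (\<theta> / b * N t \<omega>)) \<le> exp (s * (t + b))"
        using exp_N_bound[OF _ _ s0 le] b t by auto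
      have "exp (- (\<theta> * t / (mu * b))) * expectation (\<lambda>\<omega>. exp (\<theta> / b * N t \<omega>)) \<le> exp (- (\<theta> * t / (mu * b))) * exp (s * (t + b))"
        using Nb by (intro mult_left_mono) auto
      also have "\<dots> = exp (\<kappa> + s * b)"
        unfolding exp_add[symmetric] using b t mu_pos by (simp add: s_def field_simps)
      also have "\<dots> \<le> exp (\<kappa> + D)"
        using sb by simp
      finally show ?case
        unfolding eq using Nb by simp
    qed
  qed simp
qed

text \<open>Only upper exponential moments are known so far. Wald's inequality
  \<open>t \<le> mu * E N\<close> makes the mean of \<open>Z\<close> nonnegative, so the negative
  part has at most the mean of the positive part; pointwise,
  \<open>\<bar>Z\<bar> \<le> 2 * exp Z - Z\<close>.\<close>

lemma abs_Z_bound: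
  obtains C where "0 < C" "\<forall>\<^sub>F t in at_top. integrable M (Z t) \<and> expectation (\<lambda>\<omega>. \<bar>Z t \<omega>\<bar>) \<le> C"
proof -
  obtain C where C: "0 < C" "\<forall>\<^sub>F t in at_top. integrable M (\<lambda>\<omega>. exp (1 * Z t \<omega>)) \<and> expectation (\<lambda>\<omega>. exp (1 * Z t \<omega>)) \<le> C"
    using exp_Z_bound[of 1] by auto
  show thesis
  proof (rule that[of "2 * C"])
    show "\<forall>\<^sub>F t in at_top. integrable M (Z t) \<and> expectation (\<lambda>\<omega>. \<bar>Z t \<omega>\<bar>) \<le> 2 * C"
      using C(2) a_pos eventually_gt_at_top[of 0]
    proof eventually_elim
      case (elim t)
      have i: "integrable M (Z t)"
        unfolding Z_def[abs_def] using integrable_N[of t] elim by simp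
      have "expectation (Z t) = (mean_N t - t / mu) / a t"
        unfolding Z_def[abs_def] using integrable_N[of t] elim by (simp add: prob_space)
      moreover have "t / mu \<le> mean_N t"
        using wald_mean(1)[of t] mu_pos elim by (simp add: field_simps)
      ultimately have "0 \<le> expectation (Z t)"
        using elim by simp
      have "expectation (\<lambda>\<omega>. \<bar>Z t \<omega>\<bar>) \<le> expectation (\<lambda>\<omega>. 2 * exp (1 * Z t \<omega>) - Z t \<omega>)"
      proof (intro integral_mono)
        fix \<omega>
        have "Z t \<omega> \<le> exp (Z t \<omega>)" "0 < exp (Z t \<omega>)"
          using exp_ge_add_one_self[of "Z t \<omega>"] by linarith auto
        then show "\<bar>Z t \<omega>\<bar> \<le> 2 * exp (1 * Z t \<omega>) - Z t \<omega>"
          unfolding mult_1 by linarith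
      qed (use i elim in auto)
      also have "\<dots> = 2 * expectation (\<lambda>\<omega>. exp (1 * Z t \<omega>)) - expectation (Z t)"
        using i elim by simp
      finally show ?case
        using elim \<open>0 \<le> expectation (Z t)\<close> i by auto
    qed
  qed (use C in simp)
qed

text \<open>The elementary renewal theorem, here a by-product: \<open>N / t\<close> differs from
  \<open>1 / mu\<close> by \<open>(a t / t) * Z\<close>, with \<open>Z\<close> bounded in mean and
  \<open>a t / t\<close> tending to 0.\<close>

lemma mean_ratio: "((\<lambda>t. mean_N t / t) \<longlongrightarrow> 1 / mu) at_top"
proof -
  obtain C where C: "0 < C" "\<forall>\<^sub>F t in at_top. integrable M (Z t) \<and> expectation (\<lambda>\<omega>. \<bar>Z t \<omega>\<bar>) \<le> C"
    using abs_Z_bound by auto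
  have "((\<lambda>t. mean_N t / t - 1 / mu) \<longlongrightarrow> 0) at_top"
  proof (rule Lim_null_comparison)
    show "\<forall>\<^sub>F t in at_top. norm (mean_N t / t - 1 / mu) \<le> C * (a t / t)"
      using C(2) a_pos eventually_gt_at_top[of 0]
    proof eventually_elim
      case (elim t)
      have "mean_N t / t = expectation (\<lambda>\<omega>. N t \<omega> / t)"
        by simp
      also have "\<dots> = expectation (\<lambda>\<omega>. 1 / mu + a t / t * Z t \<omega>)"
        using elim by (simp only: N_eq_Z)
      also have "\<dots> = 1 / mu + a t / t * expectation (Z t)"
        using elim by (simp add: prob_space)
      finally have "mean_N t / t - 1 / mu = a t / t * expectation (Z t)"
        by simp
      moreover have "\<bar>expectation (Z t)\<bar> \<le> C"
        using elim integral_abs_bound[of M "Z t"] by linarith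
      ultimately show ?case
        using elim by (simp add: abs_mult divide_right_mono mult.commute mult_right_mono)
    qed
    show "((\<lambda>t. C * (a t / t)) \<longlongrightarrow> 0) at_top"
      using tendsto_mult_left[OF a_small, of C] by simp
  qed
  then show ?thesis
    by (simp add: LIM_zero_iff)
qed

text \<open>As \<open>N / t = 1 / mu + (a t / t) * Z\<close>, the exponent
  \<open>\<kappa> * N / t\<close> contains \<open>Z\<close> with a coefficient of at most 1. The
  second bound carries the extra factor \<open>\<bar>Z\<bar>\<close> that arises when
  \<open>exp (\<kappa> * N / t)\<close> is compared with \<open>exp (\<kappa> / mu)\<close>.\<close>

lemma exp_ratio_le:
  assumes "0 < t" "0 < a t" "0 \<le> \<kappa>" "\<kappa> * (a t / t) \<le> 1"
  shows "exp (\<kappa> * (N t \<omega> / t)) \<le> exp (\<kappa> / mu) * (1 + exp (Z t \<omega>))"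
    and "\<bar>Z t \<omega>\<bar> * exp (\<kappa> * (N t \<omega> / t)) \<le> exp (\<kappa> / mu) * (\<bar>Z t \<omega>\<bar> + exp (2 * Z t \<omega>))"
proof -
  have eq: "exp (\<kappa> * (N t \<omega> / t)) = exp (\<kappa> / mu) * exp (\<kappa> * (a t / t) * Z t \<omega>)"
    unfolding N_eq_Z[OF assms(1,2)] exp_add[symmetric] by (simp add: algebra_simps)
  have nn: "0 \<le> \<kappa> * (a t / t)"
    using assms by (intro mult_nonneg_nonneg) auto
  have le: "exp (\<kappa> * (a t / t) * Z t \<omega>) \<le> 1" if "Z t \<omega> \<le> 0"
    using nn that by (simp only: exp_le_one_iff) (rule mult_nonneg_nonpos)
  have ge: "exp (\<kappa> * (a t / t) * Z t \<omega>) \<le> exp (Z t \<omega>)" if "0 \<le> Z t \<omega>"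
    using mult_right_mono[OF assms(4) that] by simp
  have "exp (\<kappa> * (a t / t) * Z t \<omega>) \<le> 1 + exp (Z t \<omega>)"
    using le ge exp_ge_zero[of "Z t \<omega>"] by (cases "0 \<le> Z t \<omega>") (auto intro: order_trans)
  then show "exp (\<kappa> * (N t \<omega> / t)) \<le> exp (\<kappa> / mu) * (1 + exp (Z t \<omega>))"
    unfolding eq by (intro mult_left_mono) auto
  have "\<bar>Z t \<omega>\<bar> * exp (\<kappa> * (a t / t) * Z t \<omega>) \<le> \<bar>Z t \<omega>\<bar> + exp (2 * Z t \<omega>)"
  proof (cases "0 \<le> Z t \<omega>")
    case True
    have "Z t \<omega> \<le> exp (Z t \<omega>)"
      using exp_ge_add_one_self[of "Z t \<omega>"] by linarith
    then have "Z t \<omega> * exp (\<kappa> * (a t / t) * Z t \<omega>) \<le> exp (Z t \<omega>) * exp (Z t \<omega>)"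
      using ge[OF True] True by (intro mult_mono) auto
    then show ?thesis
      using True unfolding exp_add[symmetric] by simp
  next
    case False
    then have "\<bar>Z t \<omega>\<bar> * exp (\<kappa> * (a t / t) * Z t \<omega>) \<le> \<bar>Z t \<omega>\<bar> * 1"
      using le by (intro mult_left_mono) auto
    then show ?thesis
      using exp_ge_zero[of "2 * Z t \<omega>"] by linarith
  qed
  then show "\<bar>Z t \<omega>\<bar> * exp (\<kappa> * (N t \<omega> / t)) \<le> exp (\<kappa> / mu) * (\<bar>Z t \<omega>\<bar> + exp (2 * Z t \<omega>))"
    unfolding eq using mult_left_mono[of _ _ "exp (\<kappa> / mu)"] by (simp add: mult_ac)
qed

lemma exp_ratio_bound:
  assumes \<kappa>: "0 \<le> \<kappa>"
  obtains C where "0 < C" "\<forall>\<^sub>F t in at_top. integrable M (\<lambda>\<omega>. exp (\<kappa> * (N t \<omega> / t))) \<and> expectation (\<lambda>\<omega>. exp (\<kappa> * (N t \<omega> / t))) \<le> C"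
    "\<forall>\<^sub>F t in at_top. integrable M (\<lambda>\<omega>. \<bar>Z t \<omega>\<bar> * exp (\<kappa> * (N t \<omega> / t))) \<and> expectation (\<lambda>\<omega>. \<bar>Z t \<omega>\<bar> * exp (\<kappa> * (N t \<omega> / t))) \<le> C"
proof -
  obtain C1 where C1: "0 < C1" "\<forall>\<^sub>F t in at_top. integrable M (\<lambda>\<omega>. exp (1 * Z t \<omega>)) \<and> expectation (\<lambda>\<omega>. exp (1 * Z t \<omega>)) \<le> C1"
    using exp_Z_bound[of 1] by auto
  obtain C2 where C2: "0 < C2" "\<forall>\<^sub>F t in at_top. integrable M (\<lambda>\<omega>. exp (2 * Z t \<omega>)) \<and> expectation (\<lambda>\<omega>. exp (2 * Z t \<omega>)) \<le> C2"
    using exp_Z_bound[of 2] by auto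
  obtain C3 where C3: "0 < C3" "\<forall>\<^sub>F t in at_top. integrable M (Z t) \<and> expectation (\<lambda>\<omega>. \<bar>Z t \<omega>\<bar>) \<le> C3"
    using abs_Z_bound by auto
  have "((\<lambda>t. \<kappa> * (a t / t)) \<longlongrightarrow> \<kappa> * 0) at_top"
    by (intro tendsto_mult tendsto_const a_small)
  then have ev: "\<forall>\<^sub>F t in at_top. \<kappa> * (a t / t) < 1"
    by (intro order_tendstoD(2)) auto
  show thesis
  proof (rule that[of "exp (\<kappa> / mu) * (1 + C1 + C2 + C3)"])
    show "\<forall>\<^sub>F t in at_top. integrable M (\<lambda>\<omega>. exp (\<kappa> * (N t \<omega> / t))) \<and>
      expectation (\<lambda>\<omega>. exp (\<kappa> * (N t \<omega> / t))) \<le> exp (\<kappa> / mu) * (1 + C1 + C2 + C3)"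
      using ev C1(2) eventually_gt_at_top[of 0] a_pos
    proof eventually_elim
      case (elim t)
      have iW: "integrable M (\<lambda>\<omega>. exp (\<kappa> / mu) * (1 + exp (Z t \<omega>)))"
        using elim by simp
      note le = exp_ratio_le(1)[of t \<kappa>]
      have i: "integrable M (\<lambda>\<omega>. exp (\<kappa> * (N t \<omega> / t)))"
        by (rule Bochner_Integration.integrable_bound[OF iW])
          (use le elim \<kappa> in \<open>auto intro!: AE_I2 simp: abs_mult abs_of_nonneg add_nonneg_nonneg\<close>)
      have "expectation (\<lambda>\<omega>. exp (\<kappa> * (N t \<omega> / t))) \<le> expectation (\<lambda>\<omega>. exp (\<kappa> / mu) * (1 + exp (Z t \<omega>)))"
        using le elim \<kappa> by (intro integral_mono i iW) auto
      also have "\<dots> = exp (\<kappa> / mu) * (1 + expectation (\<lambda>\<omega>. exp (Z t \<omega>)))"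
        using elim by (simp add: prob_space)
      also have "\<dots> \<le> exp (\<kappa> / mu) * (1 + C1 + C2 + C3)"
        using elim C1(1) C2(1) C3(1) by (intro mult_left_mono) auto
      finally show ?case
        using i by simp
    qed
    show "\<forall>\<^sub>F t in at_top. integrable M (\<lambda>\<omega>. \<bar>Z t \<omega>\<bar> * exp (\<kappa> * (N t \<omega> / t))) \<and>
      expectation (\<lambda>\<omega>. \<bar>Z t \<omega>\<bar> * exp (\<kappa> * (N t \<omega> / t))) \<le> exp (\<kappa> / mu) * (1 + C1 + C2 + C3)"
      using ev C2(2) C3(2) eventually_gt_at_top[of 0] a_pos
    proof eventually_elim
      case (elim t)
      have iW: "integrable M (\<lambda>\<omega>. exp (\<kappa> / mu) * (\<bar>Z t \<omega>\<bar> + exp (2 * Z t \<omega>)))"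
        using elim by simp
      note le = exp_ratio_le(2)[of t \<kappa>]
      have i: "integrable M (\<lambda>\<omega>. \<bar>Z t \<omega>\<bar> * exp (\<kappa> * (N t \<omega> / t)))"
        by (rule Bochner_Integration.integrable_bound[OF iW])
          (use le elim \<kappa> in \<open>auto intro!: AE_I2 simp: abs_mult abs_of_nonneg add_nonneg_nonneg\<close>)
      have "expectation (\<lambda>\<omega>. \<bar>Z t \<omega>\<bar> * exp (\<kappa> * (N t \<omega> / t))) \<le> expectation (\<lambda>\<omega>. exp (\<kappa> / mu) * (\<bar>Z t \<omega>\<bar> + exp (2 * Z t \<omega>)))"
        using le elim \<kappa> by (intro integral_mono i iW) auto
      also have "\<dots> = exp (\<kappa> / mu) * (expectation (\<lambda>\<omega>. \<bar>Z t \<omega>\<bar>) + expectation (\<lambda>\<omega>. exp (2 * Z t \<omega>)))"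
        using elim by simp
      also have "\<dots> \<le> exp (\<kappa> / mu) * (1 + C1 + C2 + C3)"
        using elim C1(1) C2(1) C3(1) by (intro mult_left_mono) auto
      finally show ?case
        using i by simp
    qed
  qed (use C1(1) C2(1) C3(1) in \<open>auto intro!: mult_pos_pos\<close>)
qed

end

subsection \<open>Convergence of the characteristic function\<close>

lemma norm_integral_le_AE:
  fixes f :: "'a \<Rightarrow> 'b :: {banach, second_countable_topology}"
  assumes "integrable M f" "integrable M g" "AE x in M. norm (f x) \<le> g x"
  shows "norm (\<integral>x. f x \<partial>M) \<le> (\<integral>x. g x \<partial>M)"
  by (rule order_trans[OF integral_norm_bound integral_mono_AE]) (use assms in auto)

lemma abs_exp_diff_le: "\<bar>exp x - exp y\<bar> \<le> \<bar>x - y\<bar> * (exp x + exp y)" for x y :: real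
proof -
  have main: "exp x - exp y \<le> (x - y) * (exp x + exp y)" if "y \<le> x" for x y :: real
  proof -
    have "exp x * (1 + (y - x)) \<le> exp x * exp (y - x)"
      by (intro mult_left_mono exp_ge_add_one_self) auto
    then have "exp x - exp y \<le> (x - y) * exp x"
      by (simp add: exp_diff algebra_simps)
    also have "\<dots> \<le> (x - y) * (exp x + exp y)"
      using that by (intro mult_left_mono) auto
    finally show ?thesis .
  qed
  show ?thesis
  proof (cases "y \<le> x")
    case True
    then show ?thesis using main[OF True] by simp
  next
    case False
    then have "\<bar>exp x - exp y\<bar> = exp y - exp x" "\<bar>x - y\<bar> = y - x"
      by auto
    then show ?thesis using main[of x y] False by (simp add: add.commute)
  qed
qed

lemma tendsto_exp_scaled: "((\<lambda>t. t * (exp (\<kappa> / t) - 1)) \<longlongrightarrow> \<kappa>) at_top" if "0 \<le> \<kappa>" for \<kappa> :: real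
proof -
  have "((\<lambda>t. t * (exp (\<kappa> / t) - 1) - \<kappa>) \<longlongrightarrow> 0) at_top"
  proof (rule Lim_null_comparison)
    show "\<forall>\<^sub>F t in at_top. norm (t * (exp (\<kappa> / t) - 1) - \<kappa>) \<le> \<kappa>\<^sup>2 / t"
      using eventually_ge_at_top[of \<kappa>] eventually_gt_at_top[of 0]
    proof eventually_elim
      case (elim t)
      have "exp (\<kappa> / t) \<le> 1 + \<kappa> / t + (\<kappa> / t)\<^sup>2" "1 + \<kappa> / t \<le> exp (\<kappa> / t)"
        using exp_bound[of "\<kappa> / t"] exp_ge_add_one_self[of "\<kappa> / t"] elim that by auto
      then have "exp (\<kappa> / t) - 1 \<le> \<kappa> / t + (\<kappa> / t)\<^sup>2" "\<kappa> / t \<le> exp (\<kappa> / t) - 1"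
        by linarith+
      then have "t * (exp (\<kappa> / t) - 1) \<le> t * (\<kappa> / t + (\<kappa> / t)\<^sup>2)" "t * (\<kappa> / t) \<le> t * (exp (\<kappa> / t) - 1)"
        using elim by (intro mult_left_mono; simp)+
      moreover have "t * (\<kappa> / t + (\<kappa> / t)\<^sup>2) = \<kappa> + \<kappa>\<^sup>2 / t"
        using elim by (simp add: field_simps power2_eq_square)
      moreover have "t * (\<kappa> / t) = \<kappa>"
        using elim by simp
      ultimately show ?case
        unfolding real_norm_def by linarith
    qed
    show "((\<lambda>t. \<kappa>\<^sup>2 / t) \<longlongrightarrow> 0) at_top"
      by (intro tendsto_divide_0[OF tendsto_const] filterlim_at_top_imp_at_infinity filterlim_ident)
  qed
  then show ?thesis
    by (simp add: LIM_zero_iff)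
qed

context renewal
begin

text \<open>Lindeberg's splitting at level \<open>b\<close>: second order Taylor expansion with
  cubic remainder for \<open>xi \<le> b\<close>, first order expansion beyond. \<open>V\<close> is
  the mean of \<open>(xi - mu)^2\<close> over \<open>xi \<le> b\<close>, written in truncated
  moments. The assumption \<open>mu \<le> b\<close> gives \<open>\<bar>xi - mu\<bar> \<le> b\<close>
  in the first range and \<open>\<bar>xi - mu\<bar> \<le> xi\<close> in the second.\<close>

lemma char_step_bound:
  assumes b: "mu \<le> b"
  defines "V \<equiv> trunc2 b - mu\<^sup>2 + 2 * mu * tail1 b - mu\<^sup>2 * tail0 b"
  shows "cmod (expectation (\<lambda>\<omega>. iexp (- u * (xi \<omega> - mu))) - 1 + u\<^sup>2 * V / 2) \<le> \<bar>u\<bar> ^ 3 * b * V / 6 + 2 * \<bar>u\<bar> * tail1 b"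
proof -
  define W where "W = (\<lambda>\<omega>. (xi \<omega> - mu)\<^sup>2 * indicator {\<omega>. xi \<omega> \<le> b} \<omega>)"
  have W_eq: "W \<omega> = (xi \<omega>)\<^sup>2 * indicator {\<omega>. xi \<omega> \<le> b} \<omega> - 2 * mu * (xi \<omega> - xi \<omega> * indicator {\<omega>. b < xi \<omega>} \<omega>)
      + mu\<^sup>2 * (1 - indicator {\<omega>. b < xi \<omega>} \<omega>)" for \<omega>
    by (auto simp: W_def indicator_def power2_eq_square algebra_simps)
  have i1: "integrable M (\<lambda>\<omega>. indicator {\<omega>. b < xi \<omega>} \<omega> :: real)"
    by (rule integrable_const_bound[of _ 1]) auto
  have iW: "integrable M W"
    unfolding W_eq[abs_def] using trunc2_int tail1_int xi_int i1 by simp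
  have "expectation W = trunc2 b - 2 * mu * (mu - tail1 b) + mu\<^sup>2 * (1 - tail0 b)"
    unfolding W_eq[abs_def] trunc2_eq tail1_def expectation_indicator_gt[symmetric] using trunc2_int tail1_int xi_int i1
    by (simp add: mu_def[symmetric] prob_space)
  then have eW: "expectation W = V"
    by (simp add: V_def power2_eq_square algebra_simps)
  define f where "f = (\<lambda>\<omega>. iexp (- u * (xi \<omega> - mu)) - 1 - \<i> * complex_of_real (- u * (xi \<omega> - mu)) + complex_of_real (u\<^sup>2 * W \<omega> / 2))"
  have ii: "integrable M (\<lambda>\<omega>. iexp (- u * (xi \<omega> - mu)))"
    by (rule integrable_const_bound[of _ 1]) auto
  have ixr: "integrable M (\<lambda>\<omega>. - u * (xi \<omega> - mu))"
  proof -
    have "integrable M (\<lambda>\<omega>. xi \<omega> - mu)"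
      using xi_int by simp
    then show ?thesis
      by (simp only: integrable_mult_left_iff simp_thms)
  qed
  have ix: "integrable M (\<lambda>\<omega>. complex_of_real (- u * (xi \<omega> - mu)))"
    by (rule integrable_of_real[OF ixr])
  have iWc: "integrable M (\<lambda>\<omega>. complex_of_real (u\<^sup>2 * W \<omega> / 2))"
    using iW by (intro integrable_of_real) simp
  have ef: "expectation f = expectation (\<lambda>\<omega>. iexp (- u * (xi \<omega> - mu))) - 1 + u\<^sup>2 * V / 2"
  proof -
    have "expectation (\<lambda>\<omega>. complex_of_real (- u * (xi \<omega> - mu))) = complex_of_real (expectation (\<lambda>\<omega>. - u * (xi \<omega> - mu)))"
      by (rule integral_of_real[OF ixr])
    also have "expectation (\<lambda>\<omega>. - u * (xi \<omega> - mu)) = 0"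
      using xi_int by (simp add: mu_def prob_space)
    finally have 1: "expectation (\<lambda>\<omega>. complex_of_real (- u * (xi \<omega> - mu))) = 0"
      by simp
    have "expectation (\<lambda>\<omega>. complex_of_real (u\<^sup>2 * W \<omega> / 2)) = complex_of_real (expectation (\<lambda>\<omega>. u\<^sup>2 * W \<omega> / 2))"
      using iW by (intro integral_of_real) simp
    also have "expectation (\<lambda>\<omega>. u\<^sup>2 * W \<omega> / 2) = u\<^sup>2 * V / 2"
      by (simp add: eW)
    finally have 2: "expectation (\<lambda>\<omega>. complex_of_real (u\<^sup>2 * W \<omega> / 2)) = u\<^sup>2 * V / 2" .
    have "expectation f = expectation (\<lambda>\<omega>. iexp (- u * (xi \<omega> - mu))) - expectation (\<lambda>\<omega>. 1)
        - \<i> * expectation (\<lambda>\<omega>. complex_of_real (- u * (xi \<omega> - mu))) + expectation (\<lambda>\<omega>. complex_of_real (u\<^sup>2 * W \<omega> / 2))"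
      unfolding f_def using ii ix iWc
      by (simp only: Bochner_Integration.integral_add Bochner_Integration.integral_diff
        Bochner_Integration.integrable_add Bochner_Integration.integrable_diff integrable_const
        integrable_mult_right integral_mult_right_zero)
    then show ?thesis
      unfolding 1 2 by (simp add: prob_space)
  qed
  have iB: "integrable M (\<lambda>\<omega>. \<bar>u\<bar> ^ 3 * b * W \<omega> / 6 + 2 * \<bar>u\<bar> * (xi \<omega> * indicator {\<omega>. b < xi \<omega>} \<omega>))"
    using iW tail1_int by simp
  have "cmod (expectation f) \<le> expectation (\<lambda>\<omega>. \<bar>u\<bar> ^ 3 * b * W \<omega> / 6 + 2 * \<bar>u\<bar> * (xi \<omega> * indicator {\<omega>. b < xi \<omega>} \<omega>))"
  proof (rule norm_integral_le_AE[OF _ iB])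
    show "integrable M f"
      unfolding f_def using ii ix iWc by simp
    have "AE \<omega> in M. cmod (f \<omega>) \<le> \<bar>u\<bar> ^ 3 * b * W \<omega> / 6 + 2 * \<bar>u\<bar> * (xi \<omega> * indicator {\<omega>. b < xi \<omega>} \<omega>)"
      using xi_pos
    proof eventually_elim
      case (elim \<omega>)
      define x where "x = - u * (xi \<omega> - mu)"
      show ?case
      proof (cases "xi \<omega> \<le> b")
        case True
        have "f \<omega> = iexp x - (\<Sum>k\<le>2. (\<i> * complex_of_real x) ^ k / fact k)"
        proof -
          have "u\<^sup>2 * W \<omega> = x\<^sup>2"
            using True by (simp add: W_def x_def power_mult_distrib)
          then show ?thesis
            unfolding f_def x_def[symmetric] by (simp add: eval_nat_numeral algebra_simps)
        qed
        then have "cmod (f \<omega>) \<le> \<bar>x\<bar> ^ 3 / 6"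
          using iexp_approx1[of x 2] by (simp add: eval_nat_numeral)
        also have "\<bar>x\<bar> ^ 3 \<le> \<bar>u\<bar> ^ 3 * b * W \<omega>"
        proof -
          have "\<bar>xi \<omega> - mu\<bar> \<le> b"
            using True elim b mu_pos by auto
          then have "\<bar>xi \<omega> - mu\<bar> * (xi \<omega> - mu)\<^sup>2 \<le> b * (xi \<omega> - mu)\<^sup>2"
            by (rule mult_right_mono) auto
          moreover have "\<bar>x\<bar> ^ 3 = \<bar>u\<bar> ^ 3 * (\<bar>xi \<omega> - mu\<bar> * (xi \<omega> - mu)\<^sup>2)"
          proof -
            have "\<bar>x\<bar> = \<bar>u\<bar> * \<bar>xi \<omega> - mu\<bar>"
              by (simp add: x_def abs_mult)
            moreover have "\<bar>xi \<omega> - mu\<bar> ^ 3 = \<bar>xi \<omega> - mu\<bar> * (xi \<omega> - mu)\<^sup>2"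
              by (simp add: power3_eq_cube power2_eq_square)
            ultimately show ?thesis
              by (simp only: power_mult_distrib)
          qed
          ultimately show ?thesis
            using True by (simp add: W_def mult.assoc mult_left_mono)
        qed
        finally show ?thesis
          using True by (simp add: field_simps)
      next
        case False
        have "f \<omega> = iexp x - (\<Sum>k\<le>1. (\<i> * complex_of_real x) ^ k / fact k)"
        proof -
          have "W \<omega> = 0"
            using False by (simp add: W_def)
          then show ?thesis
            unfolding f_def x_def[symmetric] by (simp add: algebra_simps)
        qed
        then have "cmod (f \<omega>) \<le> 2 * \<bar>x\<bar>"
          using iexp_approx2[of x 1] by simp
        also have "\<bar>x\<bar> \<le> \<bar>u\<bar> * xi \<omega>"
          unfolding x_def abs_mult abs_minus_cancel using False b mu_pos by (intro mult_left_mono) auto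
        finally show ?thesis
          using False by (simp add: W_def)
      qed
    qed
    then show "AE \<omega> in M. cmod (f \<omega>) \<le> \<bar>u\<bar> ^ 3 * b * W \<omega> / 6 + 2 * \<bar>u\<bar> * (xi \<omega> * indicator {\<omega>. b < xi \<omega>} \<omega>)" .
  qed
  also have "\<dots> = \<bar>u\<bar> ^ 3 * b * V / 6 + 2 * \<bar>u\<bar> * tail1 b"
    using iW tail1_int by (simp add: eW tail1_def[symmetric])
  finally show "cmod (expectation (\<lambda>\<omega>. iexp (- u * (xi \<omega> - mu))) - 1 + u\<^sup>2 * V / 2) \<le> \<bar>u\<bar> ^ 3 * b * V / 6 + 2 * \<bar>u\<bar> * tail1 b"
    by (simp only: ef)
qed

text \<open>A union bound over a random number of steps: the count is at least 1 as soon as one of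
  the first \<open>N\<close> steps exceeds \<open>y\<close>.\<close>

lemma wald_large_steps:
  assumes t: "0 \<le> t"
  shows "integrable M (\<lambda>\<omega>. \<Sum>k<N t \<omega>. of_bool (y < X (Suc k) \<omega>) :: real)"
    and "expectation (\<lambda>\<omega>. \<Sum>k<N t \<omega>. of_bool (y < X (Suc k) \<omega>)) = mean_N t * tail0 y"
proof -
  have ind: "(\<lambda>\<omega>. of_bool (y < xi \<omega>) :: real) = (\<lambda>\<omega>. indicator {\<omega>. y < xi \<omega>} \<omega>)"
    by (auto simp: indicator_def)
  have "integrable M (\<lambda>\<omega>. of_bool (y < xi \<omega>) :: real)"
    by (rule integrable_const_bound[of _ 1]) auto
  from wald[OF t _ _ this]
  show "integrable M (\<lambda>\<omega>. \<Sum>k<N t \<omega>. of_bool (y < X (Suc k) \<omega>) :: real)"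
    "expectation (\<lambda>\<omega>. \<Sum>k<N t \<omega>. of_bool (y < X (Suc k) \<omega>)) = mean_N t * tail0 y"
    unfolding expectation_indicator_gt[symmetric] ind[symmetric] by auto
qed

text \<open>Before the crossing step the sum is at most \<open>t\<close>. The index
  \<open>Suc (N t \<omega> - 1)\<close> is \<open>N t \<omega>\<close> itself, written so that it
  matches the summand \<open>k = N - 1\<close> in sums over \<open>k < N\<close>.\<close>

lemma overshoot_le_last_step:
  assumes "good t \<omega>" "0 \<le> t"
  shows "partial_sum X (N t \<omega>) \<omega> - t \<le> X (Suc (N t \<omega> - 1)) \<omega>"
proof -
  have "0 < N t \<omega>"
    using good_sum_pos[OF assms] by simp
  moreover have "partial_sum X (N t \<omega> - 1) \<omega> \<le> t"
    using alive_iff[OF assms(1), of "N t \<omega> - 1"] \<open>0 < N t \<omega>\<close> assms(2) by (auto intro: alive_le)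
  ultimately show ?thesis
    using partial_sum_Suc[of "N t \<omega> - 1" \<omega>] by simp
qed

end

context scaled_renewal
begin

lemma char_step_tendsto:
  "((\<lambda>t. complex_of_real t * (expectation (\<lambda>\<omega>. iexp (- (\<theta> / (mu * a t)) * (xi \<omega> - mu))) - 1))
      \<longlongrightarrow> - complex_of_real (\<theta>\<^sup>2 * mu / 2)) at_top"
proof (rule tendstoI)
  fix r :: real assume r: "0 < r"
  \<comment> \<open>The truncation level is \<open>e * a t\<close>. The cubic remainder, multiplied
    by \<open>t\<close>, tends to \<open>\<bar>\<theta>\<bar>^3 * e / 6\<close>, and this choice of
    \<open>e\<close> keeps it below \<open>r\<close>.\<close>
  define e where "e = r / (\<bar>\<theta>\<bar> ^ 3 + 1)"
  have pos: "0 < \<bar>\<theta>\<bar> ^ 3 + 1"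
    by (intro add_nonneg_pos) auto
  have e: "0 < e"
    using r pos by (simp add: e_def)
  have er: "\<bar>\<theta>\<bar> ^ 3 * e / 6 < r"
  proof -
    have "\<bar>\<theta>\<bar> ^ 3 * e \<le> (\<bar>\<theta>\<bar> ^ 3 + 1) * e"
      using e by (intro mult_right_mono) auto
    also have "\<dots> = r"
      using pos by (simp add: e_def)
    finally show ?thesis
      using r by simp
  qed
  define V where "V = (\<lambda>t. trunc2 (e * a t) - mu\<^sup>2 + 2 * mu * tail1 (e * a t) - mu\<^sup>2 * tail0 (e * a t))"
  define u where "u = (\<lambda>t. \<theta> / (mu * a t))"
  define f where "f = (\<lambda>t. expectation (\<lambda>\<omega>. iexp (- u t * (xi \<omega> - mu))))"
  have inv0: "((\<lambda>t. 1 / a t) \<longlongrightarrow> 0) at_top"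
    by (intro tendsto_divide_0[OF tendsto_const] filterlim_at_top_imp_at_infinity a_top)
  \<comment> \<open>An expansion of \<open>t * u^2 * V\<close> into quantities with known limits:
    the two terms containing tails vanish, and \<open>L_rel\<close> evaluates the rest as
    \<open>\<theta>^2 / mu^2 * mu^3\<close>.\<close>
  have "((\<lambda>t. \<theta>\<^sup>2 / mu\<^sup>2 * (t * trunc2 (e * a t) / (a t)\<^sup>2 - mu\<^sup>2 * (t / (a t)\<^sup>2)
      + 2 * mu * (t / a t * tail1 (e * a t)) * (1 / a t)
      - mu\<^sup>2 * (t * tail0 (e * a t)) * (1 / a t * (1 / a t))))
      \<longlongrightarrow> \<theta>\<^sup>2 / mu\<^sup>2 * (L - mu\<^sup>2 * L' + 2 * mu * 0 * 0 - mu\<^sup>2 * 0 * (0 * 0))) at_top"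
    by (intro tendsto_intros L_scaled L' tail1_scaled prob_scaled e inv0)
  also have "\<theta>\<^sup>2 / mu\<^sup>2 * (L - mu\<^sup>2 * L' + 2 * mu * 0 * 0 - mu\<^sup>2 * 0 * (0 * 0)) = \<theta>\<^sup>2 * mu"
    using L_rel mu_pos by (simp add: power2_eq_square power3_eq_cube)
  finally have "((\<lambda>t. \<theta>\<^sup>2 / mu\<^sup>2 * (t * trunc2 (e * a t) / (a t)\<^sup>2 - mu\<^sup>2 * (t / (a t)\<^sup>2)
      + 2 * mu * (t / a t * tail1 (e * a t)) * (1 / a t)
      - mu\<^sup>2 * (t * tail0 (e * a t)) * (1 / a t * (1 / a t))))
      \<longlongrightarrow> \<theta>\<^sup>2 * mu) at_top" .
  moreover have "\<forall>\<^sub>F t in at_top. \<theta>\<^sup>2 / mu\<^sup>2 * (t * trunc2 (e * a t) / (a t)\<^sup>2 - mu\<^sup>2 * (t / (a t)\<^sup>2)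
      + 2 * mu * (t / a t * tail1 (e * a t)) * (1 / a t)
      - mu\<^sup>2 * (t * tail0 (e * a t)) * (1 / a t * (1 / a t))) = t * ((u t)\<^sup>2 * V t)"
    using a_pos by eventually_elim
      (use mu_pos in \<open>simp add: u_def V_def power_divide power_mult_distrib add_divide_distrib diff_divide_distrib algebra_simps power2_eq_square\<close>)
  ultimately have tV: "((\<lambda>t. t * ((u t)\<^sup>2 * V t)) \<longlongrightarrow> \<theta>\<^sup>2 * mu) at_top"
    by (rule Lim_transform_eventually)
  define B where "B = (\<lambda>t. \<bar>\<theta>\<^sup>2 * mu - t * ((u t)\<^sup>2 * V t)\<bar> / 2 + (\<bar>\<theta>\<bar> * e / (6 * mu)) * (t * ((u t)\<^sup>2 * V t))
      + 2 * \<bar>\<theta>\<bar> / mu * (t / a t * tail1 (e * a t)))"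
  have "(B \<longlongrightarrow> \<bar>\<theta>\<^sup>2 * mu - \<theta>\<^sup>2 * mu\<bar> / 2 + (\<bar>\<theta>\<bar> * e / (6 * mu)) * (\<theta>\<^sup>2 * mu) + 2 * \<bar>\<theta>\<bar> / mu * 0) at_top"
    unfolding B_def by (intro tendsto_intros tV tail1_scaled e) simp
  also have "\<bar>\<theta>\<^sup>2 * mu - \<theta>\<^sup>2 * mu\<bar> / 2 + (\<bar>\<theta>\<bar> * e / (6 * mu)) * (\<theta>\<^sup>2 * mu) + 2 * \<bar>\<theta>\<bar> / mu * 0 = \<bar>\<theta>\<bar> ^ 3 * e / 6"
    using mu_pos by (simp add: power3_eq_cube power2_eq_square)
  finally have evB: "\<forall>\<^sub>F t in at_top. B t < r"
    using er by (rule order_tendstoD(2))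
  have evb: "\<forall>\<^sub>F t in at_top. mu \<le> e * a t"
    using scaled_top[OF e] by (simp add: filterlim_at_top)
  show "\<forall>\<^sub>F t in at_top. dist (complex_of_real t * (expectation (\<lambda>\<omega>. iexp (- (\<theta> / (mu * a t)) * (xi \<omega> - mu))) - 1))
        (- complex_of_real (\<theta>\<^sup>2 * mu / 2)) < r"
    using evB evb a_pos eventually_gt_at_top[of 0]
  proof eventually_elim
    case (elim t)
    let ?b = "e * a t"
    have le: "cmod (f t - 1 + (u t)\<^sup>2 * V t / 2) \<le> \<bar>u t\<bar> ^ 3 * ?b * V t / 6 + 2 * \<bar>u t\<bar> * tail1 ?b"
      unfolding f_def V_def using char_step_bound[of ?b "u t"] elim by simp
    have "complex_of_real t * (f t - 1) + complex_of_real (\<theta>\<^sup>2 * mu / 2)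
      = complex_of_real t * (f t - 1 + (u t)\<^sup>2 * V t / 2) + complex_of_real ((\<theta>\<^sup>2 * mu - t * ((u t)\<^sup>2 * V t)) / 2)"
      by (simp add: algebra_simps add_divide_distrib diff_divide_distrib)
    also have "cmod \<dots> \<le> cmod (complex_of_real t * (f t - 1 + (u t)\<^sup>2 * V t / 2)) + cmod (complex_of_real ((\<theta>\<^sup>2 * mu - t * ((u t)\<^sup>2 * V t)) / 2))"
      by (rule norm_triangle_ineq)
    also have "\<dots> = t * cmod (f t - 1 + (u t)\<^sup>2 * V t / 2) + \<bar>\<theta>\<^sup>2 * mu - t * ((u t)\<^sup>2 * V t)\<bar> / 2"
      unfolding norm_mult norm_of_real using elim by simp
    also have "\<dots> \<le> t * (\<bar>u t\<bar> ^ 3 * ?b * V t / 6 + 2 * \<bar>u t\<bar> * tail1 ?b) + \<bar>\<theta>\<^sup>2 * mu - t * ((u t)\<^sup>2 * V t)\<bar> / 2"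
      using le elim by (intro add_right_mono mult_left_mono) auto
    also have "t * (\<bar>u t\<bar> ^ 3 * ?b * V t / 6 + 2 * \<bar>u t\<bar> * tail1 ?b)
      = (\<bar>u t\<bar> * ?b / 6) * (t * ((u t)\<^sup>2 * V t)) + 2 * (t * \<bar>u t\<bar> * tail1 ?b)"
      by (simp add: power3_eq_cube power2_eq_square distrib_left) 
    also have "\<bar>u t\<bar> * ?b / 6 = \<bar>\<theta>\<bar> * e / (6 * mu)"
      using elim mu_pos by (simp add: u_def abs_mult field_simps)
    also have "2 * (t * \<bar>u t\<bar> * tail1 ?b) = 2 * \<bar>\<theta>\<bar> / mu * (t / a t * tail1 ?b)"
      using elim mu_pos by (simp add: u_def abs_mult field_simps)
    finally have "cmod (complex_of_real t * (f t - 1) + complex_of_real (\<theta>\<^sup>2 * mu / 2)) \<le> B t"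
      by (simp add: B_def)
    then show ?case
      using elim unfolding dist_norm diff_minus_eq_add f_def u_def by linarith
  qed
qed

text \<open>The stopped sum equals \<open>t\<close> plus the overshoot, so
  \<open>- u * (S_N - mu * N)\<close> splits into \<open>u * (mu * N - t) = \<theta> * Z\<close> and
  a phase that contains only the overshoot.\<close>

lemma random_prod_char:
  assumes "good t \<omega>" "0 < t" "0 < a t"
  shows "(\<Prod>k<N t \<omega>. iexp (- (\<theta> / (mu * a t)) * (X (Suc k) \<omega> - mu)) * complex_of_real (exp (\<kappa> / t)))
    = iexp (\<theta> * Z t \<omega>) * iexp (- (\<theta> / (mu * a t)) * (partial_sum X (N t \<omega>) \<omega> - t)) * complex_of_real (exp (\<kappa> * (N t \<omega> / t)))"
proof -
  define u where "u = \<theta> / (mu * a t)"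
  have Z: "\<theta> * Z t \<omega> = u * (mu * N t \<omega> - t)"
    using assms mu_pos by (simp add: Z_def u_def field_simps)
  have "(\<Prod>k<N t \<omega>. iexp (- u * (X (Suc k) \<omega> - mu)) * complex_of_real (exp (\<kappa> / t)))
    = exp (\<Sum>k<N t \<omega>. \<i> * complex_of_real (- u * (X (Suc k) \<omega> - mu)) + complex_of_real (\<kappa> / t))"
    by (simp only: exp_sum finite_lessThan exp_add exp_of_real)
  also have "(\<Sum>k<N t \<omega>. \<i> * complex_of_real (- u * (X (Suc k) \<omega> - mu)) + complex_of_real (\<kappa> / t))
    = \<i> * complex_of_real (- u * (partial_sum X (N t \<omega>) \<omega> - mu * N t \<omega>)) + complex_of_real (\<kappa> * (N t \<omega> / t))"
    by (simp add: partial_sum_eq sum.distrib sum_distrib_left[symmetric] sum_subtractf algebra_simps)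
  also have "exp \<dots> = exp (\<i> * complex_of_real (\<theta> * Z t \<omega>) + \<i> * complex_of_real (- u * (partial_sum X (N t \<omega>) \<omega> - t)) + complex_of_real (\<kappa> * (N t \<omega> / t)))"
    unfolding Z by (rule arg_cong[of _ _ exp]) (simp add: algebra_simps)
  finally show ?thesis
    by (simp only: exp_add exp_of_real u_def)
qed

lemma char_Z_tendsto:
  "((\<lambda>t. expectation (\<lambda>\<omega>. iexp (\<theta> * Z t \<omega>))) \<longlongrightarrow> complex_of_real (exp (- (\<theta>\<^sup>2) / 2))) at_top"
proof -
  define \<kappa> where "\<kappa> = \<theta>\<^sup>2 * mu / 2"
  have \<kappa>: "0 \<le> \<kappa>"
    using mu_pos by (simp add: \<kappa>_def)
  have \<kappa>mu: "\<kappa> / mu = \<theta>\<^sup>2 / 2"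
    using mu_pos by (simp add: \<kappa>_def)
  define u where "u = (\<lambda>t. \<theta> / (mu * a t))"
  define h where "h = (\<lambda>t. expectation (\<lambda>\<omega>. iexp (- u t * (xi \<omega> - mu))))"
  \<comment> \<open>The defect must be \<open>o (1 / t)\<close>, not merely \<open>o 1\<close>,
    because \<open>random_prod_bound\<close> multiplies it by the mean of \<open>N * R ^ N\<close>,
    which is of order \<open>t\<close>.\<close>
  define \<delta> where "\<delta> = (\<lambda>t. cmod (h t * complex_of_real (exp (\<kappa> / t)) - 1))"
  \<comment> \<open>The exponent \<open>\<kappa> + 1\<close> leaves room for the extra factor
    \<open>N\<close>, by \<open>N \<le> t * exp (N / t)\<close>.\<close>
  obtain C1 where C1: "0 < C1" "\<forall>\<^sub>F t in at_top. integrable M (\<lambda>\<omega>. exp ((\<kappa> + 1) * (N t \<omega> / t))) \<and>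
      expectation (\<lambda>\<omega>. exp ((\<kappa> + 1) * (N t \<omega> / t))) \<le> C1"
    by (rule exp_ratio_bound[of "\<kappa> + 1"]) (use \<kappa> in simp)
  obtain C2 where C2: "0 < C2" "\<forall>\<^sub>F t in at_top. integrable M (\<lambda>\<omega>. \<bar>Z t \<omega>\<bar> * exp (\<kappa> * (N t \<omega> / t))) \<and>
      expectation (\<lambda>\<omega>. \<bar>Z t \<omega>\<bar> * exp (\<kappa> * (N t \<omega> / t))) \<le> C2"
    by (rule exp_ratio_bound[OF \<kappa>])
  obtain C3 where C3: "0 < C3" "\<forall>\<^sub>F t in at_top. integrable M (Z t) \<and> expectation (\<lambda>\<omega>. \<bar>Z t \<omega>\<bar>) \<le> C3"
    using abs_Z_bound by auto
  have \<delta>0: "((\<lambda>t. t * \<delta> t) \<longlongrightarrow> 0) at_top"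
  proof -
    have cs: "((\<lambda>t. complex_of_real t * (expectation (\<lambda>\<omega>. iexp (- (\<theta> / (mu * a t)) * (xi \<omega> - mu))) - 1))
      \<longlongrightarrow> - complex_of_real \<kappa>) at_top"
      unfolding \<kappa>_def by (rule char_step_tendsto)
    have "((\<lambda>t. complex_of_real t * (h t - 1) * complex_of_real (exp (\<kappa> / t)) + complex_of_real (t * (exp (\<kappa> / t) - 1)))
      \<longlongrightarrow> - complex_of_real \<kappa> * complex_of_real (exp 0) + complex_of_real \<kappa>) at_top"
      unfolding h_def u_def using \<kappa>
      by (intro tendsto_add tendsto_mult tendsto_of_real tendsto_exp tendsto_exp_scaled cs
          tendsto_divide_0[OF tendsto_const] filterlim_at_top_imp_at_infinity filterlim_ident)
    then have "((\<lambda>t. cmod (complex_of_real t * (h t - 1) * complex_of_real (exp (\<kappa> / t)) + complex_of_real (t * (exp (\<kappa> / t) - 1))))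
      \<longlongrightarrow> 0) at_top"
      by (simp add: tendsto_norm_zero)
    moreover have "\<forall>\<^sub>F t in at_top. cmod (complex_of_real t * (h t - 1) * complex_of_real (exp (\<kappa> / t)) + complex_of_real (t * (exp (\<kappa> / t) - 1))) = t * \<delta> t"
      using eventually_gt_at_top[of 0]
    proof eventually_elim
      case (elim t)
      have "complex_of_real t * (h t - 1) * complex_of_real (exp (\<kappa> / t)) + complex_of_real (t * (exp (\<kappa> / t) - 1))
         = complex_of_real t * (h t * complex_of_real (exp (\<kappa> / t)) - 1)"
        by (simp add: algebra_simps)
      then show ?case
        using elim by (simp add: norm_mult \<delta>_def)
    qed
    ultimately show ?thesis
      by (rule Lim_transform_eventually)
  qed
  have "((\<lambda>t. expectation (\<lambda>\<omega>. iexp (\<theta> * Z t \<omega>)) * complex_of_real (exp (\<kappa> / mu))) \<longlongrightarrow> 1) at_top"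
  proof (rule tendstoI)
    fix r :: real assume r: "0 < r"
    define e where "e = r / (exp (\<kappa> / mu) * \<bar>\<theta>\<bar> / mu + 1)"
    have pos: "0 < exp (\<kappa> / mu) * \<bar>\<theta>\<bar> / mu + 1"
      using mu_pos by (intro add_nonneg_pos) auto
    have e: "0 < e"
      using r pos by (simp add: e_def)
    have er: "exp (\<kappa> / mu) * \<bar>\<theta>\<bar> / mu * e < r"
    proof -
      have "exp (\<kappa> / mu) * \<bar>\<theta>\<bar> / mu * e < (exp (\<kappa> / mu) * \<bar>\<theta>\<bar> / mu + 1) * e"
        using e by (intro mult_strict_right_mono) auto
      also have "\<dots> = r"
        using pos by (simp add: e_def)
      finally show ?thesis .
    qed
    define p where "p = (\<lambda>t. tail0 (e * a t))"
    \<comment> \<open>The error budget: the martingale defect of the product, the replacement of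
      \<open>exp (\<kappa> * N / t)\<close> by \<open>exp (\<kappa> / mu)\<close>, and the overshoot
      phase. In the limit only \<open>exp (\<kappa> / mu) * \<bar>\<theta>\<bar> * e / mu\<close>
      remains, which \<open>e\<close> was chosen to keep below \<open>r\<close>.\<close>
    define B where "B = (\<lambda>t. C1 * (t * \<delta> t) + \<kappa> * (a t / t) * (exp (\<kappa> / mu) * C3 + C2)
       + exp (\<kappa> / mu) * (\<bar>\<theta>\<bar> * e / mu + 2 * ((mean_N t / t) * (t * p t))))"
    have "(B \<longlongrightarrow> C1 * 0 + \<kappa> * 0 * (exp (\<kappa> / mu) * C3 + C2) + exp (\<kappa> / mu) * (\<bar>\<theta>\<bar> * e / mu + 2 * (1 / mu * 0))) at_top"
      unfolding B_def p_def by (intro tendsto_add tendsto_mult tendsto_const \<delta>0 a_small mean_ratio prob_scaled e)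
    then have evB: "\<forall>\<^sub>F t in at_top. B t < r"
      using er by (intro order_tendstoD(2)) (auto simp: mult_ac)
    show "\<forall>\<^sub>F t in at_top. dist (expectation (\<lambda>\<omega>. iexp (\<theta> * Z t \<omega>)) * complex_of_real (exp (\<kappa> / mu))) 1 < r"
      using evB C1(2) C2(2) C3(2) a_pos eventually_gt_at_top[of 0]
    proof eventually_elim
      case (elim t)
      have t: "0 < t" "0 \<le> t" and at: "0 < a t"
        using elim by auto
      \<comment> \<open>The factor \<open>exp (\<kappa> / t)\<close> makes the mean of \<open>\<psi> (xi)\<close> equal to \<open>1 + o(1 / t)\<close>, so the product of
        about \<open>t / mu\<close> such factors is an approximate martingale.\<close>
      define \<psi> where "\<psi> = (\<lambda>x. iexp (- u t * (x - mu)) * complex_of_real (exp (\<kappa> / t)))"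
      define G where "G = (\<lambda>\<omega>. \<Prod>k<N t \<omega>. \<psi> (X (Suc k) \<omega>))"
      define R where "R = (\<lambda>\<omega>. partial_sum X (N t \<omega>) \<omega> - t)"
      have [measurable]: "R \<in> borel_measurable M"
        unfolding R_def using wald_mean(2)[OF t(2)] by (auto dest: borel_measurable_integrable)
      have \<psi>m: "\<psi> \<in> borel_measurable borel"
        unfolding \<psi>_def by measurable
      have \<psi>n: "norm (\<psi> x) \<le> exp (\<kappa> / t)" for x
        by (simp add: \<psi>_def norm_mult)
      have le1: "real n * exp (\<kappa> / t) ^ n \<le> t * exp ((\<kappa> + 1) * (n / t))" for n :: nat
      proof -
        have "real n / t \<le> exp (real n / t)"
          using exp_ge_add_one_self[of "real n / t"] by linarith
        then have "real n \<le> t * exp (real n / t)"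
          using t by (simp add: field_simps)
        then have "real n * exp (\<kappa> / t) ^ n \<le> t * exp (real n / t) * exp (\<kappa> / t) ^ n"
          by (intro mult_right_mono) auto
        also have "\<dots> = t * exp ((\<kappa> + 1) * (n / t))"
          by (simp add: exp_of_nat_mult[symmetric] exp_add[symmetric] algebra_simps add_divide_distrib)
        finally show ?thesis .
      qed
      have iNR: "integrable M (\<lambda>\<omega>. N t \<omega> * exp (\<kappa> / t) ^ N t \<omega>)"
      proof (rule Bochner_Integration.integrable_bound)
        show "integrable M (\<lambda>\<omega>. t * exp ((\<kappa> + 1) * (N t \<omega> / t)))"
          using elim by simp
      qed (use le1 t in \<open>auto intro!: AE_I2\<close>)
      have eNR: "expectation (\<lambda>\<omega>. N t \<omega> * exp (\<kappa> / t) ^ N t \<omega>) \<le> t * C1"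
      proof -
        have "expectation (\<lambda>\<omega>. N t \<omega> * exp (\<kappa> / t) ^ N t \<omega>) \<le> expectation (\<lambda>\<omega>. t * exp ((\<kappa> + 1) * (N t \<omega> / t)))"
          using elim le1 by (intro integral_mono iNR) auto
        also have "\<dots> \<le> t * C1"
          using elim by simp
        finally show ?thesis .
      qed
      have e\<psi>: "norm (expectation (\<lambda>\<omega>. \<psi> (xi \<omega>)) - 1) = \<delta> t"
        by (simp add: \<psi>_def \<delta>_def h_def)
      have "1 \<le> exp (\<kappa> / t)"
        using \<kappa> t by simp
      note rp = random_prod_bound[OF t(2) \<psi>m \<psi>n this iNR, folded G_def]
      have "cmod (expectation G - 1) \<le> expectation (\<lambda>\<omega>. N t \<omega> * exp (\<kappa> / t) ^ N t \<omega>) * \<delta> t"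
        using rp(2) by (simp only: e\<psi>)
      also have "\<dots> \<le> t * C1 * \<delta> t"
        using eNR by (intro mult_right_mono) (auto simp: \<delta>_def)
      finally have b1: "cmod (expectation G - 1) \<le> C1 * (t * \<delta> t)"
        by (simp add: mult_ac)
      define J where "J = (\<lambda>\<omega>. \<Sum>k<N t \<omega>. of_bool (e * a t < X (Suc k) \<omega>) :: real)"
      have iJ: "integrable M J" and eJ: "expectation J = mean_N t * p t"
        unfolding J_def p_def using t by (auto intro: wald_large_steps)
      have ae: "AE \<omega> in M. norm (iexp (\<theta> * Z t \<omega>) * complex_of_real (exp (\<kappa> / mu)) - G \<omega>)
        \<le> \<kappa> * (a t / t) * (exp (\<kappa> / mu) * \<bar>Z t \<omega>\<bar> + \<bar>Z t \<omega>\<bar> * exp (\<kappa> * (N t \<omega> / t)))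
          + exp (\<kappa> / mu) * (\<bar>\<theta>\<bar> * e / mu + 2 * J \<omega>)"
        using AE_good[OF t(2)]
      proof eventually_elim
        case (elim \<omega>)
        define w where "w = iexp (- u t * R \<omega>)"
        have nw: "cmod w = 1"
          by (simp add: w_def)
        have G: "G \<omega> = iexp (\<theta> * Z t \<omega>) * w * complex_of_real (exp (\<kappa> * (N t \<omega> / t)))"
          unfolding G_def \<psi>_def u_def w_def R_def using random_prod_char[OF elim t(1) at] by simp
        have "iexp (\<theta> * Z t \<omega>) * complex_of_real (exp (\<kappa> / mu)) - G \<omega>
          = iexp (\<theta> * Z t \<omega>) * (complex_of_real (exp (\<kappa> / mu) - exp (\<kappa> * (N t \<omega> / t))) * w + complex_of_real (exp (\<kappa> / mu)) * (1 - w))"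
          unfolding G by (simp add: algebra_simps)
        also have "norm \<dots> \<le> \<bar>exp (\<kappa> / mu) - exp (\<kappa> * (N t \<omega> / t))\<bar> + exp (\<kappa> / mu) * cmod (1 - w)"
          unfolding norm_mult by (rule order_trans[OF mult_left_mono[OF norm_triangle_ineq]])
            (simp_all add: norm_mult nw del: of_real_diff)
        also have "\<bar>exp (\<kappa> / mu) - exp (\<kappa> * (N t \<omega> / t))\<bar> \<le> \<kappa> * (a t / t) * (exp (\<kappa> / mu) * \<bar>Z t \<omega>\<bar> + \<bar>Z t \<omega>\<bar> * exp (\<kappa> * (N t \<omega> / t)))"
        proof -
          have "\<kappa> / mu - \<kappa> * (N t \<omega> / t) = - (\<kappa> * (a t / t) * Z t \<omega>)"
            unfolding N_eq_Z[OF t(1) at] by (simp add: algebra_simps)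
          then have "\<bar>\<kappa> / mu - \<kappa> * (N t \<omega> / t)\<bar> = \<kappa> * (a t / t) * \<bar>Z t \<omega>\<bar>"
            using \<kappa> t at by (simp add: abs_mult)
          then show ?thesis
            using abs_exp_diff_le[of "\<kappa> / mu" "\<kappa> * (N t \<omega> / t)"] by (simp add: algebra_simps)
        qed
        \<comment> \<open>Either the overshoot is at most \<open>e * a t\<close>, and the phase
          moves by at most \<open>\<bar>\<theta>\<bar> * e / mu\<close>; or the crossing step
          exceeds \<open>e * a t\<close> and is counted by \<open>J\<close>, so that the trivial
          bound 2 is covered.\<close>
        also have "cmod (1 - w) \<le> \<bar>\<theta>\<bar> * e / mu + 2 * J \<omega>"
        proof (cases "R \<omega> \<le> e * a t")
          case True
          have R0: "0 \<le> R \<omega>"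
            using good_sum_pos[OF elim t(2)] by (simp add: R_def)
          have "cmod (w - 1) \<le> \<bar>- u t * R \<omega>\<bar>"
            using iexp_approx1[of "- u t * R \<omega>" 0] by (simp add: w_def)
          also have "\<dots> = \<bar>u t\<bar> * R \<omega>"
            using R0 by (simp add: abs_mult)
          also have "\<dots> \<le> \<bar>u t\<bar> * (e * a t)"
            using True by (intro mult_left_mono) auto
          also have "\<dots> = \<bar>\<theta>\<bar> * e / mu"
            using at mu_pos by (simp add: u_def abs_mult)
          moreover have "0 \<le> J \<omega>"
            by (auto simp: J_def intro: sum_nonneg)
          ultimately show ?thesis
            by (simp add: norm_minus_commute)
        next
          case False
          have "R \<omega> \<le> X (Suc (N t \<omega> - 1)) \<omega>"
            unfolding R_def by (rule overshoot_le_last_step[OF elim t(2)])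
          then have "(1::real) \<le> of_bool (e * a t < X (Suc (N t \<omega> - 1)) \<omega>)"
            using False by simp
          also have "\<dots> \<le> J \<omega>"
            unfolding J_def using good_sum_pos[OF elim t(2)]
            by (intro member_le_sum[of "N t \<omega> - 1" _ "\<lambda>k. of_bool (e * a t < X (Suc k) \<omega>) :: real"]) auto
          finally have "1 \<le> J \<omega>" .
          moreover have "cmod (1 - w) \<le> 2"
            using norm_triangle_ineq4[of 1 w] nw by simp
          moreover have "0 \<le> \<bar>\<theta>\<bar> * e / mu"
            using e mu_pos by simp
          ultimately show ?thesis
            by linarith
        qed
        finally show ?case
          by simp
      qed
      have ib: "integrable M (\<lambda>\<omega>. iexp (\<theta> * Z t \<omega>))"
        by (rule integrable_const_bound[of _ 1]) auto
      define Bd where "Bd = (\<lambda>\<omega>. \<kappa> * (a t / t) * (exp (\<kappa> / mu) * \<bar>Z t \<omega>\<bar> + \<bar>Z t \<omega>\<bar> * exp (\<kappa> * (N t \<omega> / t)))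
          + exp (\<kappa> / mu) * (\<bar>\<theta>\<bar> * e / mu + 2 * J \<omega>))"
      have iBd: "integrable M Bd"
        unfolding Bd_def using elim iJ by simp
      have "cmod (expectation (\<lambda>\<omega>. iexp (\<theta> * Z t \<omega>) * complex_of_real (exp (\<kappa> / mu)) - G \<omega>)) \<le> expectation Bd"
        using ib rp(1) iBd ae by (intro norm_integral_le_AE) (auto simp: Bd_def G_def)
      also have "expectation (\<lambda>\<omega>. iexp (\<theta> * Z t \<omega>) * complex_of_real (exp (\<kappa> / mu)) - G \<omega>)
          = expectation (\<lambda>\<omega>. iexp (\<theta> * Z t \<omega>)) * complex_of_real (exp (\<kappa> / mu)) - expectation G"
        using ib rp(1) by (simp add: G_def)
      also have "expectation Bd = \<kappa> * (a t / t) * (exp (\<kappa> / mu) * expectation (\<lambda>\<omega>. \<bar>Z t \<omega>\<bar>) + expectation (\<lambda>\<omega>. \<bar>Z t \<omega>\<bar> * exp (\<kappa> * (N t \<omega> / t))))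
          + exp (\<kappa> / mu) * (\<bar>\<theta>\<bar> * e / mu + 2 * (mean_N t * p t))"
        unfolding Bd_def using elim iJ eJ by (simp add: prob_space)
      also have "\<dots> \<le> \<kappa> * (a t / t) * (exp (\<kappa> / mu) * C3 + C2)
          + exp (\<kappa> / mu) * (\<bar>\<theta>\<bar> * e / mu + 2 * (mean_N t * p t))"
        using elim \<kappa> by (intro add_right_mono mult_left_mono add_mono) auto
      finally have b2: "cmod (expectation (\<lambda>\<omega>. iexp (\<theta> * Z t \<omega>)) * complex_of_real (exp (\<kappa> / mu)) - expectation G)
        \<le> \<kappa> * (a t / t) * (exp (\<kappa> / mu) * C3 + C2) + exp (\<kappa> / mu) * (\<bar>\<theta>\<bar> * e / mu + 2 * ((mean_N t / t) * (t * p t)))"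
        using t by simp
      have "cmod (expectation (\<lambda>\<omega>. iexp (\<theta> * Z t \<omega>)) * complex_of_real (exp (\<kappa> / mu)) - 1) \<le> B t"
        using norm_triangle_ineq[of "expectation (\<lambda>\<omega>. iexp (\<theta> * Z t \<omega>)) * complex_of_real (exp (\<kappa> / mu)) - expectation G" "expectation G - 1"] b1 b2
        unfolding B_def by simp
      then show ?case
        using elim by (simp add: dist_norm)
    qed
  qed
  from tendsto_mult[OF this tendsto_const[of "complex_of_real (exp (- (\<kappa> / mu)))"]]
  have "((\<lambda>t. expectation (\<lambda>\<omega>. iexp (\<theta> * Z t \<omega>)) * (complex_of_real (exp (\<kappa> / mu)) * complex_of_real (exp (- (\<kappa> / mu)))))
     \<longlongrightarrow> complex_of_real (exp (- (\<kappa> / mu)))) at_top"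
    by (simp only: mult.assoc mult_1)
  then show ?thesis
    unfolding of_real_mult[symmetric] exp_add[symmetric] by (simp add: \<kappa>mu)
qed

end

subsection \<open>Gaussian integrals and convergence of expectations\<close>

text \<open>Completing the square turns the integrand into a multiple of the normal density with
  mean \<open>\<theta>\<close>.\<close>

lemma has_bochner_integral_std_normal_exp:
  "has_bochner_integral std_normal_distribution (\<lambda>x. exp (\<theta> * x)) (exp (\<theta>\<^sup>2 / 2))"
proof (rule has_bochner_integral_density)
  have eq: "std_normal_density x *\<^sub>R exp (\<theta> * x) = exp (\<theta>\<^sup>2 / 2) * normal_density \<theta> 1 x" for x
    unfolding std_normal_density_def normal_density_def
    by (simp add: exp_add[symmetric] power2_eq_square field_simps)
  show "has_bochner_integral lborel (\<lambda>x. std_normal_density x *\<^sub>R exp (\<theta> * x)) (exp (\<theta>\<^sup>2 / 2))"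
    unfolding eq has_bochner_integral_iff by (simp add: integrable_normal_density)
qed auto

lemma pos_part_pow_measurable [measurable]: "pos_part_pow p \<in> borel_measurable borel"
  unfolding pos_part_pow_def[abs_def] by measurable

lemma neg_part_pow_measurable [measurable]: "neg_part_pow p \<in> borel_measurable borel"
  unfolding neg_part_pow_def[abs_def] by measurable

lemma neg_part_pow_eq: "neg_part_pow p x = pos_part_pow p (- x)"
  by (auto simp: neg_part_pow_def pos_part_pow_def max_def min_def)

lemma pos_part_pow_nonneg: "0 \<le> pos_part_pow p x"
  by (simp add: pos_part_pow_def)

lemma has_bochner_integral_gaussian_powr:
  fixes p :: real
  assumes p: "0 \<le> p"
  shows "has_bochner_integral lborel (\<lambda>x. indicator {0<..} x * (x powr p * exp (- x\<^sup>2 / 2))) (2 powr ((p - 1) / 2) * Gamma ((p + 1) / 2))"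
proof -
  define f where "f = (\<lambda>x::real. x powr p * exp (- x\<^sup>2 / 2))"
  \<comment> \<open>The substitution \<open>x = sqrt (2 * y)\<close> changes
    \<open>exp (- x^2 / 2)\<close> into \<open>exp (- y)\<close> and the integral into a Gamma
    integral. It is made on the open half line, as \<open>g\<close> is not differentiable at
    0.\<close>
  define g where "g = (\<lambda>x::real. sqrt (2 * x))"
  define g' where "g' = (\<lambda>x::real. 1 / sqrt (2 * x))"
  let ?G = "\<lambda>t::real. t powr ((p + 1) / 2 - 1) / exp t"
  have s: "0 < (p + 1) / 2"
    using p by simp
  have fg: "f (g x) * g' x = 2 powr ((p - 1) / 2) * ?G x" if "0 < x" for x
  proof -
    have "f (g x) * g' x = (2 * x) powr (p / 2) * (2 * x) powr (- (1 / 2)) * exp (- x)"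
      using that by (simp add: f_def g_def g'_def powr_half_sqrt[symmetric] powr_powr powr_minus field_simps)
        (simp add: powr_half_sqrt)
    also have "\<dots> = (2 * x) powr ((p - 1) / 2) * exp (- x)"
      unfolding powr_add[symmetric] by (simp add: diff_divide_distrib)
    also have "\<dots> = 2 powr ((p - 1) / 2) * (x powr ((p - 1) / 2) * exp (- x))"
      using that by (simp add: powr_mult)
    also have "(p - 1) / 2 = (p + 1) / 2 - 1" for p :: real
      by (simp add: field_simps)
    finally show ?thesis
      by (simp add: exp_minus field_simps)
  qed
  have nn: "(\<integral>\<^sup>+t. ennreal (indicator {0..} t * ?G t) \<partial>lborel) = ennreal (Gamma ((p + 1) / 2))"
    using Gamma_conv_nn_integral_real[OF s] by simp
  have G: "has_bochner_integral lborel (\<lambda>t. indicator {0..} t * ?G t) (Gamma ((p + 1) / 2))"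
    by (rule has_bochner_integral_nn_integral[OF _ _ _ nn]) (use s in auto)
  have G': "has_bochner_integral lborel (\<lambda>t. indicator {0<..} t *\<^sub>R (f (g t) * g' t)) (2 powr ((p - 1) / 2) * Gamma ((p + 1) / 2))"
  proof (rule has_bochner_integral_cong_AE[THEN iffD1])
    show "has_bochner_integral lborel (\<lambda>t. 2 powr ((p - 1) / 2) * (indicator {0..} t * ?G t)) (2 powr ((p - 1) / 2) * Gamma ((p + 1) / 2))"
      by (rule has_bochner_integral_mult_right[OF G])
    have "AE t in lborel. t \<noteq> (0::real)"
      by (rule AE_lborel_singleton)
    then show "AE t in lborel. 2 powr ((p - 1) / 2) * (indicator {0..} t * ?G t) = indicator {0<..} t *\<^sub>R (f (g t) * g' t)"
      by eventually_elim (auto simp: indicator_def fg)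
    show "(\<lambda>t. indicator {0<..} t *\<^sub>R (f (g t) * g' t)) \<in> borel_measurable lborel"
      unfolding f_def g_def g'_def by measurable
  qed measurable
  have ein: "einterval 0 \<infinity> = {0<..}"
    by (auto simp: einterval_def)
  have "set_integrable lborel (einterval 0 \<infinity>) (\<lambda>x. f (g x) * g' x)"
    using G' unfolding ein set_integrable_def by (auto simp: has_bochner_integral_iff)
  note int = this
  have D: "DERIV g x :> g' x" if "0 < x" for x
    unfolding g_def g'_def using that by (auto intro!: derivative_eq_intros simp: field_simps)
  have cf: "isCont f x" if "0 < x" for x
    unfolding f_def using that by (intro continuous_intros) auto
  have cg': "isCont g' x" if "0 < x" for x
    unfolding g'_def using that by (intro continuous_intros) auto
  have A: "((ereal \<circ> g \<circ> real_of_ereal) \<longlongrightarrow> 0) (at_right 0)"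
  proof -
    have "(g \<longlongrightarrow> g 0) (at_right 0)"
      unfolding g_def by (intro tendsto_intros)
    then show ?thesis
      by (simp add: zero_ereal_def ereal_tendsto_simps g_def)
  qed
  have B: "((ereal \<circ> g \<circ> real_of_ereal) \<longlongrightarrow> \<infinity>) (at_left \<infinity>)"
  proof -
    have "filterlim g at_top at_top"
      unfolding g_def by (intro filterlim_compose[OF sqrt_at_top] filterlim_tendsto_pos_mult_at_top[OF tendsto_const] filterlim_ident) simp
    then show ?thesis
      by (simp add: ereal_tendsto_simps)
  qed
  have D': "DERIV g x :> g' x" and cf': "isCont f (g x)" and cg'': "isCont g' x" and f0: "0 \<le> f (g x)"
    if "0 < ereal x" "ereal x < \<infinity>" for x
  proof -
    have x: "0 < x" using that by simp
    then have "0 < g x" by (simp add: g_def)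
    then show "DERIV g x :> g' x" "isCont f (g x)" "isCont g' x" "0 \<le> f (g x)"
      using D[OF x] cf cg'[OF x] by (auto simp: f_def)
  qed
  have g0: "0 \<le> g' x" if "0 \<le> ereal x" "ereal x \<le> \<infinity>" for x
    using that by (simp add: g'_def)
  have "(0::ereal) < \<infinity>"
    by simp
  note sub' = interval_integral_substitution_nonneg[OF this D' cf' cg'' f0 g0 A B int]
  have "(LBINT x=0..\<infinity>. (f (g x) * g' x)) = 2 powr ((p - 1) / 2) * Gamma ((p + 1) / 2)"
    using G' by (simp add: interval_lebesgue_integral_def ein set_lebesgue_integral_def has_bochner_integral_iff)
  with sub' show ?thesis
    by (simp add: interval_lebesgue_integral_def ein set_lebesgue_integral_def set_integrable_def has_bochner_integral_iff f_def)
qed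

lemma has_bochner_integral_std_normal_pos_part:
  assumes p: "0 \<le> p"
  shows "has_bochner_integral std_normal_distribution (pos_part_pow p) (2 powr (p / 2 - 1) * Gamma ((p + 1) / 2) / sqrt pi)"
proof (rule has_bochner_integral_density)
  have eq: "std_normal_density x *\<^sub>R pos_part_pow p x = 1 / sqrt (2 * pi) * (indicator {0<..} x * (x powr p * exp (- x\<^sup>2 / 2)))" for x
    by (auto simp: std_normal_density_def pos_part_pow_def indicator_def)
  have "2 powr (p / 2 - 1) * Gamma ((p + 1) / 2) / sqrt pi = 1 / sqrt (2 * pi) * (2 powr ((p - 1) / 2) * Gamma ((p + 1) / 2))"
  proof -
    have "2 powr ((p - 1) / 2) = 2 powr (p / 2 - 1 + 1 / 2)"
      by (simp add: field_simps)
    also have "\<dots> = 2 powr (p / 2 - 1) * sqrt 2"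
      unfolding powr_add by (simp add: powr_half_sqrt)
    finally show ?thesis
      by (simp add: real_sqrt_mult field_simps)
  qed
  then show "has_bochner_integral lborel (\<lambda>x. std_normal_density x *\<^sub>R pos_part_pow p x) (2 powr (p / 2 - 1) * Gamma ((p + 1) / 2) / sqrt pi)"
    unfolding eq using has_bochner_integral_mult_right[OF has_bochner_integral_gaussian_powr[OF p], of "1 / sqrt (2 * pi)"] by simp
qed auto

lemma has_bochner_integral_std_normal_neg_part:
  assumes p: "0 \<le> p"
  shows "has_bochner_integral std_normal_distribution (neg_part_pow p) (2 powr (p / 2 - 1) * Gamma ((p + 1) / 2) / sqrt pi)"
proof (rule has_bochner_integral_density)
  have "has_bochner_integral lborel (\<lambda>x. std_normal_density x *\<^sub>R pos_part_pow p x) (2 powr (p / 2 - 1) * Gamma ((p + 1) / 2) / sqrt pi)"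
    using has_bochner_integral_std_normal_pos_part[OF p]
    by (auto simp: has_bochner_integral_iff integrable_density integral_density)
  then show "has_bochner_integral lborel (\<lambda>x. std_normal_density x *\<^sub>R neg_part_pow p x) (2 powr (p / 2 - 1) * Gamma ((p + 1) / 2) / sqrt pi)"
    by (subst (asm) lborel_has_bochner_integral_real_affine_iff[where c = "-1" and t = 0])
      (simp_all add: neg_part_pow_eq std_normal_density_def)
qed auto

lemma neg_part_pow_nonneg: "0 \<le> neg_part_pow p x"
  by (simp add: neg_part_pow_def)

lemma isCont_pos_part_pow: "0 < p \<Longrightarrow> isCont (pos_part_pow p) x"
  unfolding isCont_def pos_part_pow_def[abs_def]
  by (intro tendsto_powr' tendsto_max tendsto_const tendsto_ident_at) auto

lemma isCont_neg_part_pow: "0 < p \<Longrightarrow> isCont (neg_part_pow p) x"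
  unfolding neg_part_pow_eq[abs_def] by (rule isCont_o2[OF _ isCont_pos_part_pow]) auto

interpretation std_normal: real_distribution std_normal_distribution
  by (rule real_dist_normal_dist)

lemma std_normal_singleton: "emeasure std_normal_distribution {x} = 0"
  by (subst emeasure_density) (auto simp: nn_integral_0_iff_AE intro: eventually_mono[OF AE_lborel_singleton[of x]])

section \<open>Weak convergence and uniform integrability\<close>

context scaled_renewal
begin

text \<open>Levy's continuity theorem concerns sequences, so the continuous parameter is sampled
  along an arbitrary sequence tending to infinity.\<close>

lemma weak_conv_Z:
  assumes "filterlim s at_top sequentially"
  shows "weak_conv_m (\<lambda>n. distr M borel (Z (s n))) std_normal_distribution"
proof (rule levy_continuity)
  show "real_distribution (distr M borel (Z (s n)))" for n
    by (rule real_distribution_distr) measurable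
  show "real_distribution std_normal_distribution"
    by (rule real_dist_normal_dist)
  fix \<theta> :: real
  have "char (distr M borel (Z (s n))) \<theta> = expectation (\<lambda>\<omega>. iexp (\<theta> * Z (s n) \<omega>))" for n
    unfolding char_def by (subst integral_distr) auto
  then show "(\<lambda>n. char (distr M borel (Z (s n))) \<theta>) \<longlonglongrightarrow> char std_normal_distribution \<theta>"
    unfolding char_std_normal_distribution
    using filterlim_compose[OF char_Z_tendsto assms] by simp
qed

lemma expectation_Z_tendsto:
  fixes f :: "real \<Rightarrow> real"
  assumes [measurable]: "f \<in> borel_measurable borel" and cont: "emeasure std_normal_distribution {x. \<not> isCont f x} = 0"
    and bnd: "\<And>x. \<bar>f x\<bar> \<le> B"
  shows "((\<lambda>t. expectation (\<lambda>\<omega>. f (Z t \<omega>))) \<longlongrightarrow> (\<integral>x. f x \<partial>std_normal_distribution)) at_top"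
proof (rule tendsto_at_topI_sequentially)
  fix s :: "nat \<Rightarrow> real" assume s: "filterlim s at_top sequentially"
  have "(\<lambda>n. \<integral>x. f x \<partial>distr M borel (Z (s n))) \<longlonglongrightarrow> (\<integral>x. f x \<partial>std_normal_distribution)"
    using bnd by (intro weak_conv_imp_bdd_ae_continuous_conv[OF _ _ weak_conv_Z[OF s]] cont
      real_distribution_distr real_dist_normal_dist) auto
  then show "(\<lambda>n. expectation (\<lambda>\<omega>. f (Z (s n) \<omega>))) \<longlonglongrightarrow> (\<integral>x. f x \<partial>std_normal_distribution)"
    by (simp add: integral_distr)
qed

text \<open>Uniform integrability in the form \<open>f \<le> K + e * g\<close> with \<open>g\<close>
  bounded in mean: the bounded continuous function \<open>min f K\<close> converges by weak
  convergence, and it differs from \<open>f\<close> by at most \<open>e * g\<close>, both under the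
  law of \<open>Z\<close> and under the normal law.\<close>

lemma uniform_integrability_limit:
  fixes f g :: "real \<Rightarrow> real"
  assumes cont: "\<And>x. isCont f x" and f0: "\<And>x. 0 \<le> f x" and g [measurable]: "g \<in> borel_measurable borel" and g0: "\<And>x. 0 \<le> g x"
    and dom: "\<And>e. 0 < e \<Longrightarrow> \<exists>K. 0 \<le> K \<and> (\<forall>x. f x - K \<le> e * g x)"
    and bound: "\<forall>\<^sub>F t in at_top. integrable M (\<lambda>\<omega>. g (Z t \<omega>)) \<and> expectation (\<lambda>\<omega>. g (Z t \<omega>)) \<le> C"
    and sf: "integrable std_normal_distribution f" and sg: "integrable std_normal_distribution g"
  shows "((\<lambda>t. expectation (\<lambda>\<omega>. f (Z t \<omega>))) \<longlongrightarrow> (\<integral>x. f x \<partial>std_normal_distribution)) at_top"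
proof (rule tendstoI)
  fix r :: real assume r: "0 < r"
  have fm [measurable]: "f \<in> borel_measurable borel"
    using cont by (intro borel_measurable_continuous_onI) (auto intro: continuous_at_imp_continuous_on)
  define C' where "C' = max C (\<integral>x. g x \<partial>std_normal_distribution) + 1"
  have C': "0 < C'" "C \<le> C'" "(\<integral>x. g x \<partial>std_normal_distribution) \<le> C'"
    using Bochner_Integration.integral_nonneg[of std_normal_distribution g, OF g0] by (auto simp: C'_def max_def)
  \<comment> \<open>\<open>C'\<close> dominates the mean of \<open>g (Z t)\<close> as well as the
    Gaussian integral of \<open>g\<close>. Each of the two truncation errors then takes a third of
    \<open>r\<close>, and the weak convergence of \<open>h\<close> takes the last third.\<close>
  define e where "e = r / (3 * C')"
  have e: "0 < e" "e * C' = r / 3"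
    using r C' by (auto simp: e_def)
  obtain K where K: "0 \<le> K" "\<And>x. f x - K \<le> e * g x"
    using dom[OF e(1)] by auto
  define h where "h = (\<lambda>x. min (f x) K)"
  have hb: "0 \<le> h x" "h x \<le> K" "h x \<le> f x" "f x \<le> h x + e * g x" for x
    using f0[of x] K(1) K(2)[of x] mult_nonneg_nonneg[OF less_imp_le[OF e(1)] g0[of x]] by (auto simp: h_def min_def)
  have ch: "isCont h x" for x
    unfolding h_def using cont by (intro continuous_intros) auto
  have hm [measurable]: "h \<in> borel_measurable borel"
    unfolding h_def by measurable
  have "((\<lambda>t. expectation (\<lambda>\<omega>. h (Z t \<omega>))) \<longlongrightarrow> (\<integral>x. h x \<partial>std_normal_distribution)) at_top"
    using hb ch by (intro expectation_Z_tendsto[where B = K]) auto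
  from tendstoD[OF this, of "r / 3"] have ev: "\<forall>\<^sub>F t in at_top. \<bar>expectation (\<lambda>\<omega>. h (Z t \<omega>)) - (\<integral>x. h x \<partial>std_normal_distribution)\<bar> < r / 3"
    using r unfolding dist_real_def by simp
  have ihs: "integrable std_normal_distribution h"
    using hb by (intro std_normal.integrable_const_bound[of _ K]) auto
  have s1: "(\<integral>x. h x \<partial>std_normal_distribution) \<le> (\<integral>x. f x \<partial>std_normal_distribution)"
    using hb by (intro integral_mono ihs sf) auto
  have "(\<integral>x. f x \<partial>std_normal_distribution) \<le> (\<integral>x. h x + e * g x \<partial>std_normal_distribution)"
    using hb by (intro integral_mono sf Bochner_Integration.integrable_add ihs integrable_mult_right sg) auto
  also have "\<dots> = (\<integral>x. h x \<partial>std_normal_distribution) + e * (\<integral>x. g x \<partial>std_normal_distribution)"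
    using ihs sg by simp
  also have "\<dots> \<le> (\<integral>x. h x \<partial>std_normal_distribution) + r / 3"
    using C' e by (simp flip: e(2))
  finally have s2: "(\<integral>x. f x \<partial>std_normal_distribution) \<le> (\<integral>x. h x \<partial>std_normal_distribution) + r / 3" .
  show "\<forall>\<^sub>F t in at_top. dist (expectation (\<lambda>\<omega>. f (Z t \<omega>))) (\<integral>x. f x \<partial>std_normal_distribution) < r"
    using ev bound
  proof eventually_elim
    case (elim t)
    have ih: "integrable M (\<lambda>\<omega>. h (Z t \<omega>))"
      using hb by (intro integrable_const_bound[of _ K]) auto
    have ihg: "integrable M (\<lambda>\<omega>. h (Z t \<omega>) + e * g (Z t \<omega>))"
      using ih elim by simp
    have if': "integrable M (\<lambda>\<omega>. f (Z t \<omega>))"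
      by (rule Bochner_Integration.integrable_bound[OF ihg])
        (use hb f0 in \<open>auto intro!: AE_I2 intro: order_trans[OF _ abs_ge_self]\<close>)
    have m1: "expectation (\<lambda>\<omega>. h (Z t \<omega>)) \<le> expectation (\<lambda>\<omega>. f (Z t \<omega>))"
      using hb by (intro integral_mono ih if') auto
    have "expectation (\<lambda>\<omega>. f (Z t \<omega>)) \<le> expectation (\<lambda>\<omega>. h (Z t \<omega>) + e * g (Z t \<omega>))"
      using hb by (intro integral_mono if' ihg) auto
    also have "\<dots> = expectation (\<lambda>\<omega>. h (Z t \<omega>)) + e * expectation (\<lambda>\<omega>. g (Z t \<omega>))"
      using ih elim by simp
    also have "\<dots> \<le> expectation (\<lambda>\<omega>. h (Z t \<omega>)) + e * C'"
      using elim C' e by (intro add_left_mono mult_left_mono) auto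
    finally have m2: "expectation (\<lambda>\<omega>. f (Z t \<omega>)) \<le> expectation (\<lambda>\<omega>. h (Z t \<omega>)) + r / 3"
      by (simp only: e)
    show ?case
      using elim m1 m2 s1 s2 unfolding dist_real_def by linarith
  qed
qed

text \<open>Completing the square gives \<open>f \<le> e * f^2 + 1 / (4 * e)\<close>; hence a bound
  on the mean of the square is all that uniform integrability requires.\<close>

lemma square_dominates: "0 < e \<Longrightarrow> \<exists>K. 0 \<le> K \<and> (\<forall>x. f x - K \<le> e * (f x)\<^sup>2)" for f :: "real \<Rightarrow> real"
proof (intro exI[of _ "1 / (4 * e)"] conjI allI)
  fix x assume e: "0 < e"
  have "0 \<le> (2 * e * f x - 1)\<^sup>2 / (4 * e)"
    using e by simp
  also have "\<dots> = e * (f x)\<^sup>2 - f x + 1 / (4 * e)"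
    using e by (simp add: field_simps power2_eq_square)
  finally show "f x - 1 / (4 * e) \<le> e * (f x)\<^sup>2"
    by simp
qed simp

lemma exp_Z_tendsto:
  assumes "0 \<le> \<theta>"
  shows "((\<lambda>t. expectation (\<lambda>\<omega>. exp (\<theta> * Z t \<omega>))) \<longlongrightarrow> (\<integral>x. exp (\<theta> * x) \<partial>std_normal_distribution)) at_top"
proof -
  have sq: "exp (2 * \<theta> * x) = (exp (\<theta> * x))\<^sup>2" for x :: real
    by (simp add: exp_double[symmetric] mult.assoc)
  obtain C where C: "0 < C" "\<forall>\<^sub>F t in at_top. integrable M (\<lambda>\<omega>. exp (2 * \<theta> * Z t \<omega>)) \<and> expectation (\<lambda>\<omega>. exp (2 * \<theta> * Z t \<omega>)) \<le> C"
    by (rule exp_Z_bound[of "2 * \<theta>"]) (use assms in simp)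
  show ?thesis
  proof (rule uniform_integrability_limit[where g = "\<lambda>x. exp (2 * \<theta> * x)" and C = C])
    show "\<exists>K. 0 \<le> K \<and> (\<forall>x. exp (\<theta> * x) - K \<le> e * exp (2 * \<theta> * x))" if "0 < e" for e
      unfolding sq by (rule square_dominates[OF that])
    show "integrable std_normal_distribution (\<lambda>x. exp (\<theta> * x))" "integrable std_normal_distribution (\<lambda>x. exp (2 * \<theta> * x))"
      using has_bochner_integral_std_normal_exp by (auto simp: has_bochner_integral_iff)
  qed (use C in auto)
qed

text \<open>The constant is \<open>q powr q\<close>: raise \<open>x / q \<le> exp (x / q)\<close> to
  the power \<open>q\<close>.\<close>

lemma powr_le_exp:
  assumes "0 < q"
  obtains c where "0 < c" "\<And>x. pos_part_pow q x \<le> c * exp x"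
proof
  show "0 < q powr q"
    using assms by simp
  show "pos_part_pow q x \<le> q powr q * exp x" for x
  proof (cases "0 < x")
    case True
    have "x / q \<le> exp (x / q)"
      using exp_ge_add_one_self[of "x / q"] by linarith
    then have "(x / q) powr q \<le> exp (x / q) powr q"
      using True assms by (intro powr_mono2) auto
    then show ?thesis
      using True assms by (simp add: pos_part_pow_def powr_divide exp_powr_real field_simps)
  next
    case False
    then show ?thesis by (simp add: pos_part_pow_def)
  qed
qed

lemma pos_part_bound:
  assumes "0 < q"
  obtains C where "\<forall>\<^sub>F t in at_top. integrable M (\<lambda>\<omega>. pos_part_pow q (Z t \<omega>)) \<and> expectation (\<lambda>\<omega>. pos_part_pow q (Z t \<omega>)) \<le> C"
proof -
  obtain C where C: "0 < C" "\<forall>\<^sub>F t in at_top. integrable M (\<lambda>\<omega>. exp (1 * Z t \<omega>)) \<and> expectation (\<lambda>\<omega>. exp (1 * Z t \<omega>)) \<le> C"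
    using exp_Z_bound[of 1] by auto
  obtain c where c: "0 < c" "\<And>x. pos_part_pow q x \<le> c * exp x"
    using powr_le_exp[OF assms] by blast
  show thesis
  proof (rule that[of "c * C"])
    show "\<forall>\<^sub>F t in at_top. integrable M (\<lambda>\<omega>. pos_part_pow q (Z t \<omega>)) \<and> expectation (\<lambda>\<omega>. pos_part_pow q (Z t \<omega>)) \<le> c * C"
      using C(2)
    proof eventually_elim
      case (elim t)
      have ic: "integrable M (\<lambda>\<omega>. c * exp (Z t \<omega>))"
        using elim by simp
      have i: "integrable M (\<lambda>\<omega>. pos_part_pow q (Z t \<omega>))"
        by (rule Bochner_Integration.integrable_bound[OF ic])
          (use c pos_part_pow_nonneg in \<open>auto intro!: AE_I2 simp: abs_mult\<close>)
      have "expectation (\<lambda>\<omega>. pos_part_pow q (Z t \<omega>)) \<le> expectation (\<lambda>\<omega>. c * exp (Z t \<omega>))"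
        using c by (intro integral_mono i ic) auto
      also have "\<dots> \<le> c * C"
        using elim c by simp
      finally show ?case
        using i by simp
    qed
  qed
qed

lemma pos_part_Z_tendsto:
  assumes p: "0 < p"
  shows "((\<lambda>t. expectation (\<lambda>\<omega>. pos_part_pow p (Z t \<omega>))) \<longlongrightarrow> (\<integral>x. pos_part_pow p x \<partial>std_normal_distribution)) at_top"
proof -
  have sq: "pos_part_pow (2 * p) x = (pos_part_pow p x)\<^sup>2" for x :: real
    by (simp add: pos_part_pow_def powr_power mult.commute powr_numeral[symmetric] powr_powr del: powr_numeral)
  obtain C where C: "\<forall>\<^sub>F t in at_top. integrable M (\<lambda>\<omega>. pos_part_pow (2 * p) (Z t \<omega>)) \<and> expectation (\<lambda>\<omega>. pos_part_pow (2 * p) (Z t \<omega>)) \<le> C"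
    by (rule pos_part_bound[of "2 * p"]) (use p in simp)
  show ?thesis
  proof (rule uniform_integrability_limit[where g = "pos_part_pow (2 * p)" and C = C])
    show "\<exists>K. 0 \<le> K \<and> (\<forall>x. pos_part_pow p x - K \<le> e * pos_part_pow (2 * p) x)" if "0 < e" for e
      unfolding sq by (rule square_dominates[OF that])
    show "integrable std_normal_distribution (pos_part_pow p)" "integrable std_normal_distribution (pos_part_pow (2 * p))"
      using has_bochner_integral_std_normal_pos_part[of p] has_bochner_integral_std_normal_pos_part[of "2 * p"] p
      by (auto simp: has_bochner_integral_iff)
  qed (use C p in \<open>auto intro: isCont_pos_part_pow pos_part_pow_nonneg\<close>)
qed

lemma neg_part_0_Z_tendsto:
  "((\<lambda>t. expectation (\<lambda>\<omega>. neg_part_pow 0 (Z t \<omega>))) \<longlongrightarrow> (\<integral>x. neg_part_pow 0 x \<partial>std_normal_distribution)) at_top"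
proof (rule expectation_Z_tendsto[where B = 1])
  have eq: "neg_part_pow 0 = indicator {..<0}"
    by (auto simp: fun_eq_iff neg_part_pow_def indicator_def min_def)
  have "{x::real. \<not> isCont (neg_part_pow 0) x} = {0}"
    unfolding eq isCont_indicator by (auto simp: frontier_def interior_open)
  then show "emeasure std_normal_distribution {x. \<not> isCont (neg_part_pow 0) x} = 0"
    by (simp only: std_normal_singleton)
qed (auto simp: neg_part_pow_def)

lemma neg_part_Z_tendsto:
  fixes p q :: real
  assumes p: "0 < p" "p < q"
    and bound: "\<forall>\<^sub>F t in at_top. integrable M (\<lambda>\<omega>. neg_part_pow q (Z t \<omega>)) \<and> expectation (\<lambda>\<omega>. neg_part_pow q (Z t \<omega>)) \<le> C"
  shows "((\<lambda>t. expectation (\<lambda>\<omega>. neg_part_pow p (Z t \<omega>))) \<longlongrightarrow> (\<integral>x. neg_part_pow p x \<partial>std_normal_distribution)) at_top"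
proof (rule uniform_integrability_limit[OF _ _ _ _ _ bound])
  show "\<exists>K. 0 \<le> K \<and> (\<forall>x. neg_part_pow p x - K \<le> e * neg_part_pow q x)" if e: "0 < e" for e
  \<comment> \<open>With \<open>T = e powr (1 / (p - q))\<close>, values up to \<open>T\<close> are
    absorbed in \<open>K = T powr p\<close>; beyond \<open>T\<close> one has
    \<open>y powr p = y powr q * y powr (p - q) \<le> e * y powr q\<close>, because
    \<open>p - q\<close> is negative.\<close>
  proof (intro exI[of _ "(e powr (1 / (p - q))) powr p"] conjI allI)
    let ?T = "e powr (1 / (p - q))"
    fix x :: real
    define y where "y = max (- x) 0"
    have n: "neg_part_pow s x = y powr s" for s
      by (simp add: y_def neg_part_pow_eq pos_part_pow_def)
    have y: "0 \<le> y"
      by (simp add: y_def)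
    show "neg_part_pow p x - ?T powr p \<le> e * neg_part_pow q x"
    proof (cases "y \<le> ?T")
      case True
      then have "y powr p \<le> ?T powr p"
        using y p by (intro powr_mono2) auto
      then show ?thesis
        unfolding n using e by (smt (verit) mult_nonneg_nonneg powr_ge_zero)
    next
      case False
      then have y: "0 < y"
        using e by (smt (verit) powr_ge_zero)
      have "y powr (p - q) \<le> ?T powr (p - q)"
        using False y p e by (intro powr_mono2') auto
      also have "\<dots> = e"
        using e p by (simp add: powr_powr)
      finally have "y powr q * y powr (p - q) \<le> y powr q * e"
        by (intro mult_left_mono) auto
      also have "y powr q * y powr (p - q) = y powr p"
        using y by (simp add: powr_add[symmetric])
      finally show ?thesis
        unfolding n by (smt (verit) mult.commute powr_ge_zero)
    qed
  qed simp
  show "integrable std_normal_distribution (neg_part_pow p)" "integrable std_normal_distribution (neg_part_pow q)"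
    using has_bochner_integral_std_normal_neg_part[of p] has_bochner_integral_std_normal_neg_part[of q] p
    by (auto simp: has_bochner_integral_iff)
qed (use p in \<open>auto intro: isCont_neg_part_pow neg_part_pow_nonneg\<close>)

end

context renewal
begin

subsection \<open>Lower deviations\<close>

text \<open>If \<open>N\<close> is too small, the sum has passed \<open>t\<close> too early. Then
  either one of the first \<open>N\<close> steps exceeds \<open>y\<close>, or the stopped centred
  truncated sum satisfies \<open>S = S_N - m * N \<ge> S_N - mu * N > mu * y\<close>, to which
  Chebyshev's inequality and Wald's second identity apply. The truncated mean \<open>m\<close> lies
  below \<open>mu\<close>, which is the favourable direction.\<close>

lemma lower_deviation_bound:
  assumes t: "0 \<le> t" and y: "0 < y"
  shows "prob {\<omega>\<in>space M. N t \<omega> - t / mu < - y}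
    \<le> mean_N t * (tail0 y + trunc2 y / (mu * y)\<^sup>2)"
proof -
  \<comment> \<open>Steps above \<open>y\<close> are replaced by 0 instead of \<open>y\<close>, so
    that the second moment of \<open>h xi\<close> is exactly \<open>trunc2 y\<close>; large steps
    are counted separately by \<open>J\<close>.\<close>
  define h where "h = (\<lambda>x::real. x * indicator {0<..y} x)"
  define m where "m = expectation (\<lambda>\<omega>. h (xi \<omega>))"
  define g where "g = (\<lambda>x. h x - m)"
  have hb: "0 \<le> h x" "h x \<le> y" for x
    using y by (auto simp: h_def indicator_def)
  have [measurable]: "h \<in> borel_measurable borel" "g \<in> borel_measurable borel"
    unfolding g_def h_def by measurable
  have ih: "integrable M (\<lambda>\<omega>. h (xi \<omega>))"
    using hb by (intro integrable_const_bound[of _ y]) auto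
  have m0: "0 \<le> m"
    unfolding m_def using hb by (intro Bochner_Integration.integral_nonneg) auto
  have m1: "m \<le> mu"
    unfolding m_def mu_def using xi_pos
    by (intro integral_mono_AE ih xi_int) (auto simp: h_def indicator_def elim!: eventually_mono)
  have gb: "\<bar>g x\<bar> \<le> y + m" for x
    using hb[of x] m0 by (auto simp: g_def)
  have g0: "expectation (\<lambda>\<omega>. g (xi \<omega>)) = 0"
    unfolding g_def using ih by (simp add: m_def prob_space)
  have ih2: "integrable M (\<lambda>\<omega>. (h (xi \<omega>))\<^sup>2)"
    using hb by (intro integrable_const_bound[of _ "y\<^sup>2"]) (auto intro!: power_mono)
  have eg2: "expectation (\<lambda>\<omega>. (g (xi \<omega>))\<^sup>2) \<le> trunc2 y"
  proof -
    have "expectation (\<lambda>\<omega>. (g (xi \<omega>))\<^sup>2) = expectation (\<lambda>\<omega>. (h (xi \<omega>))\<^sup>2 - 2 * m * h (xi \<omega>) + m\<^sup>2)"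
      by (simp add: g_def power2_diff algebra_simps)
    also have "\<dots> = expectation (\<lambda>\<omega>. (h (xi \<omega>))\<^sup>2) - m\<^sup>2"
      using ih ih2 by (simp add: m_def[symmetric] prob_space power2_eq_square)
    also have "\<dots> \<le> expectation (\<lambda>\<omega>. (h (xi \<omega>))\<^sup>2)"
      by simp
    also have "\<dots> = trunc2 y"
      unfolding trunc2_eq using xi_pos
      by (intro integral_cong_AE) (auto simp: h_def indicator_def elim!: eventually_mono)
    finally show ?thesis .
  qed
  define S where "S = (\<lambda>\<omega>. \<Sum>k<N t \<omega>. g (X (Suc k) \<omega>))"
  have S: "integrable M (\<lambda>\<omega>. (S \<omega>)\<^sup>2)" "expectation (\<lambda>\<omega>. (S \<omega>)\<^sup>2) = mean_N t * expectation (\<lambda>\<omega>. (g (xi \<omega>))\<^sup>2)"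
    unfolding S_def using wald_second[OF t _ gb g0] by auto
  define J where "J = (\<lambda>\<omega>. \<Sum>k<N t \<omega>. of_bool (y < X (Suc k) \<omega>) :: real)"
  have iJ: "integrable M J" and eJ: "expectation J = mean_N t * tail0 y"
    unfolding J_def using t by (auto intro: wald_large_steps)
  let ?A = "{\<omega>\<in>space M. N t \<omega> - t / mu < - y}"
  have my: "0 < mu * y"
    using mu_pos y by simp
  have "prob ?A = expectation (indicat_real ?A)"
    by simp
  also have "\<dots> \<le> expectation (\<lambda>\<omega>. J \<omega> + (S \<omega>)\<^sup>2 / (mu * y)\<^sup>2)"
  proof (intro integral_mono_AE)
    show "AE \<omega> in M. indicat_real ?A \<omega> \<le> J \<omega> + (S \<omega>)\<^sup>2 / (mu * y)\<^sup>2"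
      using AE_good[OF t]
    proof eventually_elim
      case (elim \<omega>)
      have J0: "0 \<le> J \<omega>"
        by (auto simp: J_def intro: sum_nonneg)
      have S0: "0 \<le> (S \<omega>)\<^sup>2 / (mu * y)\<^sup>2"
        by simp
      show ?case
      proof (cases "\<omega> \<in> ?A")
        case True
        have "1 \<le> J \<omega> + (S \<omega>)\<^sup>2 / (mu * y)\<^sup>2"
        proof (cases "\<exists>k<N t \<omega>. y < X (Suc k) \<omega>")
          case True
          then obtain k where k: "k < N t \<omega>" "y < X (Suc k) \<omega>" by auto
          have "(1::real) = of_bool (y < X (Suc k) \<omega>)"
            using k by simp
          also have "\<dots> \<le> J \<omega>"
            unfolding J_def using k by (intro member_le_sum[where f = "\<lambda>k. of_bool (y < X (Suc k) \<omega>) :: real"]) auto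
          finally show ?thesis
            using S0 by linarith
        next
          case False
          have "S \<omega> = (\<Sum>k<N t \<omega>. X (Suc k) \<omega> - m)"
            unfolding S_def
          proof (intro sum.cong refl)
            fix k assume "k \<in> {..<N t \<omega>}"
            then have "X (Suc k) \<omega> \<in> {0<..y}"
              using False elim by (auto simp: good_def not_less not_le[symmetric] dest: spec[of _ k])
            then show "g (X (Suc k) \<omega>) = X (Suc k) \<omega> - m"
              by (simp add: g_def h_def)
          qed
          also have "\<dots> = partial_sum X (N t \<omega>) \<omega> - m * N t \<omega>"
            by (simp add: partial_sum_eq sum_subtractf)
          finally have "t - mu * N t \<omega> \<le> S \<omega>"
            using good_sum_pos[OF elim t] mult_right_mono[OF m1, of "real (N t \<omega>)"] of_nat_0_le_iff by linarith
          moreover have "mu * y < t - mu * N t \<omega>"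
            using \<open>\<omega> \<in> ?A\<close> mu_pos by (simp add: field_simps)
          ultimately have "mu * y \<le> S \<omega>"
            by simp
          then have "(mu * y)\<^sup>2 \<le> (S \<omega>)\<^sup>2"
            using my by (intro power_mono) auto
          then have "1 \<le> (S \<omega>)\<^sup>2 / (mu * y)\<^sup>2"
            using my by (subst le_divide_eq_1_pos) auto
          then show ?thesis
            using J0 by linarith
        qed
        then show ?thesis
          using True by simp
      next
        case False
        then show ?thesis
          using J0 S0 by simp
      qed
    qed
  qed (use iJ S in \<open>auto simp: emeasure_eq_measure\<close>)
  also have "\<dots> = expectation J + expectation (\<lambda>\<omega>. (S \<omega>)\<^sup>2) / (mu * y)\<^sup>2"
    using iJ S by simp
  also have "\<dots> \<le> mean_N t * tail0 y + mean_N t * trunc2 y / (mu * y)\<^sup>2"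
    unfolding eJ S(2) using eg2 by (intro add_left_mono divide_right_mono mult_left_mono) auto
  finally show ?thesis
    by (simp add: distrib_left)
qed

end

text \<open>A layer-cake bound over powers of two: for \<open>- z > 1\<close> the least
  \<open>n\<close> with \<open>- z \<le> 2 ^ n\<close> is some \<open>Suc j\<close>, whence
  \<open>2 ^ j < - z \<le> 2 ^ (j + 1)\<close>, and the single summand \<open>j\<close> already
  suffices.\<close>

lemma neg_part_pow_le_dyadic:
  assumes q: "0 < q"
  shows "ennreal (neg_part_pow q z) \<le> 1 + (\<Sum>j. ennreal ((2 powr q) ^ (j + 1)) * indicator {..< - (2 ^ j)} z)"
proof (cases "- z \<le> 1")
  case True
  have "max (- z) 0 powr q \<le> 1 powr q"
    using True q by (intro powr_mono2) auto
  then have "ennreal (neg_part_pow q z) \<le> 1"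
    by (simp add: neg_part_pow_eq pos_part_pow_def)
  then show ?thesis
    by (rule order_trans) simp
next
  case False
  define n where "n = (LEAST n. - z \<le> 2 ^ n)"
  have "\<exists>n. - z < 2 ^ n"
    by (rule real_arch_pow) simp
  then have n: "- z \<le> 2 ^ n"
    unfolding n_def by (metis (mono_tags, lifting) LeastI less_imp_le)
  have "n \<noteq> 0"
    using n False by (cases n) auto
  then obtain j where j: "n = Suc j"
    by (cases n) auto
  have "\<not> - z \<le> 2 ^ j"
    unfolding n_def using j by (intro not_less_Least) (simp add: n_def[symmetric])
  then have zj: "z < - (2 ^ j)"
    by simp
  have "neg_part_pow q z = (- z) powr q"
    using False by (simp add: neg_part_pow_eq pos_part_pow_def max_def)
  also have "\<dots> \<le> (2 ^ (j + 1)) powr q"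
    using n j q False by (intro powr_mono2) auto
  also have "\<dots> = (2 powr q) ^ (j + 1)"
    by (simp add: powr_realpow[symmetric] powr_powr powr_mult mult.commute del: powr_realpow)
  finally have "ennreal (neg_part_pow q z) \<le> ennreal ((2 powr q) ^ (j + 1)) * indicator {..< - (2 ^ j)} z"
    using zj by (simp add: ennreal_leI)
  also have "\<dots> \<le> (\<Sum>j. ennreal ((2 powr q) ^ (j + 1)) * indicator {..< - (2 ^ j)} z)"
    using sum_le_suminf[OF summableI, of "{j}" "\<lambda>j. ennreal ((2 powr q) ^ (j + 1)) * indicator {..< - (2 ^ j)} z"]
    by (simp only: finite.intros sum.insert sum.empty empty_iff add_0_right not_False_eq_True simp_thms zero_le)
  finally show ?thesis
    by (rule order_trans) simp
qed

context scaled_renewal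
begin

text \<open>By \<open>lower_deviation_bound\<close> at \<open>y = 2 ^ j * a t\<close>, the
  probability of \<open>Z < - (2 ^ j)\<close> is of order \<open>t * trunc2 y / y^2\<close>.
  Doubling the scale multiplies this by at most \<open>(1 + e) / 4\<close>, so the dyadic series for
  the power \<open>q\<close> is geometric.\<close>

lemma neg_part_bound:
  assumes q: "0 < q" "q < 2"
  obtains C where "\<forall>\<^sub>F t in at_top. integrable M (\<lambda>\<omega>. neg_part_pow q (Z t \<omega>)) \<and> expectation (\<lambda>\<omega>. neg_part_pow q (Z t \<omega>)) \<le> C"
proof -
  \<comment> \<open>The ratio \<open>\<rho> = 2 powr q * (1 + e) / 4\<close> is below 1 exactly when
    \<open>1 + e < 2 powr (2 - q)\<close>; \<open>e\<close> is half of the available gap, which is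
    positive since \<open>q < 2\<close>.\<close>
  define e where "e = (2 powr (2 - q) - 1) / 2"
  have "1 < 2 powr (2 - q)"
    using q by simp
  then have e: "0 < e" "1 + e < 2 powr (2 - q)"
    by (auto simp: e_def field_simps)
  define \<rho> where "\<rho> = 2 powr q * ((1 + e) / 4)"
  have "2 powr q * (1 + e) < 2 powr q * 2 powr (2 - q)"
    using e by (intro mult_strict_left_mono) auto
  also have "\<dots> = 4"
    by (simp add: powr_add[symmetric])
  finally have \<rho>: "0 < \<rho>" "\<rho> < 1"
    using e by (auto simp: \<rho>_def)
  obtain y0 where y0: "0 < y0" "\<And>y. y0 \<le> y \<Longrightarrow> 0 < trunc2 y"
      "\<And>y. y0 \<le> y \<Longrightarrow> trunc2 (2 * y) \<le> (1 + e) * trunc2 y"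
    using doubling[OF e(1)] by metis
  have "\<forall>\<^sub>F y in at_top. y * tail1 y / trunc2 y < 1"
    by (rule order_tendstoD(2)[OF tail1_small]) simp
  then obtain y1 where y1: "\<And>y. y1 \<le> y \<Longrightarrow> y * tail1 y / trunc2 y < 1"
    by (auto simp: eventually_at_top_linorder)
  have ptail: "tail0 y \<le> trunc2 y / y\<^sup>2" if "y0 \<le> y" "y1 \<le> y" for y
  proof -
    have y: "0 < y" "0 < trunc2 y"
      using y0 that by auto
    have "tail1 y / y \<le> trunc2 y / y\<^sup>2"
      using y1[OF that(2)] y by (simp add: field_simps power2_eq_square)
    then show ?thesis
      using prob_tail_le[OF y(1)] by simp
  qed
  \<comment> \<open>The factors come from \<open>E N \<le> 2 * t / mu\<close>, from the large step
    and Chebyshev contributions \<open>1\<close> and \<open>1 / mu^2\<close>, and from the eventual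
    bound \<open>L + 1\<close> for \<open>t * trunc2 (a t) / (a t)^2\<close>.\<close>
  define c where "c = 2 / mu * (1 + 1 / mu\<^sup>2) * (L + 1)"
  have c: "0 < c"
    using mu_pos L_pos by (simp add: c_def add_pos_pos)
  have evN: "\<forall>\<^sub>F t in at_top. mean_N t / t < 2 / mu"
    using mu_pos by (intro order_tendstoD(2)[OF mean_ratio]) (simp add: divide_strict_right_mono)
  have evL: "\<forall>\<^sub>F t in at_top. t * trunc2 (a t) / (a t)\<^sup>2 < L + 1"
    by (intro order_tendstoD(2)[OF L]) simp
  have eva: "\<forall>\<^sub>F t in at_top. max y0 y1 \<le> a t"
    using a_top unfolding filterlim_at_top by blast
  let ?C = "1 + 2 powr q * c / (1 - \<rho>)"
  show thesis
  proof (rule that[of ?C])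
    show "\<forall>\<^sub>F t in at_top. integrable M (\<lambda>\<omega>. neg_part_pow q (Z t \<omega>)) \<and> expectation (\<lambda>\<omega>. neg_part_pow q (Z t \<omega>)) \<le> ?C"
      using evN evL eva eventually_gt_at_top[of 0]
    proof eventually_elim
      case (elim t)
      have t: "0 < t" "0 \<le> t" and at: "y0 \<le> a t" "y1 \<le> a t" "0 < a t"
        using elim y0(1) by auto
      have pj: "prob {\<omega>\<in>space M. Z t \<omega> < - (2 ^ j)} \<le> c * ((1 + e) / 4) ^ j" for j
      proof -
        let ?y = "2 ^ j * a t"
        have "1 * a t \<le> ?y"
          using at by (intro mult_right_mono) auto
        then have y: "0 < ?y" "y0 \<le> ?y" "y1 \<le> ?y"
          using at by linarith+
        have "{\<omega>\<in>space M. Z t \<omega> < - (2 ^ j)} = {\<omega>\<in>space M. N t \<omega> - t / mu < - ?y}"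
          using at by (simp add: Z_def divide_less_eq)
        then have "prob {\<omega>\<in>space M. Z t \<omega> < - (2 ^ j)}
          \<le> mean_N t * (tail0 ?y + trunc2 ?y / (mu * ?y)\<^sup>2)"
          using lower_deviation_bound[OF t(2) y(1)] by simp
        also have "\<dots> \<le> (2 / mu * t) * (trunc2 ?y / ?y\<^sup>2 + trunc2 ?y / (mu * ?y)\<^sup>2)"
          using elim t ptail[OF y(2,3)] trunc2_nonneg[of ?y] mu_pos
          by (intro mult_mono add_mono order_refl) (auto simp: field_simps)
        also have "\<dots> = (2 / mu * (1 + 1 / mu\<^sup>2)) * (t * trunc2 ?y / ?y\<^sup>2)"
          using at mu_pos by (simp add: field_simps power_mult_distrib)
        also have "\<dots> \<le> (2 / mu * (1 + 1 / mu\<^sup>2)) * (((1 + e) / 4) ^ j * (L + 1))"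
        proof (intro mult_left_mono)
          have "t * trunc2 ?y / ?y\<^sup>2 \<le> t * ((1 + e) ^ j * trunc2 (a t)) / ?y\<^sup>2"
            using doubling_power[OF y0(1,3) e(1) at(1), of j] t
            by (intro divide_right_mono mult_left_mono) auto
          also have "\<dots> = ((1 + e) / 4) ^ j * (t * trunc2 (a t) / (a t)\<^sup>2)"
          proof -
            have "(2 ^ j * a t)\<^sup>2 = 4 ^ j * (a t)\<^sup>2"
              by (simp add: power_mult_distrib power2_eq_square flip: power_mult_distrib)
            then show ?thesis
              by (simp add: power_divide)
          qed
          also have "\<dots> \<le> ((1 + e) / 4) ^ j * (L + 1)"
            using elim e by (intro mult_left_mono) auto
          finally show "t * trunc2 ?y / ?y\<^sup>2 \<le> ((1 + e) / 4) ^ j * (L + 1)" .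
        qed (use mu_pos in auto)
        finally show ?thesis
          by (simp add: c_def mult_ac)
      qed
      have "(\<integral>\<^sup>+\<omega>. ennreal (neg_part_pow q (Z t \<omega>)) \<partial>M)
        \<le> (\<integral>\<^sup>+\<omega>. 1 + (\<Sum>j. ennreal ((2 powr q) ^ (j + 1)) * indicator {..< - (2 ^ j)} (Z t \<omega>)) \<partial>M)"
        by (intro nn_integral_mono neg_part_pow_le_dyadic q)
      also have "\<dots> = 1 + (\<Sum>j. ennreal ((2 powr q) ^ (j + 1)) * emeasure M {\<omega>\<in>space M. Z t \<omega> < - (2 ^ j)})"
      proof -
        have "(\<integral>\<^sup>+\<omega>. indicator {..< - (2 ^ j)} (Z t \<omega>) \<partial>M) = emeasure M {\<omega>\<in>space M. Z t \<omega> < - (2 ^ j)}" for j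
        proof -
          have "(\<integral>\<^sup>+\<omega>. indicator {..< - (2 ^ j)} (Z t \<omega>) \<partial>M) = (\<integral>\<^sup>+\<omega>. indicator {\<omega>\<in>space M. Z t \<omega> < - (2 ^ j)} \<omega> \<partial>M)"
            by (intro nn_integral_cong) (auto simp: indicator_def)
          then show ?thesis by simp
        qed
        then show ?thesis
          by (simp add: nn_integral_add nn_integral_suminf nn_integral_cmult emeasure_space_1)
      qed
      also have "\<dots> \<le> 1 + (\<Sum>j. ennreal (2 powr q * c * \<rho> ^ j))"
      proof (intro add_left_mono suminf_le)
        fix j
        have "ennreal ((2 powr q) ^ (j + 1)) * emeasure M {\<omega>\<in>space M. Z t \<omega> < - (2 ^ j)}
          \<le> ennreal ((2 powr q) ^ (j + 1) * (c * ((1 + e) / 4) ^ j))"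
          unfolding emeasure_eq_measure using pj[of j]
          by (subst ennreal_mult[symmetric]) (auto intro!: ennreal_leI mult_left_mono)
        also have "(2 powr q) ^ (j + 1) * (c * ((1 + e) / 4) ^ j) = 2 powr q * c * \<rho> ^ j"
          unfolding \<rho>_def power_mult_distrib by simp
        finally show "ennreal ((2 powr q) ^ (j + 1)) * emeasure M {\<omega>\<in>space M. Z t \<omega> < - (2 ^ j)} \<le> ennreal (2 powr q * c * \<rho> ^ j)" .
      qed auto
      also have "(\<Sum>j. ennreal (2 powr q * c * \<rho> ^ j)) = ennreal (2 powr q * c * (1 / (1 - \<rho>)))"
        using \<rho> c by (intro suminf_ennreal_eq sums_mult geometric_sums) auto
      also have "1 + \<dots> = ennreal ?C"
        using \<rho> c by (subst ennreal_1[symmetric], subst ennreal_plus[symmetric]) auto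
      finally have le: "(\<integral>\<^sup>+\<omega>. ennreal (neg_part_pow q (Z t \<omega>)) \<partial>M) \<le> ennreal ?C" .
      have i: "integrable M (\<lambda>\<omega>. neg_part_pow q (Z t \<omega>))"
        using le neg_part_pow_nonneg by (intro integrableI_bounded) (auto simp: less_top[symmetric] top_unique)
      have "0 \<le> ?C"
        using \<rho> c by simp
      then have "expectation (\<lambda>\<omega>. neg_part_pow q (Z t \<omega>)) \<le> ?C"
        using le neg_part_pow_nonneg by (subst (asm) nn_integral_eq_integral[OF i]) auto
      then show ?case
        using i by simp
    qed
  qed
qed

text \<open>For \<open>p > 0\<close> the moment bound is taken at the midpoint of \<open>p\<close>
  and 2, which leaves room on both sides; \<open>p = 0\<close> is separate because of the
  jump.\<close>

lemma neg_part_Z_tendsto_less_2: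
  assumes "0 \<le> p" "p < 2"
  shows "((\<lambda>t. expectation (\<lambda>\<omega>. neg_part_pow p (Z t \<omega>))) \<longlongrightarrow> (\<integral>x. neg_part_pow p x \<partial>std_normal_distribution)) at_top"
proof (cases "p = 0")
  case True
  then show ?thesis using neg_part_0_Z_tendsto by simp
next
  case False
  obtain C where "\<forall>\<^sub>F t in at_top. integrable M (\<lambda>\<omega>. neg_part_pow ((p + 2) / 2) (Z t \<omega>)) \<and>
      expectation (\<lambda>\<omega>. neg_part_pow ((p + 2) / 2) (Z t \<omega>)) \<le> C"
    by (rule neg_part_bound[of "(p + 2) / 2"]) (use assms in auto)
  then show ?thesis
    by (rule neg_part_Z_tendsto[rotated 2]) (use assms False in auto)
qed

end

subsection \<open>Overshoot and second moments\<close>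

lemma borel_measurable_antimono:
  fixes f :: "real \<Rightarrow> real"
  assumes "antimono f"
  shows "f \<in> borel_measurable borel"
proof -
  have "(\<lambda>x. - f x) \<in> borel_measurable borel"
    using assms by (intro borel_measurable_mono) (auto simp: mono_def antimono_def)
  then show ?thesis
    by (simp add: borel_measurable_uminus_eq)
qed

context renewal
begin

text \<open>Fubini for the indicator of \<open>x \<le> z < xi\<close>: for fixed
  \<open>\<omega>\<close> the admissible \<open>z\<close> form an interval of length
  \<open>max (xi - x) 0\<close>.\<close>

lemma expected_excess:
  "(LBINT z:{x..}. tail0 z) = expectation (\<lambda>\<omega>. max (xi \<omega> - x) 0)"
proof -
  interpret P: pair_sigma_finite lborel M ..
  have "antimono (\<lambda>z. tail0 z)"
    by (intro antimonoI finite_measure_mono) auto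
  then have m [measurable]: "(\<lambda>z. tail0 z) \<in> borel_measurable borel"
    by (rule borel_measurable_antimono)
  have pe: "ennreal (tail0 z) = (\<integral>\<^sup>+\<omega>. indicator {z<..} (xi \<omega>) \<partial>M)" for z
  proof -
    have "(\<integral>\<^sup>+\<omega>. indicator {z<..} (xi \<omega>) \<partial>M) = (\<integral>\<^sup>+\<omega>. indicator {\<omega>\<in>space M. z < xi \<omega>} \<omega> \<partial>M)"
      by (intro nn_integral_cong) (auto simp: indicator_def)
    then show ?thesis
      by (simp add: emeasure_eq_measure)
  qed
  have "(LBINT z:{x..}. tail0 z)
    = enn2real (\<integral>\<^sup>+z. ennreal (indicator {x..} z *\<^sub>R tail0 z) \<partial>lborel)"
    unfolding set_lebesgue_integral_def by (rule integral_eq_nn_integral) auto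
  also have "(\<integral>\<^sup>+z. ennreal (indicator {x..} z *\<^sub>R tail0 z) \<partial>lborel)
    = (\<integral>\<^sup>+z. (\<integral>\<^sup>+\<omega>. indicator {x..} z * indicator {z<..} (xi \<omega>) \<partial>M) \<partial>lborel)"
    by (intro nn_integral_cong) (simp add: nn_integral_cmult pe ennreal_mult' ennreal_indicator)
  also have "\<dots> = (\<integral>\<^sup>+\<omega>. (\<integral>\<^sup>+z. indicator {x..} z * indicator {z<..} (xi \<omega>) \<partial>lborel) \<partial>M)"
  proof (rule P.Fubini'[symmetric])
    have "(\<lambda>p. indicator {x..} (fst p) * (if fst p < xi (snd p) then 1 else 0) :: ennreal) \<in> borel_measurable (lborel \<Otimes>\<^sub>M M)"
      by measurable
    also have "(\<lambda>p. indicator {x..} (fst p) * (if fst p < xi (snd p) then 1 else 0) :: ennreal)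
       = (\<lambda>(z, \<omega>). indicator {x..} z * indicator {z<..} (xi \<omega>))"
      by (auto simp: fun_eq_iff indicator_def)
    finally show "(\<lambda>(z, \<omega>). indicator {x..} z * indicator {z<..} (xi \<omega>) :: ennreal) \<in> borel_measurable (lborel \<Otimes>\<^sub>M M)" .
  qed
  also have "\<dots> = (\<integral>\<^sup>+\<omega>. ennreal (max (xi \<omega> - x) 0) \<partial>M)"
  proof (intro nn_integral_cong)
    fix \<omega>
    have "(\<integral>\<^sup>+z. indicator {x..} z * indicator {z<..} (xi \<omega>) \<partial>lborel) = (\<integral>\<^sup>+z. indicator {x..<xi \<omega>} z \<partial>lborel)"
      by (intro nn_integral_cong) (auto simp: indicator_def)
    also have "\<dots> = ennreal (max (xi \<omega> - x) 0)"
      by (cases "x \<le> xi \<omega>") (auto simp: max_def)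
    finally show "(\<integral>\<^sup>+z. indicator {x..} z * indicator {z<..} (xi \<omega>) \<partial>lborel) = ennreal (max (xi \<omega> - x) 0)" .
  qed
  also have "enn2real (\<integral>\<^sup>+\<omega>. ennreal (max (xi \<omega> - x) 0) \<partial>M) = expectation (\<lambda>\<omega>. max (xi \<omega> - x) 0)"
    by (rule integral_eq_nn_integral[symmetric]) auto
  finally show ?thesis .
qed

text \<open>A second use of Fubini gives \<open>2 * I\<close> as the mean of a function equal to
  \<open>xi^2\<close> for \<open>xi \<le> t\<close> and to \<open>2 * t * xi - t^2\<close> for
  \<open>xi > t\<close>. The second piece lies between 0 and \<open>2 * t * xi\<close>, and its mean
  is negligible against \<open>trunc2 t\<close> under slow variation.\<close>

lemma integrated_tail_bounds:
  assumes t: "0 \<le> t"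
  defines "I \<equiv> (LBINT x:{0..t}. (LBINT z:{x..}. tail0 z))"
  shows "trunc2 t \<le> 2 * I" "2 * I \<le> trunc2 t + 2 * (t * tail1 t)"
proof -
  interpret P: pair_sigma_finite lborel M ..
  define G where "G = (\<lambda>x. expectation (\<lambda>\<omega>. max (xi \<omega> - x) 0))"
  have iG: "integrable M (\<lambda>\<omega>. max (xi \<omega> - x) 0)" for x
    using xi_int by auto
  have G0: "0 \<le> G x" for x
    unfolding G_def by (intro Bochner_Integration.integral_nonneg) auto
  have "antimono G"
    unfolding G_def by (intro antimonoI integral_mono iG) auto
  then have [measurable]: "G \<in> borel_measurable borel"
    by (rule borel_measurable_antimono)
  \<comment> \<open>\<open>k y\<close> is the integral of \<open>max (y - x) 0\<close> over
    \<open>x\<close> from 0 to \<open>t\<close>, for positive \<open>y\<close>.\<close>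
  define k where "k = (\<lambda>y. y * min y t - (min y t)\<^sup>2 / 2)"
  have inner: "(\<integral>\<^sup>+x. indicator {0..t} x * ennreal (max (y - x) 0) \<partial>lborel) = ennreal (k y)" if y: "0 < y" for y
  proof -
    have "(\<integral>\<^sup>+x. indicator {0..t} x * ennreal (max (y - x) 0) \<partial>lborel) = (\<integral>\<^sup>+x. ennreal (y - x) * indicator {0..min y t} x \<partial>lborel)"
      by (intro nn_integral_cong) (auto simp: indicator_def max_def)
    also have "\<dots> = ennreal ((y * min y t - (min y t)\<^sup>2 / 2) - (y * 0 - 0\<^sup>2 / 2))"
      using y t by (intro nn_integral_FTC_Icc[where F = "\<lambda>x. y * x - x\<^sup>2 / 2"])
        (auto intro!: derivative_eq_intros)
    finally show ?thesis
      by (simp add: k_def)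
  qed
  have k: "2 * k y = y\<^sup>2 * indicator {z. z \<le> t} y + (2 * (t * y) - t\<^sup>2) * indicator {z. t < z} y" for y
    by (auto simp: k_def min_def power2_eq_square algebra_simps)
  have km [measurable]: "k \<in> borel_measurable borel"
    unfolding k_def by measurable
  have k0: "0 \<le> k y" if "0 < y" for y
  proof -
    have "min y t * min y t \<le> y * min y t"
      using that t by (intro mult_right_mono) auto
    moreover have "0 \<le> min y t * min y t"
      by simp
    ultimately show ?thesis
      unfolding k_def power2_eq_square by linarith
  qed
  have "I = enn2real (\<integral>\<^sup>+x. ennreal (indicator {0..t} x *\<^sub>R G x) \<partial>lborel)"
    unfolding I_def expected_excess G_def[symmetric] unfolding set_lebesgue_integral_def
    using G0 by (intro integral_eq_nn_integral) auto
  also have "(\<integral>\<^sup>+x. ennreal (indicator {0..t} x *\<^sub>R G x) \<partial>lborel)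
    = (\<integral>\<^sup>+x. (\<integral>\<^sup>+\<omega>. indicator {0..t} x * ennreal (max (xi \<omega> - x) 0) \<partial>M) \<partial>lborel)"
  proof (intro nn_integral_cong)
    fix x
    have "ennreal (G x) = (\<integral>\<^sup>+\<omega>. ennreal (max (xi \<omega> - x) 0) \<partial>M)"
      unfolding G_def using iG by (subst nn_integral_eq_integral) auto
    then show "ennreal (indicator {0..t} x *\<^sub>R G x) = (\<integral>\<^sup>+\<omega>. indicator {0..t} x * ennreal (max (xi \<omega> - x) 0) \<partial>M)"
      using G0 by (simp add: nn_integral_cmult ennreal_mult' ennreal_indicator)
  qed
  also have "\<dots> = (\<integral>\<^sup>+\<omega>. (\<integral>\<^sup>+x. indicator {0..t} x * ennreal (max (xi \<omega> - x) 0) \<partial>lborel) \<partial>M)"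
  proof (rule P.Fubini'[symmetric])
    have "(\<lambda>p. indicator {0..t} (fst p) * ennreal (max (xi (snd p) - fst p) 0)) \<in> borel_measurable (lborel \<Otimes>\<^sub>M M)"
      by measurable
    then show "(\<lambda>(x, \<omega>). indicator {0..t} x * ennreal (max (xi \<omega> - x) 0)) \<in> borel_measurable (lborel \<Otimes>\<^sub>M M)"
      by (simp add: split_beta')
  qed
  also have "\<dots> = (\<integral>\<^sup>+\<omega>. ennreal (k (xi \<omega>)) \<partial>M)"
  proof (rule nn_integral_cong_AE)
    show "AE \<omega> in M. (\<integral>\<^sup>+x. indicator {0..t} x * ennreal (max (xi \<omega> - x) 0) \<partial>lborel) = ennreal (k (xi \<omega>))"
      using xi_pos by eventually_elim (rule inner)
  qed
  also have "enn2real \<dots> = expectation (\<lambda>\<omega>. k (xi \<omega>))"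
    using xi_pos by (intro integral_eq_nn_integral[symmetric]) (auto simp: k0 elim!: eventually_mono)
  finally have I: "2 * I = expectation (\<lambda>\<omega>. 2 * k (xi \<omega>))"
    by simp
  have ind: "indicator {z. z \<le> t} (xi \<omega>) = indicator {\<omega>. xi \<omega> \<le> t} \<omega>" "indicator {z. t < z} (xi \<omega>) = indicator {\<omega>. t < xi \<omega>} \<omega>" for \<omega>
    by (auto simp: indicator_def)
  have i1: "integrable M (\<lambda>\<omega>. indicator {\<omega>. t < xi \<omega>} \<omega> :: real)"
    by (rule integrable_const_bound[of _ 1]) auto
  have eq: "2 * k (xi \<omega>) = (xi \<omega>)\<^sup>2 * indicator {\<omega>. xi \<omega> \<le> t} \<omega> + (2 * (t * (xi \<omega> * indicator {\<omega>. t < xi \<omega>} \<omega>)) - t\<^sup>2 * indicator {\<omega>. t < xi \<omega>} \<omega>)" for \<omega>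
    unfolding k ind by (simp add: algebra_simps)
  have i2: "integrable M (\<lambda>\<omega>. 2 * k (xi \<omega>))"
    unfolding eq using trunc2_int tail1_int i1 by simp
  show "trunc2 t \<le> 2 * I"
    unfolding I trunc2_eq
  proof (rule integral_mono[OF trunc2_int i2])
    fix \<omega>
    have "t * t \<le> t * xi \<omega>" if "t < xi \<omega>"
      using t that by (intro mult_left_mono) auto
    moreover have "t * xi \<omega> \<ge> 0" if "t < xi \<omega>"
      using t that by simp
    ultimately show "(xi \<omega>)\<^sup>2 * indicator {\<omega>. xi \<omega> \<le> t} \<omega> \<le> 2 * k (xi \<omega>)"
      unfolding eq by (auto simp: indicator_def power2_eq_square)
  qed
  have "2 * I \<le> expectation (\<lambda>\<omega>. (xi \<omega>)\<^sup>2 * indicator {\<omega>. xi \<omega> \<le> t} \<omega> + 2 * (t * (xi \<omega> * indicator {\<omega>. t < xi \<omega>} \<omega>)))"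
    unfolding I
  proof (rule integral_mono[OF i2])
    show "integrable M (\<lambda>\<omega>. (xi \<omega>)\<^sup>2 * indicator {\<omega>. xi \<omega> \<le> t} \<omega> + 2 * (t * (xi \<omega> * indicator {\<omega>. t < xi \<omega>} \<omega>)))"
      using trunc2_int tail1_int by simp
  qed (simp add: eq)
  also have "\<dots> = trunc2 t + 2 * (t * tail1 t)"
    using trunc2_int tail1_int by (simp add: trunc2_eq tail1_def)
  finally show "2 * I \<le> trunc2 t + 2 * (t * tail1 t)" .
qed

text \<open>Clipping to \<open>T\<close>, in place of replacing large steps by 0, preserves the
  first passage over any level \<open>t < T\<close>: a clipped step of size \<open>T\<close> still
  crosses. The inner \<open>max x 0\<close> makes the bounds hold for all real arguments and not
  merely almost surely.\<close>

definition clip :: "real \<Rightarrow> real \<Rightarrow> real" where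
  "clip T x = min (max x 0) T"

lemma clip_measurable [measurable]: "clip T \<in> borel_measurable borel"
  unfolding clip_def[abs_def] by measurable

lemma clip_bounds: "0 \<le> T \<Longrightarrow> 0 \<le> clip T x" "clip T x \<le> T"
  by (auto simp: clip_def)

text \<open>The expected number of visits of the walk to an interval of length \<open>\<delta>\<close> is at most \<open>1 / q\<close> with
  \<open>q = P(\<xi> > \<delta>)\<close>: the events that \<open>S\<^sub>k\<close> lies in the interval and the next step exceeds \<open>\<delta>\<close> are disjoint.\<close>

lemma overshoot_second_moment:
  assumes t: "0 \<le> t" and T: "t < T" and \<delta>: "0 < \<delta>" and q: "0 < tail0 \<delta>"
  defines "R \<equiv> \<lambda>\<omega>. (\<Sum>k<N t \<omega>. clip T (X (Suc k) \<omega>)) - t"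
  shows "integrable M (\<lambda>\<omega>. (R \<omega>)\<^sup>2)"
    and "expectation (\<lambda>\<omega>. (R \<omega>)\<^sup>2) \<le> expectation (\<lambda>\<omega>. (clip T (xi \<omega>))\<^sup>2 * (clip T (xi \<omega>) / \<delta> + 1)) / tail0 \<delta>"
proof -
  let ?q = "tail0 \<delta>"
  have T0: "0 \<le> T"
    using t T by simp
  \<comment> \<open>The distance from the last position before the crossing to the level
    \<open>t\<close> is sorted into windows \<open>[n * \<delta>, n * \<delta> + \<delta>)\<close>,
    recorded by \<open>f n k\<close>. In window \<open>n\<close> the squared overshoot is at most
    \<open>\<psi> n\<close> of the crossing step, which is independent of
    \<open>f n k\<close>.\<close>
  define \<psi> where "\<psi> = (\<lambda>n::nat. \<lambda>x. ennreal ((max (clip T x - n * \<delta>) 0)\<^sup>2))"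
  define f where "f = (\<lambda>n::nat. \<lambda>k \<omega>. of_bool (alive t k \<omega> \<and> n * \<delta> \<le> t - partial_sum X k \<omega> \<and> t - partial_sum X k \<omega> < n * \<delta> + \<delta>) :: ennreal)"
  have \<psi>m [measurable]: "\<psi> n \<in> borel_measurable borel" for n
    unfolding \<psi>_def by measurable
  have fp: "f n k \<in> borel_measurable (past k)" for n k
  proof -
    have [measurable]: "partial_sum X k \<in> borel_measurable (past k)" "Measurable.pred (past k) (alive t k)"
      by (auto intro: partial_sum_past alive_past)
    show ?thesis
      unfolding f_def by measurable
  qed
  have fm [measurable]: "f n k \<in> borel_measurable M" for n k
    using fp by (rule measurable_pastD)
  have Rm [measurable]: "R \<in> borel_measurable M"
    unfolding R_def by measurable
  have visits: "(\<integral>\<^sup>+\<omega>. (\<Sum>k. f n k \<omega>) \<partial>M) \<le> ennreal (1 / ?q)" for n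
  proof -
    have "(\<integral>\<^sup>+\<omega>. (\<Sum>k. f n k \<omega>) \<partial>M) * (\<integral>\<^sup>+\<omega>. indicator {\<delta><..} (xi \<omega>) \<partial>M)
      = (\<integral>\<^sup>+\<omega>. (\<Sum>k. f n k \<omega> * indicator {\<delta><..} (X (Suc k) \<omega>)) \<partial>M)"
      by (rule wald_nn[symmetric]) (use fp in auto)
    also have "\<dots> \<le> (\<integral>\<^sup>+\<omega>. 1 \<partial>M)"
    proof (intro nn_integral_mono_AE)
      show "AE \<omega> in M. (\<Sum>k. f n k \<omega> * indicator {\<delta><..} (X (Suc k) \<omega>)) \<le> 1"
        using AE_good[OF t]
      proof eventually_elim
        case (elim \<omega>)
        define Q where "Q = (\<lambda>k. n * \<delta> \<le> t - partial_sum X k \<omega> \<and> t - partial_sum X k \<omega> < n * \<delta> + \<delta> \<and> \<delta> < X (Suc k) \<omega>)"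
        have inc: "partial_sum X i \<omega> \<le> partial_sum X j \<omega>" if "i \<le> j" for i j
          unfolding partial_sum_eq using that elim by (intro sum_mono2) (auto simp: good_def intro: less_imp_le)
        \<comment> \<open>A step larger than \<open>\<delta>\<close> carries the walk out of a
          window of length \<open>\<delta>\<close>, and monotonicity of the partial sums prevents a
          return.\<close>
        have no: False if "Q i" "Q j" "i < j" for i j
          using inc[of "Suc i" j] that by (auto simp: Q_def partial_sum_Suc)
        have zero: "f n k \<omega> * indicator {\<delta><..} (X (Suc k) \<omega>) = 0" if "\<not> Q k" for k
          using that by (auto simp: f_def Q_def indicator_def)
        show ?case
        proof (cases "\<exists>k. Q k")
          case True
          then obtain k0 where k0: "Q k0" by auto
          have "(\<Sum>k. f n k \<omega> * indicator {\<delta><..} (X (Suc k) \<omega>)) = (\<Sum>k\<in>{k0}. f n k \<omega> * indicator {\<delta><..} (X (Suc k) \<omega>))"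
          proof (rule suminf_finite)
            fix k assume "k \<notin> {k0}"
            then have "\<not> Q k"
              using no[of k k0] no[of k0 k] k0 by (cases k k0 rule: linorder_cases) auto
            then show "f n k \<omega> * indicator {\<delta><..} (X (Suc k) \<omega>) = 0"
              by (rule zero)
          qed simp
          also have "\<dots> \<le> 1"
            by (simp add: f_def indicator_def)
          finally show ?thesis .
        next
          case False
          then have "(\<Sum>k. f n k \<omega> * indicator {\<delta><..} (X (Suc k) \<omega>)) = 0"
            using zero by (subst suminf_finite[of "{}"]) auto
          then show ?thesis by simp
        qed
      qed
    qed
    also have "\<dots> = 1"
      by (simp add: emeasure_space_1)
    also have "(\<integral>\<^sup>+\<omega>. indicator {\<delta><..} (xi \<omega>) \<partial>M) = ennreal ?q"
    proof -
      have "(\<integral>\<^sup>+\<omega>. indicator {\<delta><..} (xi \<omega>) \<partial>M) = (\<integral>\<^sup>+\<omega>. indicator {\<omega>\<in>space M. \<delta> < xi \<omega>} \<omega> \<partial>M)"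
        by (intro nn_integral_cong) (auto simp: indicator_def)
      then show ?thesis
        by (simp add: emeasure_eq_measure)
    qed
    finally have le: "(\<integral>\<^sup>+\<omega>. (\<Sum>k. f n k \<omega>) \<partial>M) * ennreal ?q \<le> 1" .
    have "(\<integral>\<^sup>+\<omega>. (\<Sum>k. f n k \<omega>) \<partial>M) = (\<integral>\<^sup>+\<omega>. (\<Sum>k. f n k \<omega>) \<partial>M) * ennreal ?q * ennreal (1 / ?q)"
      using q by (simp add: mult.assoc ennreal_mult'[symmetric])
    also have "\<dots> \<le> 1 * ennreal (1 / ?q)"
      by (intro mult_right_mono le) simp
    finally show ?thesis by simp
  qed
  have path: "AE \<omega> in M. ennreal ((R \<omega>)\<^sup>2) \<le> (\<Sum>n. \<Sum>k. f n k \<omega> * \<psi> n (X (Suc k) \<omega>))"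
    using AE_good[OF t]
  proof eventually_elim
    case (elim \<omega>)
    define k where "k = N t \<omega> - 1"
    have N: "N t \<omega> = Suc k"
      using good_sum_pos[OF elim t] by (simp add: k_def)
    have al: "alive t k \<omega>"
      using alive_iff[OF elim] N by simp
    define s where "s = t - partial_sum X k \<omega>"
    have s0: "0 \<le> s"
      using alive_le[OF al t] by (simp add: s_def)
    define n where "n = nat \<lfloor>s / \<delta>\<rfloor>"
    have sd: "0 \<le> s / \<delta>"
      using s0 \<delta> by simp
    have "real n = of_int \<lfloor>s / \<delta>\<rfloor>"
      unfolding n_def using sd by simp
    then have "real n \<le> s / \<delta>" "s / \<delta> < real n + 1"
      by linarith+
    then have ns: "n * \<delta> \<le> s" "s < n * \<delta> + \<delta>"
      using \<delta> by (auto simp: field_simps)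
    \<comment> \<open>Any step before the crossing is at most \<open>t < T\<close>, so clipping can
      alter the crossing step only.\<close>
    have small: "clip T (X (Suc j) \<omega>) = X (Suc j) \<omega>" if "j < k" for j
    proof -
      have "X (Suc j) \<omega> \<le> (\<Sum>i<k. X (Suc i) \<omega>)"
        using that elim by (intro member_le_sum[of j "{..<k}" "\<lambda>i. X (Suc i) \<omega>"]) (auto simp: good_def intro: less_imp_le)
      also have "\<dots> \<le> t"
        using s0 by (simp add: s_def partial_sum_eq)
      finally show ?thesis
        using T elim by (simp add: clip_def good_def less_imp_le)
    qed
    have R: "R \<omega> = clip T (X (Suc k) \<omega>) - s"
      unfolding R_def N sum.lessThan_Suc s_def partial_sum_eq using small by simp
    have "s < clip T (X (Suc k) \<omega>)"
    proof -
      have "s < X (Suc k) \<omega>"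
        using good_sum_pos[OF elim t] N by (simp add: s_def partial_sum_Suc)
      moreover have "s < T"
      proof -
        have "0 \<le> partial_sum X k \<omega>"
          unfolding partial_sum_eq using elim by (intro sum_nonneg) (auto simp: good_def intro: less_imp_le)
        then show ?thesis
          using T by (simp add: s_def)
      qed
      ultimately show ?thesis
        by (auto simp: clip_def)
    qed
    then have "(R \<omega>)\<^sup>2 \<le> (max (clip T (X (Suc k) \<omega>) - n * \<delta>) 0)\<^sup>2"
      unfolding R using ns by (intro power_mono) auto
    then have "ennreal ((R \<omega>)\<^sup>2) \<le> f n k \<omega> * \<psi> n (X (Suc k) \<omega>)"
      using al ns by (simp add: f_def \<psi>_def s_def ennreal_leI)
    also have "\<dots> \<le> (\<Sum>k. f n k \<omega> * \<psi> n (X (Suc k) \<omega>))"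
      using sum_le_suminf[OF summableI, of "{k}" "\<lambda>k. f n k \<omega> * \<psi> n (X (Suc k) \<omega>)"] by simp
    also have "\<dots> \<le> (\<Sum>n. \<Sum>k. f n k \<omega> * \<psi> n (X (Suc k) \<omega>))"
      using sum_le_suminf[OF summableI, of "{n}" "\<lambda>n. \<Sum>k. f n k \<omega> * \<psi> n (X (Suc k) \<omega>)"] by simp
    finally show ?case .
  qed
  have \<psi>sum: "(\<Sum>n. \<psi> n x) \<le> ennreal ((clip T x)\<^sup>2 * (clip T x / \<delta> + 1))" for x
  proof -
    define y where "y = clip T x"
    have y: "0 \<le> y"
      using clip_bounds T0 by (simp add: y_def)
    \<comment> \<open>Only windows with \<open>n * \<delta> < y\<close> contribute. There are at
      most \<open>m \<le> y / \<delta> + 1\<close> of them, each with a term of at most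
      \<open>y^2\<close>; this is the source of the third moment in the bound.\<close>
    define m where "m = nat \<lceil>y / \<delta>\<rceil>"
    have yd: "0 \<le> y / \<delta>"
      using y \<delta> by simp
    have m: "y / \<delta> \<le> real m" "real m \<le> y / \<delta> + 1"
      unfolding m_def using yd by linarith+
    have "(\<Sum>n. \<psi> n x) = (\<Sum>n<m. \<psi> n x)"
    proof (rule suminf_finite)
      fix n assume "n \<notin> {..<m}"
      then have "real m \<le> real n"
        by simp
      then have "y / \<delta> \<le> real n"
        using m(1) by linarith
      then have "y \<le> n * \<delta>"
        using \<delta> by (simp add: field_simps)
      then show "\<psi> n x = 0"
        by (simp add: \<psi>_def y_def)
    qed simp
    also have "\<dots> \<le> (\<Sum>n<m. ennreal (y\<^sup>2))"
      unfolding \<psi>_def y_def[symmetric] using y \<delta> by (intro sum_mono ennreal_leI power_mono) auto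
    also have "\<dots> = ennreal (real m * y\<^sup>2)"
      by (simp add: ennreal_mult ennreal_of_nat_eq_real_of_nat)
    also have "\<dots> \<le> ennreal (y\<^sup>2 * (y / \<delta> + 1))"
      using mult_left_mono[OF m(2), of "y\<^sup>2"] by (intro ennreal_leI) (simp add: mult.commute)
    finally show ?thesis
      by (simp add: y_def)
  qed
  have iB: "integrable M (\<lambda>\<omega>. (clip T (xi \<omega>))\<^sup>2 * (clip T (xi \<omega>) / \<delta> + 1))"
  proof (rule integrable_const_bound[of _ "T\<^sup>2 * (T / \<delta> + 1)"])
    have "norm ((clip T x)\<^sup>2 * (clip T x / \<delta> + 1)) \<le> T\<^sup>2 * (T / \<delta> + 1)" for x
      unfolding norm_mult using clip_bounds[of T x] T0 \<delta>
      by (intro mult_mono) (auto intro!: power_mono divide_right_mono)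
    then show "AE \<omega> in M. norm ((clip T (xi \<omega>))\<^sup>2 * (clip T (xi \<omega>) / \<delta> + 1)) \<le> T\<^sup>2 * (T / \<delta> + 1)"
      by simp
  qed measurable
  define B where "B = expectation (\<lambda>\<omega>. (clip T (xi \<omega>))\<^sup>2 * (clip T (xi \<omega>) / \<delta> + 1))"
  have B0: "0 \<le> B"
    unfolding B_def using clip_bounds T0 \<delta> by (intro Bochner_Integration.integral_nonneg) (auto intro!: mult_nonneg_nonneg add_nonneg_nonneg)
  have "(\<integral>\<^sup>+\<omega>. ennreal ((R \<omega>)\<^sup>2) \<partial>M) \<le> (\<integral>\<^sup>+\<omega>. (\<Sum>n. \<Sum>k. f n k \<omega> * \<psi> n (X (Suc k) \<omega>)) \<partial>M)"
    by (rule nn_integral_mono_AE[OF path])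
  also have "\<dots> = (\<Sum>n. \<integral>\<^sup>+\<omega>. (\<Sum>k. f n k \<omega> * \<psi> n (X (Suc k) \<omega>)) \<partial>M)"
    by (intro nn_integral_suminf) measurable
  also have "\<dots> = (\<Sum>n. (\<integral>\<^sup>+\<omega>. (\<Sum>k. f n k \<omega>) \<partial>M) * (\<integral>\<^sup>+\<omega>. \<psi> n (xi \<omega>) \<partial>M))"
    using wald_nn[OF \<psi>m fp] by simp
  also have "\<dots> \<le> (\<Sum>n. ennreal (1 / ?q) * (\<integral>\<^sup>+\<omega>. \<psi> n (xi \<omega>) \<partial>M))"
    using visits by (intro suminf_le mult_right_mono) auto
  also have "\<dots> = ennreal (1 / ?q) * (\<integral>\<^sup>+\<omega>. (\<Sum>n. \<psi> n (xi \<omega>)) \<partial>M)"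
    by (simp add: nn_integral_suminf)
  also have "\<dots> \<le> ennreal (1 / ?q) * (\<integral>\<^sup>+\<omega>. ennreal ((clip T (xi \<omega>))\<^sup>2 * (clip T (xi \<omega>) / \<delta> + 1)) \<partial>M)"
    by (intro mult_left_mono nn_integral_mono \<psi>sum) auto
  also have "\<dots> = ennreal (1 / ?q) * ennreal B"
    unfolding B_def using clip_bounds T0 \<delta>
    by (subst nn_integral_eq_integral[OF iB]) (auto intro!: AE_I2 mult_nonneg_nonneg add_nonneg_nonneg)
  also have "\<dots> = ennreal (B / ?q)"
    using B0 by (simp add: ennreal_mult[symmetric])
  finally have le: "(\<integral>\<^sup>+\<omega>. ennreal ((R \<omega>)\<^sup>2) \<partial>M) \<le> ennreal (B / ?q)" .
  show i: "integrable M (\<lambda>\<omega>. (R \<omega>)\<^sup>2)"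
    using le by (intro integrableI_bounded) (auto simp: less_top[symmetric] top_unique)
  show "expectation (\<lambda>\<omega>. (R \<omega>)\<^sup>2) \<le> B / ?q"
    using le B0 by (subst (asm) nn_integral_eq_integral[OF i]) auto
qed

lemma clip_integrable: "0 \<le> T \<Longrightarrow> integrable M (\<lambda>\<omega>. clip T (xi \<omega>) ^ n)"
  using clip_bounds[of T] by (intro integrable_const_bound[of _ "T ^ n"]) (auto intro!: power_mono)

lemma clip_mean:
  assumes "0 < T"
  shows "mu - tail1 T \<le> expectation (\<lambda>\<omega>. clip T (xi \<omega>))" "expectation (\<lambda>\<omega>. clip T (xi \<omega>)) \<le> mu"
proof -
  have i: "integrable M (\<lambda>\<omega>. clip T (xi \<omega>))"
    using clip_integrable[of T 1] assms by simp
  have "mu - tail1 T = expectation (\<lambda>\<omega>. xi \<omega> - xi \<omega> * indicator {\<omega>. T < xi \<omega>} \<omega>)"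
    using xi_int tail1_int by (simp add: mu_def tail1_def)
  also have "\<dots> \<le> expectation (\<lambda>\<omega>. clip T (xi \<omega>))"
  proof (rule integral_mono_AE[OF _ i])
    show "integrable M (\<lambda>\<omega>. xi \<omega> - xi \<omega> * indicator {\<omega>. T < xi \<omega>} \<omega>)"
      using xi_int tail1_int by simp
    show "AE \<omega> in M. xi \<omega> - xi \<omega> * indicator {\<omega>. T < xi \<omega>} \<omega> \<le> clip T (xi \<omega>)"
      using xi_pos by eventually_elim (use assms in \<open>auto simp: clip_def indicator_def\<close>)
  qed
  finally show "mu - tail1 T \<le> expectation (\<lambda>\<omega>. clip T (xi \<omega>))" .
  show "expectation (\<lambda>\<omega>. clip T (xi \<omega>)) \<le> mu"
    unfolding mu_def using xi_pos by (intro integral_mono_AE i xi_int) (auto simp: clip_def)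
qed

lemma clip_second_moment:
  assumes T: "0 < T"
  shows "trunc2 T \<le> expectation (\<lambda>\<omega>. (clip T (xi \<omega>))\<^sup>2)"
    "expectation (\<lambda>\<omega>. (clip T (xi \<omega>))\<^sup>2) \<le> trunc2 T + T * tail1 T"
proof -
  have i: "integrable M (\<lambda>\<omega>. (clip T (xi \<omega>))\<^sup>2)"
    using clip_integrable[of T 2] T by simp
  show "trunc2 T \<le> expectation (\<lambda>\<omega>. (clip T (xi \<omega>))\<^sup>2)"
    unfolding trunc2_eq
  proof (rule integral_mono_AE[OF trunc2_int i])
    show "AE \<omega> in M. (xi \<omega>)\<^sup>2 * indicator {\<omega>. xi \<omega> \<le> T} \<omega> \<le> (clip T (xi \<omega>))\<^sup>2"
      using xi_pos by eventually_elim (auto simp: clip_def indicator_def)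
  qed
  have "expectation (\<lambda>\<omega>. (clip T (xi \<omega>))\<^sup>2) \<le> expectation (\<lambda>\<omega>. (xi \<omega>)\<^sup>2 * indicator {\<omega>. xi \<omega> \<le> T} \<omega> + T * (xi \<omega> * indicator {\<omega>. T < xi \<omega>} \<omega>))"
  proof (rule integral_mono_AE[OF i])
    show "integrable M (\<lambda>\<omega>. (xi \<omega>)\<^sup>2 * indicator {\<omega>. xi \<omega> \<le> T} \<omega> + T * (xi \<omega> * indicator {\<omega>. T < xi \<omega>} \<omega>))"
      using trunc2_int tail1_int by simp
    show "AE \<omega> in M. (clip T (xi \<omega>))\<^sup>2 \<le> (xi \<omega>)\<^sup>2 * indicator {\<omega>. xi \<omega> \<le> T} \<omega> + T * (xi \<omega> * indicator {\<omega>. T < xi \<omega>} \<omega>)"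
      using xi_pos by eventually_elim (use T in \<open>auto simp: clip_def indicator_def power2_eq_square\<close>)
  qed
  also have "\<dots> = trunc2 T + T * tail1 T"
    using trunc2_int tail1_int by (simp add: trunc2_eq tail1_def)
  finally show "expectation (\<lambda>\<omega>. (clip T (xi \<omega>))\<^sup>2) \<le> trunc2 T + T * tail1 T" .
qed

text \<open>Designed to be \<open>o (T * trunc2 T)\<close>: below \<open>e * T\<close> one factor
  \<open>xi\<close> is at most \<open>e * T\<close>; the range from \<open>e * T\<close> to
  \<open>T\<close> carries only an increment of the slowly varying \<open>trunc2\<close>; above
  \<open>T\<close> the bound \<open>T^3 \<le> T^2 * xi\<close> leads to the tail, which
  \<open>tail1_small\<close> controls.\<close>

lemma clip_third_moment:
  assumes T: "0 < T" and e: "0 < e" "e \<le> 1"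
  shows "expectation (\<lambda>\<omega>. clip T (xi \<omega>) ^ 3) \<le> e * T * trunc2 (e * T) + T * (trunc2 T - trunc2 (e * T)) + T\<^sup>2 * tail1 T"
proof -
  let ?i = "\<lambda>y \<omega>. (xi \<omega>)\<^sup>2 * indicator {\<omega>. xi \<omega> \<le> y} \<omega>"
  let ?f = "\<lambda>\<omega>. e * T * ?i (e * T) \<omega> + T * (?i T \<omega> - ?i (e * T) \<omega>) + T\<^sup>2 * (xi \<omega> * indicator {\<omega>. T < xi \<omega>} \<omega>)"
  have eT: "e * T \<le> T"
    using e T by simp
  have "expectation (\<lambda>\<omega>. clip T (xi \<omega>) ^ 3) \<le> expectation ?f"
  proof (rule integral_mono_AE)
    show "integrable M (\<lambda>\<omega>. clip T (xi \<omega>) ^ 3)"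
      using clip_integrable[of T 3] T by simp
    show "integrable M ?f"
      using trunc2_int tail1_int by simp
    show "AE \<omega> in M. clip T (xi \<omega>) ^ 3 \<le> ?f \<omega>"
      using xi_pos
    proof eventually_elim
      case (elim \<omega>)
      consider "xi \<omega> \<le> e * T" | "e * T < xi \<omega>" "xi \<omega> \<le> T" | "T < xi \<omega>"
        by linarith
      then show ?case
      proof cases
        case 1
        then have "xi \<omega> * (xi \<omega>)\<^sup>2 \<le> e * T * (xi \<omega>)\<^sup>2"
          by (rule mult_right_mono) simp
        then show ?thesis
          using 1 eT elim by (simp add: clip_def power2_eq_square power3_eq_cube)
      next
        case 2
        then have "xi \<omega> * (xi \<omega>)\<^sup>2 \<le> T * (xi \<omega>)\<^sup>2"
          by (intro mult_right_mono) auto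
        then show ?thesis
          using 2 eT elim by (simp add: clip_def power2_eq_square power3_eq_cube)
      next
        case 3
        then have "T\<^sup>2 * T \<le> T\<^sup>2 * xi \<omega>"
          by (intro mult_left_mono) auto
        moreover have "\<not> xi \<omega> \<le> e * T"
          using 3 eT by linarith
        ultimately show ?thesis
          using 3 elim T by (simp add: clip_def power2_eq_square power3_eq_cube)
      qed
    qed
  qed
  also have "\<dots> = e * T * trunc2 (e * T) + T * (trunc2 T - trunc2 (e * T)) + T\<^sup>2 * tail1 T"
    using trunc2_int tail1_int by (simp add: trunc2_eq tail1_def)
  finally show ?thesis .
qed

end

section \<open>Asymptotics of the clipped moments and of the integrated tail\<close>

context sv_renewal
begin

lemma trunc2_pos: "\<forall>\<^sub>F t in at_top. 0 < trunc2 t"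
  using sv by (simp add: slowly_varying_def)

lemma trunc2_ratio: "0 < x \<Longrightarrow> ((\<lambda>t. trunc2 (x * t) / trunc2 t) \<longlongrightarrow> 1) at_top"
  using sv by (simp add: slowly_varying_def)

lemma times_two_top: "filterlim (\<lambda>t::real. 2 * t) at_top at_top"
  by (intro filterlim_tendsto_pos_mult_at_top[OF tendsto_const] filterlim_ident) simp

lemma tail1_ratio: "((\<lambda>t. t * tail1 (2 * t) / trunc2 t) \<longlongrightarrow> 0) at_top"
proof -
  have "((\<lambda>t. 1 / 2 * ((2 * t) * tail1 (2 * t) / trunc2 (2 * t)) * (trunc2 (2 * t) / trunc2 t)) \<longlongrightarrow> 1 / 2 * 0 * 1) at_top"
    by (intro tendsto_mult tendsto_const trunc2_ratio filterlim_compose[OF tail1_small times_two_top]) simp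
  moreover have "\<forall>\<^sub>F t in at_top. 1 / 2 * ((2 * t) * tail1 (2 * t) / trunc2 (2 * t)) * (trunc2 (2 * t) / trunc2 t) = t * tail1 (2 * t) / trunc2 t"
    using eventually_compose_filterlim[OF trunc2_pos times_two_top] by eventually_elim auto
  ultimately show ?thesis
    using Lim_transform_eventually by fastforce
qed

lemma clip_second_moment_tendsto: "((\<lambda>t. expectation (\<lambda>\<omega>. (clip (2 * t) (xi \<omega>))\<^sup>2) / trunc2 t) \<longlongrightarrow> 1) at_top"
proof (rule tendsto_sandwich[where f = "\<lambda>t. trunc2 (2 * t) / trunc2 t" and h = "\<lambda>t. trunc2 (2 * t) / trunc2 t + 2 * (t * tail1 (2 * t) / trunc2 t)"])
  show "((\<lambda>t. trunc2 (2 * t) / trunc2 t + 2 * (t * tail1 (2 * t) / trunc2 t)) \<longlongrightarrow> 1) at_top"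
    using tendsto_add[OF trunc2_ratio[of 2] tendsto_mult[OF tendsto_const[of 2] tail1_ratio]] by simp
  show "\<forall>\<^sub>F t in at_top. trunc2 (2 * t) / trunc2 t \<le> expectation (\<lambda>\<omega>. (clip (2 * t) (xi \<omega>))\<^sup>2) / trunc2 t"
    using trunc2_pos eventually_gt_at_top[of 0] by eventually_elim (auto intro!: divide_right_mono clip_second_moment)
  show "\<forall>\<^sub>F t in at_top. expectation (\<lambda>\<omega>. (clip (2 * t) (xi \<omega>))\<^sup>2) / trunc2 t \<le> trunc2 (2 * t) / trunc2 t + 2 * (t * tail1 (2 * t) / trunc2 t)"
    using trunc2_pos eventually_gt_at_top[of 0]
  proof eventually_elim
    case (elim t)
    then show ?case
      using clip_second_moment(2)[of "2 * t"] by (simp add: field_simps)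
  qed
qed (use trunc2_ratio in simp)

lemma clip_third_moment_tendsto: "((\<lambda>t. expectation (\<lambda>\<omega>. clip (2 * t) (xi \<omega>) ^ 3) / (t * trunc2 t)) \<longlongrightarrow> 0) at_top"
proof (rule tendstoI)
  fix r :: real assume r: "0 < r"
  \<comment> \<open>With \<open>T = 2 * t\<close> the first term of \<open>clip_third_moment\<close>
    becomes \<open>2 * e\<close> in the limit, and the other two vanish; hence the requirement
    \<open>2 * e < r\<close>.\<close>
  define e where "e = min 1 (r / 4)"
  have e: "0 < e" "e \<le> 1" "2 * e < r"
    using r by (auto simp: e_def min_def field_simps)
  have "((\<lambda>t. 2 * e * (trunc2 (2 * e * t) / trunc2 t) + 2 * (trunc2 (2 * t) / trunc2 t - trunc2 (2 * e * t) / trunc2 t)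
      + 4 * (t * tail1 (2 * t) / trunc2 t)) \<longlongrightarrow> 2 * e * 1 + 2 * (1 - 1) + 4 * 0) at_top"
    by (intro tendsto_add tendsto_mult tendsto_diff tendsto_const trunc2_ratio tail1_ratio) (use e in auto)
  then have ev: "\<forall>\<^sub>F t in at_top. 2 * e * (trunc2 (2 * e * t) / trunc2 t) + 2 * (trunc2 (2 * t) / trunc2 t - trunc2 (2 * e * t) / trunc2 t)
      + 4 * (t * tail1 (2 * t) / trunc2 t) < r"
    using e by (intro order_tendstoD(2)) auto
  show "\<forall>\<^sub>F t in at_top. dist (expectation (\<lambda>\<omega>. clip (2 * t) (xi \<omega>) ^ 3) / (t * trunc2 t)) 0 < r"
    using ev trunc2_pos eventually_gt_at_top[of 0]
  proof eventually_elim
    case (elim t)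
    have "expectation (\<lambda>\<omega>. clip (2 * t) (xi \<omega>) ^ 3) / (t * trunc2 t)
      \<le> (e * (2 * t) * trunc2 (e * (2 * t)) + (2 * t) * (trunc2 (2 * t) - trunc2 (e * (2 * t))) + (2 * t)\<^sup>2 * tail1 (2 * t)) / (t * trunc2 t)"
      using clip_third_moment[of "2 * t" e] elim e by (intro divide_right_mono) auto
    also have "\<dots> = 2 * e * (trunc2 (2 * e * t) / trunc2 t) + 2 * (trunc2 (2 * t) / trunc2 t - trunc2 (2 * e * t) / trunc2 t)
      + 4 * (t * tail1 (2 * t) / trunc2 t)"
    proof -
      have e2: "e * (2 * t) = 2 * e * t" by simp
      show ?thesis
        unfolding e2 using elim by (simp add: add_divide_distrib diff_divide_distrib right_diff_distrib power2_eq_square)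
    qed
    also have "\<dots> < r"
      using elim by simp
    finally have "expectation (\<lambda>\<omega>. clip (2 * t) (xi \<omega>) ^ 3) / (t * trunc2 t) < r" .
    moreover have "0 \<le> expectation (\<lambda>\<omega>. clip (2 * t) (xi \<omega>) ^ 3) / (t * trunc2 t)"
      using elim clip_bounds(1)[of "2 * t"] by (intro divide_nonneg_pos Bochner_Integration.integral_nonneg) auto
    ultimately show ?case
      by simp
  qed
qed

lemma clip_mean_tendsto: "((\<lambda>t. expectation (\<lambda>\<omega>. clip (2 * t) (xi \<omega>))) \<longlongrightarrow> mu) at_top"
proof (rule tendsto_sandwich[where f = "\<lambda>t. mu - tail1 (2 * t)" and h = "\<lambda>t. mu"])
  show "((\<lambda>t. mu - tail1 (2 * t)) \<longlongrightarrow> mu) at_top"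
    using tendsto_diff[OF tendsto_const filterlim_compose[OF tail1_tendsto times_two_top], of mu] by simp
  show "\<forall>\<^sub>F t in at_top. mu - tail1 (2 * t) \<le> expectation (\<lambda>\<omega>. clip (2 * t) (xi \<omega>))"
    "\<forall>\<^sub>F t in at_top. expectation (\<lambda>\<omega>. clip (2 * t) (xi \<omega>)) \<le> mu"
    using eventually_gt_at_top[of 0] by (eventually_elim, simp add: clip_mean)+
qed simp

lemma integrated_tail_tendsto:
  "((\<lambda>t. 2 * (LBINT x:{0..t}. (LBINT z:{x..}. tail0 z)) / trunc2 t) \<longlongrightarrow> 1) at_top"
proof (rule tendsto_sandwich[where f = "\<lambda>t. 1" and h = "\<lambda>t. 1 + 2 * (t * tail1 t / trunc2 t)"])
  show "((\<lambda>t. 1 + 2 * (t * tail1 t / trunc2 t)) \<longlongrightarrow> 1) at_top"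
    using tendsto_add[OF tendsto_const tendsto_mult[OF tendsto_const tail1_small], of 1 2] by simp
  show "\<forall>\<^sub>F t in at_top. 1 \<le> 2 * (LBINT x:{0..t}. (LBINT z:{x..}. tail0 z)) / trunc2 t"
    using trunc2_pos eventually_gt_at_top[of 0]
    by eventually_elim (use integrated_tail_bounds(1) in \<open>simp add: le_divide_eq\<close>)
  show "\<forall>\<^sub>F t in at_top. 2 * (LBINT x:{0..t}. (LBINT z:{x..}. tail0 z)) / trunc2 t \<le> 1 + 2 * (t * tail1 t / trunc2 t)"
    using trunc2_pos eventually_gt_at_top[of 0]
  proof eventually_elim
    case (elim t)
    then show ?case
      using divide_right_mono[OF integrated_tail_bounds(2)[of t], of "trunc2 t"] by (simp add: add_divide_distrib)
  qed
qed simp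

end

section \<open>The second moment of the centred first passage time\<close>

context scaled_renewal
begin

text \<open>With steps clipped at \<open>2 * t\<close>, one has \<open>mu * N - t = B - S\<close>:
  \<open>S\<close> is the centred clipped sum, whose second moment is \<open>E N\<close> times the
  clipped variance, and \<open>B\<close> collects the bias \<open>(mu - m) * N\<close> of clipping
  and the overshoot \<open>R\<close>. The parameter \<open>r\<close> is the share of
  \<open>mu^2\<close> in the second moment: it is 0 for infinite variance and
  \<open>mu^2 / (s + mu^2)\<close> for variance \<open>s\<close>.\<close>

lemma deviation_second_moment_tendsto:
  assumes r: "((\<lambda>t. mu\<^sup>2 / trunc2 t) \<longlongrightarrow> r) at_top"
  shows "((\<lambda>t. expectation (\<lambda>\<omega>. (mu * N t \<omega> - t)\<^sup>2) / (t * trunc2 t)) \<longlongrightarrow> (1 - r) / mu) at_top"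
proof -
  \<comment> \<open>The overshoot bound needs a \<open>\<delta>\<close> that steps exceed with
    positive probability; half the mean qualifies, since otherwise the mean would be at most
    \<open>mu / 2\<close>.\<close>
  define \<delta> where "\<delta> = mu / 2"
  have \<delta>: "0 < \<delta>"
    using mu_pos by (simp add: \<delta>_def)
  define q where "q = tail0 \<delta>"
  have q: "0 < q"
  proof (rule ccontr)
    assume "\<not> 0 < q"
    then have "q = 0"
      using measure_nonneg[of M] by (simp add: q_def not_less antisym)
    then have "AE \<omega> in M. \<omega> \<notin> {\<omega>\<in>space M. \<delta> < xi \<omega>}"
      unfolding q_def by (subst (asm) prob_eq_0) auto
    then have "AE \<omega> in M. xi \<omega> \<le> \<delta>"
      using AE_space by eventually_elim auto
    then have "mu \<le> expectation (\<lambda>\<omega>. \<delta>)"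
      unfolding mu_def by (intro integral_mono_AE xi_int) auto
    then show False
      using mu_pos by (simp add: \<delta>_def prob_space)
  qed
  define m where "m = (\<lambda>t. expectation (\<lambda>\<omega>. clip (2 * t) (xi \<omega>)))"
  define v where "v = (\<lambda>t. expectation (\<lambda>\<omega>. (clip (2 * t) (xi \<omega>))\<^sup>2) - (m t)\<^sup>2)"
  define w where "w = (\<lambda>t. t * trunc2 t)"
  obtain C where C: "0 < C" "\<forall>\<^sub>F t in at_top. integrable M (\<lambda>\<omega>. exp (1 * (N t \<omega> / t))) \<and> expectation (\<lambda>\<omega>. exp (1 * (N t \<omega> / t))) \<le> C"
    by (rule exp_ratio_bound[of 1]) simp
  define A2 where "A2 = (\<lambda>t. mean_N t / t * (v t / trunc2 t))"
  \<comment> \<open>A bound for the second moment of \<open>B\<close> divided by \<open>w t\<close>.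
    The bias part uses \<open>0 \<le> mu - m t \<le> tail1 (2 * t)\<close> and
    \<open>E N^2 \<le> 2 * C * t^2\<close>; the overshoot part comes from
    \<open>overshoot_second_moment\<close>.\<close>
  define B2 where "B2 = (\<lambda>t. 4 * C * (t * tail1 (2 * t) / trunc2 t)\<^sup>2 * (trunc2 t / t)
      + 2 / q * (expectation (\<lambda>\<omega>. clip (2 * t) (xi \<omega>) ^ 3) / (t * trunc2 t) / \<delta>
         + expectation (\<lambda>\<omega>. (clip (2 * t) (xi \<omega>))\<^sup>2) / trunc2 t * (1 / t)))"
  have A2: "(A2 \<longlongrightarrow> 1 / mu * (1 - r)) at_top"
    unfolding A2_def
  proof (rule tendsto_mult[OF mean_ratio])
    have "((\<lambda>t. expectation (\<lambda>\<omega>. (clip (2 * t) (xi \<omega>))\<^sup>2) / trunc2 t - (m t)\<^sup>2 / mu\<^sup>2 * (mu\<^sup>2 / trunc2 t)) \<longlongrightarrow> 1 - mu\<^sup>2 / mu\<^sup>2 * r) at_top"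
      unfolding m_def using mu_pos by (intro tendsto_diff tendsto_mult tendsto_divide tendsto_power tendsto_const r clip_second_moment_tendsto clip_mean_tendsto) auto
    then show "((\<lambda>t. v t / trunc2 t) \<longlongrightarrow> 1 - r) at_top"
      using mu_pos by (simp add: v_def diff_divide_distrib)
  qed
  have inv0: "((\<lambda>t::real. 1 / t) \<longlongrightarrow> 0) at_top"
    by (intro tendsto_divide_0[OF tendsto_const] filterlim_at_top_imp_at_infinity filterlim_ident)
  have "(B2 \<longlongrightarrow> 4 * C * 0\<^sup>2 * 0 + 2 / q * (0 / \<delta> + 1 * 0)) at_top"
    unfolding B2_def using \<delta>
    by (intro tendsto_add tendsto_mult tendsto_power tendsto_const tendsto_divide tail1_ratio trunc2_small
        clip_third_moment_tendsto clip_second_moment_tendsto inv0) auto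
  then have B2: "(B2 \<longlongrightarrow> 0) at_top"
    by simp
  have "((\<lambda>t. expectation (\<lambda>\<omega>. (mu * N t \<omega> - t)\<^sup>2) / w t - A2 t) \<longlongrightarrow> 0) at_top"
  proof (rule tendstoI)
    fix d :: real assume d: "0 < d"
    define c where "c = \<bar>1 / mu * (1 - r)\<bar> + 1"
    have c: "0 < c"
      unfolding c_def by (rule add_nonneg_pos) auto
    \<comment> \<open>The weight in Young's inequality for the cross term: \<open>c\<close> exceeds
      the limit of \<open>A2\<close>, so \<open>\<eta> * A2\<close> tends to less than
      \<open>d\<close>, while the terms with \<open>B2\<close> vanish for this fixed
      \<open>\<eta>\<close>.\<close>
    define \<eta> where "\<eta> = d / c"
    have \<eta>: "0 < \<eta>"
      using c d by (simp add: \<eta>_def)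
    have "((\<lambda>t. B2 t + \<eta> * A2 t + B2 t / \<eta>) \<longlongrightarrow> 0 + \<eta> * (1 / mu * (1 - r)) + 0 / \<eta>) at_top"
      using \<eta> by (intro tendsto_add tendsto_mult tendsto_divide tendsto_const A2 B2) auto
    moreover have "0 + \<eta> * (1 / mu * (1 - r)) + 0 / \<eta> < d"
    proof -
      have "\<eta> * (1 / mu * (1 - r)) < \<eta> * c"
        using \<eta> abs_ge_self[of "1 / mu * (1 - r)"] unfolding c_def by (intro mult_strict_left_mono) linarith+
      then show ?thesis
        using c by (simp add: \<eta>_def)
    qed
    ultimately have ev: "\<forall>\<^sub>F t in at_top. B2 t + \<eta> * A2 t + B2 t / \<eta> < d"
      by (rule order_tendstoD(2))
    show "\<forall>\<^sub>F t in at_top. dist (expectation (\<lambda>\<omega>. (mu * N t \<omega> - t)\<^sup>2) / w t - A2 t) 0 < d"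
      using ev C(2) trunc2_pos eventually_gt_at_top[of 0]
    proof eventually_elim
      case (elim t)
      have t: "0 < t" "0 \<le> t" "t < 2 * t" "0 < 2 * t" and w: "0 < w t"
        using elim by (auto simp: w_def)
      define S where "S = (\<lambda>\<omega>. \<Sum>k<N t \<omega>. clip (2 * t) (X (Suc k) \<omega>) - m t)"
      define R where "R = (\<lambda>\<omega>. (\<Sum>k<N t \<omega>. clip (2 * t) (X (Suc k) \<omega>)) - t)"
      define B where "B = (\<lambda>\<omega>. (mu - m t) * N t \<omega> + R \<omega>)"
      have [measurable]: "S \<in> borel_measurable M" "R \<in> borel_measurable M" "B \<in> borel_measurable M"
        unfolding B_def S_def R_def
        using random_sum_measurable[of "\<lambda>x. clip (2 * t) x - m t" t] random_sum_measurable[of "clip (2 * t)" t] by measurable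
      have i1: "integrable M (\<lambda>\<omega>. clip (2 * t) (xi \<omega>))"
        using clip_integrable[of "2 * t" 1] t by simp
      have i2: "integrable M (\<lambda>\<omega>. (clip (2 * t) (xi \<omega>))\<^sup>2)"
        using clip_integrable[of "2 * t" 2] t by simp
      have em: "expectation (\<lambda>\<omega>. clip (2 * t) (xi \<omega>)) = m t"
        by (simp add: m_def)
      have eS0: "expectation (\<lambda>\<omega>. (clip (2 * t) (xi \<omega>) - m t)\<^sup>2) = v t"
      proof -
        have "expectation (\<lambda>\<omega>. (clip (2 * t) (xi \<omega>) - m t)\<^sup>2) = expectation (\<lambda>\<omega>. (clip (2 * t) (xi \<omega>))\<^sup>2 - 2 * m t * clip (2 * t) (xi \<omega>) + (m t)\<^sup>2)"
          by (simp add: power2_diff algebra_simps)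
        also have "\<dots> = expectation (\<lambda>\<omega>. (clip (2 * t) (xi \<omega>))\<^sup>2) - 2 * m t * m t + (m t)\<^sup>2"
          using i1 i2 by (simp add: em prob_space)
        finally show ?thesis
          by (simp add: v_def power2_eq_square)
      qed
      have S: "integrable M (\<lambda>\<omega>. (S \<omega>)\<^sup>2)" "expectation (\<lambda>\<omega>. (S \<omega>)\<^sup>2) = w t * A2 t"
      proof -
        have b: "\<bar>clip (2 * t) x - m t\<bar> \<le> 2 * t + \<bar>m t\<bar>" for x
          using clip_bounds[of "2 * t" x] t by linarith
        have z: "expectation (\<lambda>\<omega>. clip (2 * t) (xi \<omega>) - m t) = 0"
          using i1 by (simp add: em prob_space)
        have gm: "(\<lambda>x. clip (2 * t) x - m t) \<in> borel_measurable borel"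
          by measurable
        show "integrable M (\<lambda>\<omega>. (S \<omega>)\<^sup>2)"
          unfolding S_def by (rule wald_second(1)[OF t(2) gm b z])
        show "expectation (\<lambda>\<omega>. (S \<omega>)\<^sup>2) = w t * A2 t"
          unfolding S_def using wald_second(2)[OF t(2) gm b z] elim by (simp add: eS0 A2_def w_def)
      qed
      have R: "integrable M (\<lambda>\<omega>. (R \<omega>)\<^sup>2)"
         "expectation (\<lambda>\<omega>. (R \<omega>)\<^sup>2) \<le> (expectation (\<lambda>\<omega>. clip (2 * t) (xi \<omega>) ^ 3) / \<delta> + expectation (\<lambda>\<omega>. (clip (2 * t) (xi \<omega>))\<^sup>2)) / q"
      proof -
        note os = overshoot_second_moment[OF t(2,3) \<delta> q[unfolded q_def]]
        show "integrable M (\<lambda>\<omega>. (R \<omega>)\<^sup>2)"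
          unfolding R_def by (rule os(1))
        have "expectation (\<lambda>\<omega>. (clip (2 * t) (xi \<omega>))\<^sup>2 * (clip (2 * t) (xi \<omega>) / \<delta> + 1))
          = expectation (\<lambda>\<omega>. clip (2 * t) (xi \<omega>) ^ 3 / \<delta> + (clip (2 * t) (xi \<omega>))\<^sup>2)"
          by (simp add: power2_eq_square power3_eq_cube algebra_simps)
        also have "\<dots> = expectation (\<lambda>\<omega>. clip (2 * t) (xi \<omega>) ^ 3) / \<delta> + expectation (\<lambda>\<omega>. (clip (2 * t) (xi \<omega>))\<^sup>2)"
          using clip_integrable[of "2 * t" 3] i2 t by simp
        finally show "expectation (\<lambda>\<omega>. (R \<omega>)\<^sup>2) \<le> (expectation (\<lambda>\<omega>. clip (2 * t) (xi \<omega>) ^ 3) / \<delta> + expectation (\<lambda>\<omega>. (clip (2 * t) (xi \<omega>))\<^sup>2)) / q"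
          using os(2) unfolding R_def q_def by simp
      qed
      have iN: "integrable M (\<lambda>\<omega>. (real (N t \<omega>))\<^sup>2)"
        by (rule integrable_N_sq[OF t(2)])
      have eN: "expectation (\<lambda>\<omega>. (real (N t \<omega>))\<^sup>2) \<le> 2 * C * t\<^sup>2"
      proof -
        have le: "(real n)\<^sup>2 \<le> 2 * t\<^sup>2 * exp (1 * (n / t))" for n :: nat
        proof -
          have "0 \<le> real n / t"
            using t by simp
          then have "(real n / t)\<^sup>2 / 2 \<le> exp (real n / t)"
            using exp_lower_Taylor_quadratic[of "real n / t"] by linarith
          then show ?thesis
            using t by (simp add: field_simps)
        qed
        have "expectation (\<lambda>\<omega>. (real (N t \<omega>))\<^sup>2) \<le> expectation (\<lambda>\<omega>. 2 * t\<^sup>2 * exp (1 * (N t \<omega> / t)))"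
          using elim by (intro integral_mono iN integrable_mult_right le) auto
        also have "\<dots> = 2 * t\<^sup>2 * expectation (\<lambda>\<omega>. exp (1 * (N t \<omega> / t)))"
          by simp
        also have "\<dots> \<le> 2 * t\<^sup>2 * C"
          using elim by (intro mult_left_mono) auto
        finally show ?thesis by (simp add: mult_ac)
      qed
      have iU: "integrable M (\<lambda>\<omega>. 2 * (mu - m t)\<^sup>2 * (real (N t \<omega>))\<^sup>2 + 2 * (R \<omega>)\<^sup>2)"
        using iN R by simp
      have Ble: "(B \<omega>)\<^sup>2 \<le> 2 * (mu - m t)\<^sup>2 * (real (N t \<omega>))\<^sup>2 + 2 * (R \<omega>)\<^sup>2" for \<omega>
      proof -
        have "(x + y)\<^sup>2 \<le> 2 * x\<^sup>2 + 2 * y\<^sup>2" for x y :: real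
          using zero_le_power2[of "x - y"] unfolding power2_sum power2_diff by linarith
        from this[of "(mu - m t) * N t \<omega>" "R \<omega>"] show ?thesis
          by (simp add: B_def power_mult_distrib)
      qed
      have iB: "integrable M (\<lambda>\<omega>. (B \<omega>)\<^sup>2)"
        by (rule Bochner_Integration.integrable_bound[OF iU]) (use Ble in \<open>auto intro!: AE_I2 intro: order_trans[OF _ abs_ge_self]\<close>)
      have eB: "expectation (\<lambda>\<omega>. (B \<omega>)\<^sup>2) \<le> w t * B2 t"
      proof -
        have "expectation (\<lambda>\<omega>. (B \<omega>)\<^sup>2) \<le> expectation (\<lambda>\<omega>. 2 * (mu - m t)\<^sup>2 * (real (N t \<omega>))\<^sup>2 + 2 * (R \<omega>)\<^sup>2)"
          by (intro integral_mono iB iU Ble)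
        also have "\<dots> = 2 * (mu - m t)\<^sup>2 * expectation (\<lambda>\<omega>. (real (N t \<omega>))\<^sup>2) + 2 * expectation (\<lambda>\<omega>. (R \<omega>)\<^sup>2)"
          using iN R by simp
        also have "\<dots> \<le> 2 * (tail1 (2 * t))\<^sup>2 * (2 * C * t\<^sup>2)
           + 2 * ((expectation (\<lambda>\<omega>. clip (2 * t) (xi \<omega>) ^ 3) / \<delta> + expectation (\<lambda>\<omega>. (clip (2 * t) (xi \<omega>))\<^sup>2)) / q)"
        proof (intro add_mono mult_mono mult_left_mono eN R(2))
          show "(mu - m t)\<^sup>2 \<le> (tail1 (2 * t))\<^sup>2"
            unfolding m_def using clip_mean[OF t(4)] by (intro power_mono) auto
        qed (auto intro!: Bochner_Integration.integral_nonneg)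
        also have "\<dots> = w t * B2 t"
          using elim q \<delta> by (simp add: w_def B2_def field_simps power2_eq_square)
        finally show ?thesis .
      qed
      have dec: "mu * N t \<omega> - t = B \<omega> - S \<omega>" for \<omega>
        by (simp add: B_def S_def R_def sum_subtractf algebra_simps)
      \<comment> \<open>Young's inequality
        \<open>2 * \<bar>B * S\<bar> \<le> \<eta> * S^2 + B^2 / \<eta>\<close>, obtained from the
        squares of \<open>\<eta> * S - B\<close> and \<open>\<eta> * S + B\<close>.\<close>
      have cross: "\<bar>(B \<omega> - S \<omega>)\<^sup>2 - (S \<omega>)\<^sup>2\<bar> \<le> (B \<omega>)\<^sup>2 + \<eta> * (S \<omega>)\<^sup>2 + (B \<omega>)\<^sup>2 / \<eta>" for \<omega>
      proof -
        have "0 \<le> (\<eta> * S \<omega> - B \<omega>)\<^sup>2 / \<eta>" "0 \<le> (\<eta> * S \<omega> + B \<omega>)\<^sup>2 / \<eta>"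
          using \<eta> by auto
        then have "2 * (B \<omega> * S \<omega>) \<le> \<eta> * (S \<omega>)\<^sup>2 + (B \<omega>)\<^sup>2 / \<eta>" "- (2 * (B \<omega> * S \<omega>)) \<le> \<eta> * (S \<omega>)\<^sup>2 + (B \<omega>)\<^sup>2 / \<eta>"
          using \<eta> by (simp_all add: power2_eq_square field_simps)
        moreover have "(B \<omega> - S \<omega>)\<^sup>2 = (B \<omega>)\<^sup>2 - 2 * (B \<omega> * S \<omega>) + (S \<omega>)\<^sup>2"
          by (simp add: power2_diff)
        moreover have "0 \<le> (B \<omega>)\<^sup>2"
          by simp
        ultimately show ?thesis
          by linarith
      qed
      have iR: "integrable M (\<lambda>\<omega>. (B \<omega>)\<^sup>2 + \<eta> * (S \<omega>)\<^sup>2 + (B \<omega>)\<^sup>2 / \<eta>)"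
        using iB S by simp
      have iD': "integrable M (\<lambda>\<omega>. (B \<omega> - S \<omega>)\<^sup>2 - (S \<omega>)\<^sup>2)"
        by (rule Bochner_Integration.integrable_bound[OF iR]) (use cross in \<open>auto intro!: AE_I2 intro: order_trans[OF _ abs_ge_self]\<close>)
      have iD: "integrable M (\<lambda>\<omega>. (B \<omega> - S \<omega>)\<^sup>2)"
        using Bochner_Integration.integrable_add[OF iD' S(1)] by simp
      have "\<bar>expectation (\<lambda>\<omega>. (B \<omega> - S \<omega>)\<^sup>2) - expectation (\<lambda>\<omega>. (S \<omega>)\<^sup>2)\<bar> = \<bar>expectation (\<lambda>\<omega>. (B \<omega> - S \<omega>)\<^sup>2 - (S \<omega>)\<^sup>2)\<bar>"
        using iD S by simp
      also have "\<dots> \<le> expectation (\<lambda>\<omega>. (B \<omega>)\<^sup>2 + \<eta> * (S \<omega>)\<^sup>2 + (B \<omega>)\<^sup>2 / \<eta>)"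
        using norm_integral_le_AE[OF iD' iR] cross by simp
      also have "\<dots> = expectation (\<lambda>\<omega>. (B \<omega>)\<^sup>2) + \<eta> * expectation (\<lambda>\<omega>. (S \<omega>)\<^sup>2) + expectation (\<lambda>\<omega>. (B \<omega>)\<^sup>2) / \<eta>"
        using iB S by simp
      also have "\<dots> \<le> w t * B2 t + \<eta> * (w t * A2 t) + w t * B2 t / \<eta>"
        using eB \<eta> unfolding S(2) by (intro add_mono divide_right_mono) auto
      also have "\<dots> = w t * (B2 t + \<eta> * A2 t + B2 t / \<eta>)"
        by (simp add: algebra_simps)
      also have "\<dots> < w t * d"
        using elim w by (intro mult_strict_left_mono) auto
      finally have "\<bar>expectation (\<lambda>\<omega>. (B \<omega> - S \<omega>)\<^sup>2) - w t * A2 t\<bar> < w t * d"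
        by (simp only: S)
      then have "\<bar>(expectation (\<lambda>\<omega>. (B \<omega> - S \<omega>)\<^sup>2) - w t * A2 t) / w t\<bar> < d"
        using w by (simp add: abs_divide divide_less_eq mult.commute)
      then show ?case
        unfolding dec using w by (simp add: diff_divide_distrib)
    qed
  qed
  from tendsto_add[OF this A2] show ?thesis
    by (simp add: w_def)
qed

end

context renewal
begin

subsection \<open>The two variance cases\<close>

text \<open>A finite second moment makes \<open>trunc2\<close> converge to the positive limit
  \<open>s + mu^2\<close>, and so vary slowly. Non-degeneracy enters through \<open>s > 0\<close>:
  zero variance would force \<open>xi = mu\<close> almost surely. Since
  \<open>(a t)^2 = s / mu^3 * t\<close> exactly,
  \<open>L - mu^2 * L' = s * L' = mu^3\<close>.\<close>

lemma finite_variance_scaled: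
  assumes fv: "finite_variance_case M xi a" and nondeg: "\<forall>x>0. prob {\<omega>\<in>space M. xi \<omega> = x} < 1"
  obtains s where "0 < s" "(trunc2 \<longlongrightarrow> s + mu\<^sup>2) at_top" "((\<lambda>t. t / (a t)\<^sup>2) \<longlongrightarrow> mu ^ 3 / s) at_top"
    "scaled_renewal M xi X a (mu ^ 3 / s * (s + mu\<^sup>2)) (mu ^ 3 / s)"
proof -
  have fin: "(\<integral>\<^sup>+\<omega>. ennreal ((xi \<omega> - mu)\<^sup>2) \<partial>M) < \<infinity>"
    and a: "\<And>t. 0 \<le> t \<Longrightarrow> a t = sqrt (enn2real (\<integral>\<^sup>+\<omega>. ennreal ((xi \<omega> - mu)\<^sup>2) \<partial>M) * mu powr (-3) * t)"
    using fv by (auto simp: finite_variance_case_def ext_variance_def mu_def)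
  have i: "integrable M (\<lambda>\<omega>. (xi \<omega> - mu)\<^sup>2)"
    using fin by (intro integrableI_bounded) auto
  define s where "s = expectation (\<lambda>\<omega>. (xi \<omega> - mu)\<^sup>2)"
  have s_eq: "enn2real (\<integral>\<^sup>+\<omega>. ennreal ((xi \<omega> - mu)\<^sup>2) \<partial>M) = s"
    unfolding s_def by (rule integral_eq_nn_integral[symmetric]) auto
  have s0: "0 \<le> s"
    unfolding s_def by (intro Bochner_Integration.integral_nonneg) auto
  have "s \<noteq> 0"
  proof
    assume "s = 0"
    then have "AE \<omega> in M. (xi \<omega> - mu)\<^sup>2 = 0"
      unfolding s_def using i by (subst (asm) integral_nonneg_eq_0_iff_AE) auto
    then have "AE \<omega> in M. xi \<omega> = mu"
      by eventually_elim simp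
    then have "prob {\<omega>\<in>space M. xi \<omega> = mu} = 1"
      by (subst prob_Collect_eq_1) auto
    then show False
      using nondeg mu_pos by (metis less_irrefl)
  qed
  with s0 have s: "0 < s"
    by simp
  have i2: "integrable M (\<lambda>\<omega>. (xi \<omega>)\<^sup>2)"
  proof -
    have "integrable M (\<lambda>\<omega>. (xi \<omega> - mu)\<^sup>2 + 2 * mu * xi \<omega> - mu\<^sup>2)"
      using i xi_int by simp
    then show ?thesis
      by (simp add: power2_diff algebra_simps)
  qed
  have e2: "expectation (\<lambda>\<omega>. (xi \<omega>)\<^sup>2) = s + mu\<^sup>2"
  proof -
    have "s = expectation (\<lambda>\<omega>. (xi \<omega>)\<^sup>2 - 2 * mu * xi \<omega> + mu\<^sup>2)"
      unfolding s_def by (simp add: power2_diff algebra_simps)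
    also have "\<dots> = expectation (\<lambda>\<omega>. (xi \<omega>)\<^sup>2) - mu\<^sup>2"
      using i2 xi_int by (simp add: mu_def[symmetric] prob_space power2_eq_square)
    finally show ?thesis by simp
  qed
  have lim: "(trunc2 \<longlongrightarrow> s + mu\<^sup>2) at_top"
    unfolding trunc2_eq[abs_def] e2[symmetric]
  proof (rule integral_dominated_convergence_at_top[where w = "\<lambda>\<omega>. (xi \<omega>)\<^sup>2"])
    show "AE \<omega> in M. ((\<lambda>y. (xi \<omega>)\<^sup>2 * indicator {\<omega>. xi \<omega> \<le> y} \<omega>) \<longlongrightarrow> (xi \<omega>)\<^sup>2) at_top"
    proof (intro AE_I2 tendsto_eventually)
      fix \<omega>
      show "\<forall>\<^sub>F y in at_top. (xi \<omega>)\<^sup>2 * indicator {\<omega>. xi \<omega> \<le> y} \<omega> = (xi \<omega>)\<^sup>2"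
        using eventually_ge_at_top[of "xi \<omega>"] by eventually_elim auto
    qed
  qed (use i2 in \<open>auto simp: indicator_def\<close>)
  have pos: "0 < s + mu\<^sup>2"
    using s by (intro add_pos_nonneg) auto
  have sv: "slowly_varying trunc2"
    unfolding slowly_varying_def
  proof (intro conjI allI impI)
    show "\<forall>\<^sub>F t in at_top. 0 < trunc2 t"
      using lim pos by (rule order_tendstoD(1))
    fix x :: real assume x: "0 < x"
    have "filterlim (\<lambda>t. x * t) at_top at_top"
      using x by (intro filterlim_tendsto_pos_mult_at_top[OF tendsto_const] filterlim_ident)
    then have "((\<lambda>t. trunc2 (x * t) / trunc2 t) \<longlongrightarrow> (s + mu\<^sup>2) / (s + mu\<^sup>2)) at_top"
      using pos by (intro tendsto_divide lim filterlim_compose[OF lim]) auto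
    then show "((\<lambda>t. trunc2 (x * t) / trunc2 t) \<longlongrightarrow> 1) at_top"
      using pos by simp
  qed
  have a_eq: "a t = sqrt (s / mu ^ 3 * t)" if "0 \<le> t" for t
    using a[OF that] mu_pos unfolding s_eq by (simp add: powr_minus divide_inverse)
  have c: "0 < s / mu ^ 3"
    using s mu_pos by simp
  have a_top: "filterlim a at_top at_top"
  proof -
    have "filterlim (\<lambda>t. sqrt (s / mu ^ 3 * t)) at_top at_top"
      by (intro filterlim_compose[OF sqrt_at_top] filterlim_tendsto_pos_mult_at_top[OF tendsto_const] filterlim_ident c)
    moreover have "\<forall>\<^sub>F t in at_top. sqrt (s / mu ^ 3 * t) = a t"
      using eventually_ge_at_top[of 0] by eventually_elim (simp only: a_eq)
    ultimately show ?thesis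
      by (simp cong: filterlim_cong)
  qed
  have L': "((\<lambda>t. t / (a t)\<^sup>2) \<longlongrightarrow> mu ^ 3 / s) at_top"
  proof (rule tendsto_eventually)
    show "\<forall>\<^sub>F t in at_top. t / (a t)\<^sup>2 = mu ^ 3 / s"
      using eventually_gt_at_top[of 0]
    proof eventually_elim
      case (elim t)
      have "(a t)\<^sup>2 = s / mu ^ 3 * t"
        using elim mult_nonneg_nonneg[OF less_imp_le[OF c], of t] a_eq[of t] by (simp only: real_sqrt_pow2 less_imp_le)
      then show ?case
        using elim s mu_pos by simp
    qed
  qed
  have L: "((\<lambda>t. t * trunc2 (a t) / (a t)\<^sup>2) \<longlongrightarrow> mu ^ 3 / s * (s + mu\<^sup>2)) at_top"
    using tendsto_mult[OF L' filterlim_compose[OF lim a_top]] by simp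
  have rel: "mu ^ 3 / s * (s + mu\<^sup>2) - mu\<^sup>2 * (mu ^ 3 / s) = mu ^ 3"
    using s by (simp add: field_simps)
  have "scaled_renewal M xi X a (mu ^ 3 / s * (s + mu\<^sup>2)) (mu ^ 3 / s)"
    by unfold_locales (fact sv a_top L' L rel)+
  then show thesis
    using that s lim L' by blast
qed

text \<open>Being monotone, \<open>trunc2\<close> could fail to diverge only by staying bounded, and
  then Fatou's lemma would give a finite second moment. The divergence is what makes
  \<open>mu^2\<close> negligible in the infinite variance case.\<close>

lemma trunc2_at_top:
  assumes "ext_variance M xi = \<infinity>"
  shows "filterlim trunc2 at_top at_top"
proof (rule ccontr)
  assume "\<not> ?thesis"
  then obtain K where K: "\<not> (\<forall>\<^sub>F t in at_top. K \<le> trunc2 t)"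
    by (auto simp: filterlim_at_top)
  have lt: "trunc2 t \<le> K" for t
  proof (rule ccontr)
    assume "\<not> trunc2 t \<le> K"
    then have "\<forall>\<^sub>F y in at_top. K \<le> trunc2 y"
      using trunc2_mono[of t] by (intro eventually_mono[OF eventually_ge_at_top[of t]]) force
    then show False
      using K by simp
  qed
  have "(\<integral>\<^sup>+\<omega>. ennreal ((xi \<omega>)\<^sup>2) \<partial>M) \<le> (\<integral>\<^sup>+\<omega>. liminf (\<lambda>n. ennreal ((xi \<omega>)\<^sup>2 * indicator {\<omega>. xi \<omega> \<le> real n} \<omega>)) \<partial>M)"
  proof (intro nn_integral_mono)
    fix \<omega>
    have "(\<lambda>n. ennreal ((xi \<omega>)\<^sup>2 * indicator {\<omega>. xi \<omega> \<le> real n} \<omega>)) \<longlonglongrightarrow> ennreal ((xi \<omega>)\<^sup>2)"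
    proof (rule tendsto_eventually)
      have "\<forall>\<^sub>F n in sequentially. xi \<omega> \<le> real n"
        using filterlim_real_sequentially by (simp add: filterlim_at_top)
      then show "\<forall>\<^sub>F n in sequentially. ennreal ((xi \<omega>)\<^sup>2 * indicator {\<omega>. xi \<omega> \<le> real n} \<omega>) = ennreal ((xi \<omega>)\<^sup>2)"
        by eventually_elim simp
    qed
    then show "ennreal ((xi \<omega>)\<^sup>2) \<le> liminf (\<lambda>n. ennreal ((xi \<omega>)\<^sup>2 * indicator {\<omega>. xi \<omega> \<le> real n} \<omega>))"
      by (simp only: lim_imp_Liminf[OF sequentially_bot] order_refl)
  qed
  also have "\<dots> \<le> liminf (\<lambda>n. \<integral>\<^sup>+\<omega>. ennreal ((xi \<omega>)\<^sup>2 * indicator {\<omega>. xi \<omega> \<le> real n} \<omega>) \<partial>M)"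
    by (intro nn_integral_liminf) measurable
  also have "\<dots> \<le> ennreal K"
  proof (intro Liminf_le always_eventually allI)
    fix n :: nat
    have "(\<integral>\<^sup>+\<omega>. ennreal ((xi \<omega>)\<^sup>2 * indicator {\<omega>. xi \<omega> \<le> real n} \<omega>) \<partial>M) = ennreal (trunc2 n)"
      unfolding trunc2_eq by (intro nn_integral_eq_integral trunc2_int) auto
    then show "(\<integral>\<^sup>+\<omega>. ennreal ((xi \<omega>)\<^sup>2 * indicator {\<omega>. xi \<omega> \<le> real n} \<omega>) \<partial>M) \<le> ennreal K"
      using lt[of n] by (simp add: ennreal_leI)
  qed simp
  finally have "integrable M (\<lambda>\<omega>. (xi \<omega>)\<^sup>2)"
    by (intro integrableI_bounded) (auto simp: less_top[symmetric] top_unique)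
  then have "integrable M (\<lambda>\<omega>. (xi \<omega>)\<^sup>2 - 2 * mu * xi \<omega> + mu\<^sup>2)"
    using xi_int by simp
  then have "integrable M (\<lambda>\<omega>. (xi \<omega> - mu)\<^sup>2)"
    by (simp add: power2_diff algebra_simps)
  then have "(\<integral>\<^sup>+\<omega>. ennreal ((xi \<omega> - mu)\<^sup>2) \<partial>M) < \<infinity>"
    by (subst nn_integral_eq_integral) auto
  then show False
    using assms by (simp add: ext_variance_def mu_def)
qed

text \<open>Slow variation allows \<open>trunc2 (c t)\<close> to be replaced by
  \<open>trunc2 (b * c t)\<close>, so \<open>a = b * c\<close> inherits the defining relation of
  \<open>c\<close> up to the factor \<open>1 / b^2 = mu^3\<close>. Dividing that relation by the
  diverging \<open>trunc2 (c t)\<close> gives \<open>L' = 0\<close>.\<close>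

lemma infinite_variance_scaled:
  assumes iv: "infinite_variance_case M xi c a"
  shows "scaled_renewal M xi X a (mu ^ 3) 0" "filterlim trunc2 at_top at_top"
proof -
  have var: "ext_variance M xi = \<infinity>" and sv: "slowly_varying trunc2" and c_pos: "\<And>t. 0 < t \<Longrightarrow> 0 < c t"
    and c_top: "filterlim c at_top at_top"
    and c_lim: "((\<lambda>t. t * trunc2 (c t) / (c t)\<^sup>2) \<longlongrightarrow> 1) at_top"
    and a_eq: "\<And>t. 0 < t \<Longrightarrow> a t = mu powr (-3/2) * c t"
    using iv by (auto simp: infinite_variance_case_def mu_def)
  show top: "filterlim trunc2 at_top at_top"
    by (rule trunc2_at_top[OF var])
  define b where "b = mu powr (-3/2)"
  have b: "0 < b"
    using mu_pos by (simp add: b_def)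
  have "b\<^sup>2 = mu powr (-3)"
    unfolding b_def power2_eq_square powr_add[symmetric] by simp
  then have b2: "b\<^sup>2 = 1 / mu ^ 3"
    using mu_pos by (simp add: powr_minus divide_inverse)
  have ev: "\<forall>\<^sub>F t in at_top. a t = b * c t"
    using eventually_gt_at_top[of 0] by eventually_elim (simp add: a_eq b_def)
  have a_top: "filterlim a at_top at_top"
  proof -
    have "filterlim (\<lambda>t. b * c t) at_top at_top"
      by (intro filterlim_tendsto_pos_mult_at_top[OF tendsto_const] c_top b)
    moreover have "\<forall>\<^sub>F t in at_top. b * c t = a t"
      using ev by eventually_elim simp
    ultimately show ?thesis
      by (simp cong: filterlim_cong)
  qed
  have pos: "\<forall>\<^sub>F t in at_top. 0 < trunc2 (c t)"
    using sv by (auto simp: slowly_varying_def intro: eventually_compose_filterlim[OF _ c_top])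
  have inv0: "((\<lambda>t. 1 / trunc2 (c t)) \<longlongrightarrow> 0) at_top"
    by (intro tendsto_divide_0[OF tendsto_const] filterlim_at_top_imp_at_infinity filterlim_compose[OF top c_top])
  have L': "((\<lambda>t. t / (a t)\<^sup>2) \<longlongrightarrow> 0) at_top"
  proof -
    have "((\<lambda>t. mu ^ 3 * ((t * trunc2 (c t) / (c t)\<^sup>2) * (1 / trunc2 (c t)))) \<longlongrightarrow> mu ^ 3 * (1 * 0)) at_top"
      by (intro tendsto_mult tendsto_const c_lim inv0)
    moreover have "\<forall>\<^sub>F t in at_top. mu ^ 3 * ((t * trunc2 (c t) / (c t)\<^sup>2) * (1 / trunc2 (c t))) = t / (a t)\<^sup>2"
      using ev pos by eventually_elim (simp add: power_mult_distrib b2)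
    ultimately show ?thesis
      using Lim_transform_eventually by fastforce
  qed
  have L: "((\<lambda>t. t * trunc2 (a t) / (a t)\<^sup>2) \<longlongrightarrow> mu ^ 3) at_top"
  proof -
    have "((\<lambda>t. trunc2 (b * c t) / trunc2 (c t)) \<longlongrightarrow> 1) at_top"
      using sv b unfolding slowly_varying_def by (auto intro: filterlim_compose[OF _ c_top])
    then have "((\<lambda>t. mu ^ 3 * ((t * trunc2 (c t) / (c t)\<^sup>2) * (trunc2 (b * c t) / trunc2 (c t)))) \<longlongrightarrow> mu ^ 3 * (1 * 1)) at_top"
      by (intro tendsto_mult tendsto_const c_lim)
    moreover have "\<forall>\<^sub>F t in at_top. mu ^ 3 * ((t * trunc2 (c t) / (c t)\<^sup>2) * (trunc2 (b * c t) / trunc2 (c t))) = t * trunc2 (a t) / (a t)\<^sup>2"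
      using ev pos by eventually_elim (simp add: power_mult_distrib b2)
    ultimately show ?thesis
      using Lim_transform_eventually by fastforce
  qed
  have rel: "mu ^ 3 - mu\<^sup>2 * 0 = mu ^ 3"
    by simp
  show "scaled_renewal M xi X a (mu ^ 3) 0"
    by unfold_locales (fact sv a_top L' L rel)+
qed

end

section \<open>The endpoint \<open>p = 2\<close> and the second moment asymptotics\<close>

context scaled_renewal
begin

lemma Z_sq: "(Z t \<omega>)\<^sup>2 = (mu * N t \<omega> - t)\<^sup>2 / (mu\<^sup>2 * (a t)\<^sup>2)"
proof -
  have "Z t \<omega> = (mu * N t \<omega> - t) / (mu * a t)"
    using mu_pos by (simp add: Z_def diff_divide_distrib)
  then show ?thesis
    by (simp add: power_divide power_mult_distrib)
qed

text \<open>Uniform integrability cannot be drawn from a larger exponent here. Instead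
  \<open>E Z^2\<close> tends to 1, the Gaussian second moment, and the convergence of the positive
  part is subtracted. That \<open>trunc2\<close> has a finite limit is essential: its values at
  \<open>t\<close> and at \<open>a t\<close> then agree asymptotically.\<close>

lemma neg_part_2_Z_tendsto:
  assumes s: "0 < s" and lim: "(trunc2 \<longlongrightarrow> s + mu\<^sup>2) at_top" and lima: "((\<lambda>t. t / (a t)\<^sup>2) \<longlongrightarrow> mu ^ 3 / s) at_top"
  shows "((\<lambda>t. expectation (\<lambda>\<omega>. neg_part_pow 2 (Z t \<omega>))) \<longlongrightarrow> (\<integral>x. neg_part_pow 2 x \<partial>std_normal_distribution)) at_top"
proof -
  have pos: "0 < s + mu\<^sup>2"
    using s by (intro add_pos_nonneg) auto
  have r: "((\<lambda>t. mu\<^sup>2 / trunc2 t) \<longlongrightarrow> mu\<^sup>2 / (s + mu\<^sup>2)) at_top"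
    using pos by (intro tendsto_divide tendsto_const lim) auto
  have split: "x\<^sup>2 = pos_part_pow 2 x + neg_part_pow 2 x" for x :: real
    by (cases "0 \<le> x") (auto simp: pos_part_pow_def neg_part_pow_def max_def min_def)
  have "((\<lambda>t. expectation (\<lambda>\<omega>. (mu * N t \<omega> - t)\<^sup>2) / (t * trunc2 t) * (t / (a t)\<^sup>2 * trunc2 t / mu\<^sup>2))
    \<longlongrightarrow> (1 - mu\<^sup>2 / (s + mu\<^sup>2)) / mu * (mu ^ 3 / s * (s + mu\<^sup>2) / mu\<^sup>2)) at_top"
    using mu_pos by (intro tendsto_mult tendsto_divide tendsto_const lim lima deviation_second_moment_tendsto[OF r]) auto
  also have "(1 - mu\<^sup>2 / (s + mu\<^sup>2)) / mu * (mu ^ 3 / s * (s + mu\<^sup>2) / mu\<^sup>2) = 1"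
  proof -
    have "1 - mu\<^sup>2 / (s + mu\<^sup>2) = s / (s + mu\<^sup>2)"
      using pos by (simp add: field_simps)
    then show ?thesis
      using pos s mu_pos by (simp add: power3_eq_cube power2_eq_square)
  qed
  finally have lim2: "((\<lambda>t. expectation (\<lambda>\<omega>. (mu * N t \<omega> - t)\<^sup>2) / (t * trunc2 t) * (t / (a t)\<^sup>2 * trunc2 t / mu\<^sup>2)) \<longlongrightarrow> 1) at_top" .
  obtain C where C: "\<forall>\<^sub>F t in at_top. integrable M (\<lambda>\<omega>. pos_part_pow 2 (Z t \<omega>)) \<and> expectation (\<lambda>\<omega>. pos_part_pow 2 (Z t \<omega>)) \<le> C"
    by (rule pos_part_bound[of 2]) simp
  have std2: "(\<integral>x. x\<^sup>2 \<partial>std_normal_distribution) = 1"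
    using std_normal_distribution_even_moments(1)[of 1] by (simp add: fact_numeral)
  have ip: "integrable std_normal_distribution (pos_part_pow 2)" "integrable std_normal_distribution (neg_part_pow 2)"
    using has_bochner_integral_std_normal_pos_part[of 2] has_bochner_integral_std_normal_neg_part[of 2]
    by (auto simp: has_bochner_integral_iff)
  have std: "(\<integral>x. neg_part_pow 2 x \<partial>std_normal_distribution) = 1 - (\<integral>x. pos_part_pow 2 x \<partial>std_normal_distribution)"
    using std2 ip unfolding split by simp
  have "((\<lambda>t. expectation (\<lambda>\<omega>. (mu * N t \<omega> - t)\<^sup>2) / (t * trunc2 t) * (t / (a t)\<^sup>2 * trunc2 t / mu\<^sup>2) - expectation (\<lambda>\<omega>. pos_part_pow 2 (Z t \<omega>)))
    \<longlongrightarrow> 1 - (\<integral>x. pos_part_pow 2 x \<partial>std_normal_distribution)) at_top"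
    by (intro tendsto_diff lim2 pos_part_Z_tendsto) simp
  moreover have "\<forall>\<^sub>F t in at_top. expectation (\<lambda>\<omega>. (mu * N t \<omega> - t)\<^sup>2) / (t * trunc2 t) * (t / (a t)\<^sup>2 * trunc2 t / mu\<^sup>2) - expectation (\<lambda>\<omega>. pos_part_pow 2 (Z t \<omega>))
     = expectation (\<lambda>\<omega>. neg_part_pow 2 (Z t \<omega>))"
    using C trunc2_pos eventually_gt_at_top[of 0]
  proof eventually_elim
    case (elim t)
    have iN: "integrable M (\<lambda>\<omega>. (mu * N t \<omega> - t)\<^sup>2)"
      unfolding power2_diff power_mult_distrib using integrable_N_sq[of t] integrable_N[of t] elim by simp
    have iZ: "integrable M (\<lambda>\<omega>. (Z t \<omega>)\<^sup>2)"
      unfolding Z_sq using iN by simp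
    have "integrable M (\<lambda>\<omega>. (Z t \<omega>)\<^sup>2 - pos_part_pow 2 (Z t \<omega>))"
      using iZ elim by simp
    then have "integrable M (\<lambda>\<omega>. neg_part_pow 2 (Z t \<omega>))"
      unfolding split by simp
    then have "expectation (\<lambda>\<omega>. (Z t \<omega>)\<^sup>2) = expectation (\<lambda>\<omega>. pos_part_pow 2 (Z t \<omega>)) + expectation (\<lambda>\<omega>. neg_part_pow 2 (Z t \<omega>))"
      unfolding split using elim by simp
    moreover have "expectation (\<lambda>\<omega>. (Z t \<omega>)\<^sup>2) = expectation (\<lambda>\<omega>. (mu * N t \<omega> - t)\<^sup>2) / (t * trunc2 t) * (t / (a t)\<^sup>2 * trunc2 t / mu\<^sup>2)"
      unfolding Z_sq using elim by simp
    ultimately show ?case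
      by simp
  qed
  ultimately show ?thesis
    unfolding std by (rule Lim_transform_eventually)
qed

text \<open>With \<open>r = 0\<close> the second moment of \<open>N - t / mu\<close> is asymptotic
  to \<open>t * trunc2 t / mu^3\<close>, and \<open>integrated_tail_tendsto\<close> identifies
  \<open>trunc2 t\<close> with twice the iterated tail integral.\<close>

lemma second_moment_asymptotics:
  assumes top: "filterlim trunc2 at_top at_top"
  shows "((\<lambda>t. expectation (\<lambda>\<omega>. (real (N t \<omega>) - t / mu)\<^sup>2) /
      (2 * t / mu ^ 3 * (LBINT x:{0..t}. (LBINT z:{x..}. tail0 z)))) \<longlongrightarrow> 1) at_top"
proof -
  define I where "I = (\<lambda>t. LBINT x:{0..t}. (LBINT z:{x..}. tail0 z))"
  have r: "((\<lambda>t. mu\<^sup>2 / trunc2 t) \<longlongrightarrow> 0) at_top"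
    by (intro tendsto_divide_0[OF tendsto_const] filterlim_at_top_imp_at_infinity top)
  have I: "((\<lambda>t. 2 * I t / trunc2 t) \<longlongrightarrow> 1) at_top"
    unfolding I_def by (rule integrated_tail_tendsto)
  have "((\<lambda>t. mu * (expectation (\<lambda>\<omega>. (mu * N t \<omega> - t)\<^sup>2) / (t * trunc2 t)) / (2 * I t / trunc2 t)) \<longlongrightarrow> mu * ((1 - 0) / mu) / 1) at_top"
    by (intro tendsto_divide tendsto_mult tendsto_const I deviation_second_moment_tendsto[OF r]) simp
  then have "((\<lambda>t. mu * (expectation (\<lambda>\<omega>. (mu * N t \<omega> - t)\<^sup>2) / (t * trunc2 t)) / (2 * I t / trunc2 t)) \<longlongrightarrow> 1) at_top"
    using mu_pos by simp
  moreover have "\<forall>\<^sub>F t in at_top. mu * (expectation (\<lambda>\<omega>. (mu * N t \<omega> - t)\<^sup>2) / (t * trunc2 t)) / (2 * I t / trunc2 t)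
     = expectation (\<lambda>\<omega>. (real (N t \<omega>) - t / mu)\<^sup>2) / (2 * t / mu ^ 3 * I t)"
    using trunc2_pos eventually_gt_at_top[of 0]
  proof eventually_elim
    case (elim t)
    have "(real n - t / mu)\<^sup>2 = (mu * n - t)\<^sup>2 / mu\<^sup>2" for n
      using mu_pos by (simp add: power_divide[symmetric] diff_divide_distrib)
    then have "expectation (\<lambda>\<omega>. (real (N t \<omega>) - t / mu)\<^sup>2) = expectation (\<lambda>\<omega>. (mu * N t \<omega> - t)\<^sup>2) / mu\<^sup>2"
      by simp
    then show ?case
      using elim mu_pos by (simp add: power2_eq_square power3_eq_cube mult_ac)
  qed
  ultimately show ?thesis
    unfolding I_def by (rule Lim_transform_eventually)
qed

end

section \<open>Transfer to the variable \<open>W\<close> and conclusion for both variance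
  cases\<close>

lemma expectation_std_normal:
  fixes f :: "real \<Rightarrow> real"
  assumes "distributed M' lborel W (\<lambda>x. ennreal (std_normal_density x))" and [measurable]: "f \<in> borel_measurable borel"
  shows "(\<integral>\<omega>. f (W \<omega>) \<partial>M') = (\<integral>x. f x \<partial>std_normal_distribution)"
proof -
  have W: "distr M' lborel W = std_normal_distribution" "W \<in> measurable M' lborel"
    using assms(1) by (auto simp: distributed_def)
  have "(\<integral>x. f x \<partial>std_normal_distribution) = (\<integral>x. f x \<partial>distr M' lborel W)"
    by (simp only: W)
  also have "\<dots> = (\<integral>\<omega>. f (W \<omega>) \<partial>M')"
    using W by (intro integral_distr) auto
  finally show ?thesis ..
qed

theorem theorem1p1:
  fixes M :: "'a measure" and \<xi> :: "'a \<Rightarrow> real" and \<xi>s :: "nat \<Rightarrow> 'a \<Rightarrow> real"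
    and M' :: "'b measure" and W :: "'b \<Rightarrow> real"
    and \<mu> :: real and a c :: "real \<Rightarrow> real" and N :: "real \<Rightarrow> 'a \<Rightarrow> nat"
  assumes "prob_space M"
    and "\<xi> \<in> borel_measurable M"
    and "AE \<omega> in M. 0 < \<xi> \<omega>"
    and "\<forall>x>0. measure M {\<omega> \<in> space M. \<xi> \<omega> = x} < 1"
    and "prob_space.indep_vars M (\<lambda>_. borel) \<xi>s {1..}"
    and "\<forall>k\<ge>1. distr M borel (\<xi>s k) = distr M borel \<xi>"
    and "N = first_passage \<xi>s"
    and "integrable M \<xi>"
    and "\<mu> = prob_space.expectation M \<xi>"
    and "finite_variance_case M \<xi> a \<or> infinite_variance_case M \<xi> c a"
    and "prob_space M'"
    and "distributed M' lborel W (\<lambda>x. ennreal (std_normal_density x))"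
  shows
    "(\<forall>\<theta>\<ge>0.
        ((\<lambda>t. prob_space.expectation M (\<lambda>\<omega>. exp (\<theta> * ((real (N t \<omega>) - t / \<mu>) / a t))))
           \<longlongrightarrow> prob_space.expectation M' (\<lambda>\<omega>. exp (\<theta> * W \<omega>))) at_top \<and>
        prob_space.expectation M' (\<lambda>\<omega>. exp (\<theta> * W \<omega>)) = exp (\<theta>\<^sup>2 / 2)) \<and>
     (\<forall>p>0.
        ((\<lambda>t. prob_space.expectation M (\<lambda>\<omega>. pos_part_pow p ((real (N t \<omega>) - t / \<mu>) / a t)))
           \<longlongrightarrow> prob_space.expectation M' (\<lambda>\<omega>. pos_part_pow p (W \<omega>))) at_top \<and>
        prob_space.expectation M' (\<lambda>\<omega>. pos_part_pow p (W \<omega>))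
          = 2 powr (p / 2 - 1) * Gamma ((p + 1) / 2) / sqrt pi) \<and>
     (finite_variance_case M \<xi> a \<longrightarrow>
       (\<forall>p. 0 \<le> p \<and> p \<le> 2 \<longrightarrow>
          ((\<lambda>t. prob_space.expectation M (\<lambda>\<omega>. neg_part_pow p ((real (N t \<omega>) - t / \<mu>) / a t)))
             \<longlongrightarrow> prob_space.expectation M' (\<lambda>\<omega>. neg_part_pow p (W \<omega>))) at_top \<and>
          prob_space.expectation M' (\<lambda>\<omega>. neg_part_pow p (W \<omega>))
            = 2 powr (p / 2 - 1) * Gamma ((p + 1) / 2) / sqrt pi)) \<and>
     (infinite_variance_case M \<xi> c a \<longrightarrow>
       (\<forall>p. 0 \<le> p \<and> p < 2 \<longrightarrow>
          ((\<lambda>t. prob_space.expectation M (\<lambda>\<omega>. neg_part_pow p ((real (N t \<omega>) - t / \<mu>) / a t)))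
             \<longlongrightarrow> prob_space.expectation M' (\<lambda>\<omega>. neg_part_pow p (W \<omega>))) at_top \<and>
          prob_space.expectation M' (\<lambda>\<omega>. neg_part_pow p (W \<omega>))
            = 2 powr (p / 2 - 1) * Gamma ((p + 1) / 2) / sqrt pi) \<and>
       ((\<lambda>t. prob_space.expectation M (\<lambda>\<omega>. (real (N t \<omega>) - t / \<mu>)\<^sup>2) /
             (2 * t / \<mu> ^ 3 *
               (LBINT x:{0..t}. (LBINT z:{x..}. measure M {\<omega> \<in> space M. z < \<xi> \<omega>}))))
          \<longlongrightarrow> 1) at_top)"
proof -
  interpret prob_space M by fact
  interpret R: renewal M \<xi> \<xi>s
    using assms by unfold_locales auto
  have mu: "\<mu> = R.mu"
    by (simp add: R.mu_def assms(9))
  note W = expectation_std_normal[OF assms(12)]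
  have We: "prob_space.expectation M' (\<lambda>\<omega>. exp (\<theta> * W \<omega>)) = (\<integral>x. exp (\<theta> * x) \<partial>std_normal_distribution)"
    and Wp: "prob_space.expectation M' (\<lambda>\<omega>. pos_part_pow p (W \<omega>)) = (\<integral>x. pos_part_pow p x \<partial>std_normal_distribution)"
    and Wn: "prob_space.expectation M' (\<lambda>\<omega>. neg_part_pow p (W \<omega>)) = (\<integral>x. neg_part_pow p x \<partial>std_normal_distribution)" for \<theta> p
    by (rule W; measurable)+
  have Ie: "(\<integral>x. exp (\<theta> * x) \<partial>std_normal_distribution) = exp (\<theta>\<^sup>2 / 2)" for \<theta>
    by (rule has_bochner_integral_integral_eq[OF has_bochner_integral_std_normal_exp])
  have Ip: "(\<integral>x. pos_part_pow p x \<partial>std_normal_distribution) = 2 powr (p / 2 - 1) * Gamma ((p + 1) / 2) / sqrt pi" if "0 \<le> p" for p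
    by (rule has_bochner_integral_integral_eq[OF has_bochner_integral_std_normal_pos_part[OF that]])
  have In: "(\<integral>x. neg_part_pow p x \<partial>std_normal_distribution) = 2 powr (p / 2 - 1) * Gamma ((p + 1) / 2) / sqrt pi" if "0 \<le> p" for p
    by (rule has_bochner_integral_integral_eq[OF has_bochner_integral_std_normal_neg_part[OF that]])
  \<comment> \<open>The values of \<open>L\<close> and \<open>L'\<close> differ between the cases,
    but the exponential moments, the positive part and the negative part for \<open>p < 2\<close>
    depend only on the locale; the case is consulted again only for \<open>p = 2\<close> and for the
    second moment.\<close>
  obtain L L' where "scaled_renewal M \<xi> \<xi>s a L L'"
    using assms(10) R.finite_variance_scaled[OF _ assms(4)] R.infinite_variance_scaled(1) by metis
  then interpret S: scaled_renewal M \<xi> \<xi>s a L L' .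
  have Z: "(real (N t \<omega>) - t / \<mu>) / a t = S.Z t \<omega>" for t \<omega>
    by (simp add: S.Z_def mu assms(7))
  have e: "((\<lambda>t. expectation (\<lambda>\<omega>. exp (\<theta> * S.Z t \<omega>))) \<longlongrightarrow> (\<integral>x. exp (\<theta> * x) \<partial>std_normal_distribution)) at_top" if "0 \<le> \<theta>" for \<theta>
    by (rule S.exp_Z_tendsto[OF that])
  have p: "((\<lambda>t. expectation (\<lambda>\<omega>. pos_part_pow p (S.Z t \<omega>))) \<longlongrightarrow> (\<integral>x. pos_part_pow p x \<partial>std_normal_distribution)) at_top" if "0 < p" for p
    by (rule S.pos_part_Z_tendsto[OF that])
  have n: "((\<lambda>t. expectation (\<lambda>\<omega>. neg_part_pow p (S.Z t \<omega>))) \<longlongrightarrow> (\<integral>x. neg_part_pow p x \<partial>std_normal_distribution)) at_top" if "0 \<le> p" "p < 2" for p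
    by (rule S.neg_part_Z_tendsto_less_2[OF that])
  have n2: "((\<lambda>t. expectation (\<lambda>\<omega>. neg_part_pow p (S.Z t \<omega>))) \<longlongrightarrow> (\<integral>x. neg_part_pow p x \<partial>std_normal_distribution)) at_top"
    if "finite_variance_case M \<xi> a" "0 \<le> p" "p \<le> 2" for p
  proof (cases "p = 2")
    case True
    obtain s where "0 < s" "(R.trunc2 \<longlongrightarrow> s + R.mu\<^sup>2) at_top" "((\<lambda>t. t / (a t)\<^sup>2) \<longlongrightarrow> R.mu ^ 3 / s) at_top"
      using R.finite_variance_scaled[OF \<open>finite_variance_case M \<xi> a\<close> assms(4)] by blast
    then show ?thesis
      unfolding True by (rule S.neg_part_2_Z_tendsto)
  next
    case False
    then show ?thesis
      using that by (intro n) auto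
  qed
  have sm: "((\<lambda>t. expectation (\<lambda>\<omega>. (real (N t \<omega>) - t / \<mu>)\<^sup>2) /
             (2 * t / \<mu> ^ 3 * (LBINT x:{0..t}. (LBINT z:{x..}. prob {\<omega> \<in> space M. z < \<xi> \<omega>}))))
          \<longlongrightarrow> 1) at_top" if "infinite_variance_case M \<xi> c a"
    unfolding mu assms(7) by (rule S.second_moment_asymptotics[OF R.infinite_variance_scaled(2)[OF that]])
  show ?thesis
    unfolding Z We Wp Wn
    by (intro conjI allI impI; (elim conjE)?; (rule e p n n2 sm Ie Ip In)?; simp?)
qed

end
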